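(* \textsc{MaxAvgCut} is polynomial-time many-one (Karp) reducible to \textsc{ThinTreeValid}$^{C}$. Here \textsc{MaxAvgCut} is the decision problem: given a connected multigraph $G$ with edge weights $w_e \in \{-1,1\}$ and a rational number $k \ge -1$, output YES if there is a nontrivial partition $(A,B)$ of $V(G)$ with $\left(\sum_{e\in\delta(A)} w_e\right)/|\delta(A)| \ge k$, and NO otherwise. \textsc{ThinTreeValid}$^{C}$ is the decision problem: given a connected graph $G$, a spanning tree $T$ of $G$, and a value $\alpha\in[0,1]$, output NO if $T$ is $\alpha$-thin and YES otherwise.
   Context: For a subgraph $S$ of $G$ and $A \subseteq V(G)$, $\delta_S(A)$ (or $\delta(A)$ when $S=G$) denotes the set of edges of $S$ with exactly one endpoint in $A$. A partition $(A,B)$ is nontrivial if both parts are nonempty. A subgraph $T$ of $G$ is $\alpha$-thin if $|\delta_T(A)|/|\delta_G(A)| \le \alpha$ for every nontrivial cut $(A, V(G)\setminus A)$ of $G$. *)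

theory Defs
  imports Complex_Main "HOL-Computational_Algebra.Polynomial"
begin

section \<open>Undirected multigraphs, cuts and thin subgraphs\<close>

text \<open>Edges are abstract identifiers, so parallel edges are allowed. The set \<open>ends G e\<close> has two
  elements, or one element if \<open>e\<close> is a loop.\<close>

record ('v, 'e) mgraph =
  verts :: "'v set"
  edges :: "'e set"
  ends :: "'e \<Rightarrow> 'v set"

definition multigraph :: "('v, 'e) mgraph \<Rightarrow> bool" where
  "multigraph G \<longleftrightarrow> finite (verts G) \<and> finite (edges G) \<and>
     (\<forall>e\<in>edges G. \<exists>u\<in>verts G. \<exists>v\<in>verts G. ends G e = {u, v})"

definition simple_graph :: "('v, 'e) mgraph \<Rightarrow> bool" where
  "simple_graph G \<longleftrightarrow> finite (verts G) \<and> finite (edges G) \<and> inj_on (ends G) (edges G) \<and>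
     (\<forall>e\<in>edges G. \<exists>u\<in>verts G. \<exists>v\<in>verts G. u \<noteq> v \<and> ends G e = {u, v})"

definition adj_rel :: "('v, 'e) mgraph \<Rightarrow> ('v \<times> 'v) set" where
  "adj_rel G = {(u, v). \<exists>e\<in>edges G. ends G e = {u, v}}"

definition connected_graph :: "('v, 'e) mgraph \<Rightarrow> bool" where
  "connected_graph G \<longleftrightarrow> verts G \<noteq> {} \<and> (\<forall>u\<in>verts G. \<forall>v\<in>verts G. (u, v) \<in> (adj_rel G)\<^sup>*)"

definition cut :: "('v, 'e) mgraph \<Rightarrow> 'v set \<Rightarrow> 'e set" where
  "cut G A = {e \<in> edges G. \<exists>a b. ends G e = {a, b} \<and> a \<in> A \<and> b \<notin> A}"

definition nontrivial_partition :: "('v, 'e) mgraph \<Rightarrow> 'v set \<Rightarrow> 'v set \<Rightarrow> bool" where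
  "nontrivial_partition G A B \<longleftrightarrow> A \<union> B = verts G \<and> A \<inter> B = {} \<and> A \<noteq> {} \<and> B \<noteq> {}"

definition subgraph :: "('v, 'e) mgraph \<Rightarrow> ('v, 'e) mgraph \<Rightarrow> bool" where
  "subgraph S G \<longleftrightarrow> verts S \<subseteq> verts G \<and> edges S \<subseteq> edges G \<and> (\<forall>e\<in>edges S. ends S e = ends G e)"

text \<open>Cycles through at least three vertices; in a simple graph there are no others.\<close>

definition is_cycle :: "('v, 'e) mgraph \<Rightarrow> 'v list \<Rightarrow> bool" where
  "is_cycle G vs \<longleftrightarrow> 3 \<le> length vs \<and> distinct vs \<and>
     (\<forall>i<length vs. (vs ! i, vs ! (Suc i mod length vs)) \<in> adj_rel G)"

definition spanning_tree :: "('v, 'e) mgraph \<Rightarrow> ('v, 'e) mgraph \<Rightarrow> bool" where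
  "spanning_tree T G \<longleftrightarrow> simple_graph T \<and> subgraph T G \<and> verts T = verts G \<and>
     connected_graph T \<and> (\<nexists>vs. is_cycle T vs)"

definition thin :: "rat \<Rightarrow> ('v, 'e) mgraph \<Rightarrow> ('v, 'e) mgraph \<Rightarrow> bool" where
  "thin \<alpha> T G \<longleftrightarrow> (\<forall>A B. nontrivial_partition G A B \<longrightarrow>
     of_nat (card (cut T A)) / of_nat (card (cut G A)) \<le> \<alpha>)"


section \<open>Deterministic multi-tape Turing machines\<close>

text \<open>Tape symbols are \<open>0, \<dots>, nsyms M - 1\<close>, with \<open>0\<close> the blank. The control states are
  \<open>0, \<dots>, nstates M\<close>; the machine starts in state \<open>0\<close> and halts in state \<open>nstates M\<close>. The tapes are
  infinite in both directions; tape \<open>0\<close> carries the input and tape \<open>1\<close> the output.\<close>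

datatype move = Move_Left | Move_Stay | Move_Right

record tm =
  ntapes :: nat
  nsyms :: nat
  nstates :: nat
  delta :: "nat \<Rightarrow> nat list \<Rightarrow> nat \<times> (nat \<times> move) list"

definition tm_wf :: "tm \<Rightarrow> bool" where
  "tm_wf M \<longleftrightarrow> 2 \<le> ntapes M \<and> 1 \<le> nsyms M \<and>
     (\<forall>q syms. q < nstates M \<and> length syms = ntapes M \<and> set syms \<subseteq> {..<nsyms M} \<longrightarrow>
        (case delta M q syms of (q', acts) \<Rightarrow>
           q' \<le> nstates M \<and> length acts = ntapes M \<and> fst ` set acts \<subseteq> {..<nsyms M}))"

type_synonym tape = "(int \<Rightarrow> nat) \<times> int"
type_synonym config = "nat \<times> tape list"

fun read_tape :: "tape \<Rightarrow> nat" where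
  "read_tape (c, h) = c h"

fun move_offset :: "move \<Rightarrow> int" where
  "move_offset Move_Left = - 1"
| "move_offset Move_Stay = 0"
| "move_offset Move_Right = 1"

fun act_tape :: "nat \<times> move \<Rightarrow> tape \<Rightarrow> tape" where
  "act_tape (s, d) (c, h) = (c(h := s), h + move_offset d)"

fun tm_step :: "tm \<Rightarrow> config \<Rightarrow> config" where
  "tm_step M (q, ts) =
     (if q < nstates M
      then case delta M q (map read_tape ts) of (q', acts) \<Rightarrow> (q', map2 act_tape acts ts)
      else (q, ts))"

definition word_cells :: "nat list \<Rightarrow> int \<Rightarrow> nat" where
  "word_cells w i = (if 0 \<le> i \<and> i < int (length w) then w ! nat i else 0)"

definition tm_init :: "tm \<Rightarrow> nat list \<Rightarrow> config" where
  "tm_init M x = (0, (word_cells x, 0) # replicate (ntapes M - 1) (word_cells [], 0))"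

definition tm_computes_within :: "tm \<Rightarrow> nat list \<Rightarrow> nat list \<Rightarrow> nat \<Rightarrow> bool" where
  "tm_computes_within M x y t \<longleftrightarrow>
     set x \<subseteq> {0<..<nsyms M} \<and> set y \<subseteq> {0<..<nsyms M} \<and>
     (case (tm_step M ^^ t) (tm_init M x) of (q, ts) \<Rightarrow>
        q = nstates M \<and> fst (ts ! 1) = word_cells y)"


section \<open>Decision problems and Karp reductions\<close>

record 'i problem =
  instances :: "'i set"
  yes_instances :: "'i set"
  encode :: "'i \<Rightarrow> nat list"

definition polytime_computable ::
    "('i \<Rightarrow> 'j) \<Rightarrow> 'i set \<Rightarrow> ('i \<Rightarrow> nat list) \<Rightarrow> ('j \<Rightarrow> nat list) \<Rightarrow> bool" where
  "polytime_computable f D enc enc' \<longleftrightarrow>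
     (\<exists>M (p :: nat poly). tm_wf M \<and>
        (\<forall>x\<in>D. tm_computes_within M (enc x) (enc' (f x)) (poly p (length (enc x)))))"

definition karp_reducible :: "'i problem \<Rightarrow> 'j problem \<Rightarrow> bool" where
  "karp_reducible P Q \<longleftrightarrow>
     (\<exists>f. (\<forall>x\<in>instances P. f x \<in> instances Q \<and> (x \<in> yes_instances P \<longleftrightarrow> f x \<in> yes_instances Q)) \<and>
          polytime_computable f (instances P) (encode P) (encode Q))"


section \<open>Encodings as words\<close>

text \<open>Symbols: \<open>1\<close> and \<open>2\<close> are the digits zero and one, \<open>3\<close> ends a number and \<open>4\<close> ends a list.
  Vertex numbers are written in unary, which is polynomially equivalent to binary here since a
  connected graph with \<open>m\<close> edges has at most \<open>m + 1\<close> vertices. The numerators and denominators of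
  rational numbers are written in binary, least significant digit first.\<close>

definition enc_unary :: "nat \<Rightarrow> nat list" where
  "enc_unary n = replicate n 2 @ [3]"

fun bin_digits :: "nat \<Rightarrow> nat list" where
  "bin_digits n = (if n = 0 then [] else (if odd n then 2 else 1) # bin_digits (n div 2))"

declare bin_digits.simps [simp del]

definition enc_binary :: "nat \<Rightarrow> nat list" where
  "enc_binary n = bin_digits n @ [3]"

definition enc_int :: "int \<Rightarrow> nat list" where
  "enc_int z = (if z < 0 then 2 else 1) # enc_binary (nat \<bar>z\<bar>)"

definition enc_list :: "('a \<Rightarrow> nat list) \<Rightarrow> 'a list \<Rightarrow> nat list" where
  "enc_list enc xs = concat (map enc xs) @ [4]"


section \<open>MaxAvgCut\<close>

text \<open>The vertices are \<open>{..<mac_order I}\<close>; the \<open>i\<close>-th entry \<open>(u, v, w)\<close> of the edge list is the edge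
  with identifier \<open>i\<close>, ends \<open>u\<close>, \<open>v\<close> and weight \<open>w\<close>. A rational number is given by a fraction with
  positive denominator, not necessarily in lowest terms.\<close>

record mac_instance =
  mac_order :: nat
  mac_edges :: "(nat \<times> nat \<times> int) list"
  mac_num :: int
  mac_den :: nat

definition mac_graph :: "mac_instance \<Rightarrow> (nat, nat) mgraph" where
  "mac_graph I = \<lparr>verts = {..<mac_order I}, edges = {..<length (mac_edges I)},
     ends = (\<lambda>i. case mac_edges I ! i of (u, v, w) \<Rightarrow> {u, v})\<rparr>"

definition mac_weight :: "mac_instance \<Rightarrow> nat \<Rightarrow> int" where
  "mac_weight I i = (case mac_edges I ! i of (u, v, w) \<Rightarrow> w)"

definition mac_k :: "mac_instance \<Rightarrow> rat" where
  "mac_k I = of_int (mac_num I) / of_nat (mac_den I)"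

definition mac_valid :: "mac_instance \<Rightarrow> bool" where
  "mac_valid I \<longleftrightarrow> multigraph (mac_graph I) \<and> connected_graph (mac_graph I) \<and>
     (\<forall>e\<in>edges (mac_graph I). mac_weight I e \<in> {-1, 1}) \<and>
     0 < mac_den I \<and> - 1 \<le> mac_k I"

definition mac_yes :: "mac_instance \<Rightarrow> bool" where
  "mac_yes I \<longleftrightarrow> (\<exists>A B. nontrivial_partition (mac_graph I) A B \<and>
     of_int (\<Sum>e\<in>cut (mac_graph I) A. mac_weight I e) / of_nat (card (cut (mac_graph I) A)) \<ge> mac_k I)"

definition enc_wedge :: "nat \<times> nat \<times> int \<Rightarrow> nat list" where
  "enc_wedge = (\<lambda>(u, v, w). enc_unary u @ enc_unary v @ [if w = 1 then 2 else 1])"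

definition enc_mac :: "mac_instance \<Rightarrow> nat list" where
  "enc_mac I = enc_unary (mac_order I) @ enc_list enc_wedge (mac_edges I) @
     enc_int (mac_num I) @ enc_binary (mac_den I)"

definition MaxAvgCut :: "mac_instance problem" where
  "MaxAvgCut = \<lparr>instances = {I. mac_valid I}, yes_instances = {I. mac_valid I \<and> mac_yes I},
     encode = enc_mac\<rparr>"


section \<open>The complement of ThinTreeValid\<close>

text \<open>The graph and the tree are given by lists of their edges, each edge being listed once, with its
  ends in either order.\<close>

record ttv_instance =
  ttv_order :: nat
  ttv_edges :: "(nat \<times> nat) list"
  ttv_tree_edges :: "(nat \<times> nat) list"
  ttv_num :: nat
  ttv_den :: nat

definition edge_of :: "nat \<times> nat \<Rightarrow> nat set" where
  "edge_of = (\<lambda>(u, v). {u, v})"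

definition list_graph :: "nat \<Rightarrow> (nat \<times> nat) list \<Rightarrow> (nat, nat set) mgraph" where
  "list_graph n es = \<lparr>verts = {..<n}, edges = edge_of ` set es, ends = (\<lambda>e. e)\<rparr>"

definition ttv_graph :: "ttv_instance \<Rightarrow> (nat, nat set) mgraph" where
  "ttv_graph J = list_graph (ttv_order J) (ttv_edges J)"

definition ttv_tree :: "ttv_instance \<Rightarrow> (nat, nat set) mgraph" where
  "ttv_tree J = list_graph (ttv_order J) (ttv_tree_edges J)"

definition ttv_alpha :: "ttv_instance \<Rightarrow> rat" where
  "ttv_alpha J = of_nat (ttv_num J) / of_nat (ttv_den J)"

definition ttv_valid :: "ttv_instance \<Rightarrow> bool" where
  "ttv_valid J \<longleftrightarrow> distinct (map edge_of (ttv_edges J)) \<and> distinct (map edge_of (ttv_tree_edges J)) \<and>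
     simple_graph (ttv_graph J) \<and> connected_graph (ttv_graph J) \<and>
     spanning_tree (ttv_tree J) (ttv_graph J) \<and>
     0 < ttv_den J \<and> 0 \<le> ttv_alpha J \<and> ttv_alpha J \<le> 1"

definition enc_edge :: "nat \<times> nat \<Rightarrow> nat list" where
  "enc_edge = (\<lambda>(u, v). enc_unary u @ enc_unary v)"

definition enc_ttv :: "ttv_instance \<Rightarrow> nat list" where
  "enc_ttv J = enc_unary (ttv_order J) @ enc_list enc_edge (ttv_edges J) @
     enc_list enc_edge (ttv_tree_edges J) @ enc_binary (ttv_num J) @ enc_binary (ttv_den J)"

definition ThinTreeValid_C :: "ttv_instance problem" where
  "ThinTreeValid_C = \<lparr>instances = {J. ttv_valid J},
     yes_instances = {J. ttv_valid J \<and> \<not> thin (ttv_alpha J) (ttv_tree J) (ttv_graph J)},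
     encode = enc_ttv\<rparr>"


section \<open>The encodings are unambiguous\<close>

lemma enc_unary_append_eq: "enc_unary m @ xs = enc_unary n @ ys \<longleftrightarrow> m = n \<and> xs = ys"
proof (induction m arbitrary: n)
  case 0
  then show ?case by (cases n) (auto simp: enc_unary_def)
next
  case (Suc m)
  then show ?case by (cases n) (auto simp: enc_unary_def)
qed

lemma enc_binary_append_eq: "enc_binary m @ xs = enc_binary n @ ys \<longleftrightarrow> m = n \<and> xs = ys"
proof (induction m arbitrary: n rule: less_induct)
  case (less m)
  have step: "enc_binary k = (if odd k then 2 else 1) # enc_binary (k div 2)" if "k \<noteq> 0" for k
    using that by (simp add: enc_binary_def bin_digits.simps[of k])
  have zero: "enc_binary 0 = [3]" by (simp add: enc_binary_def bin_digits.simps[of 0])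
  show ?case
  proof (cases "m = 0 \<or> n = 0")
    case True
    then show ?thesis
      by (cases "m = 0"; cases "n = 0") (auto simp: zero step)
  next
    case False
    then have IH: "enc_binary (m div 2) @ xs = enc_binary (n div 2) @ ys \<longleftrightarrow>
        m div 2 = n div 2 \<and> xs = ys"
      using less by simp
    have "m = n \<longleftrightarrow> odd m = odd n \<and> m div 2 = n div 2"
      by (metis odd_two_times_div_two_succ even_two_times_div_two)
    then show ?thesis using False IH by (auto simp: step)
  qed
qed

lemma enc_int_append_eq: "enc_int a @ xs = enc_int b @ ys \<longleftrightarrow> a = b \<and> xs = ys"
  by (auto simp: enc_int_def enc_binary_append_eq)

lemma enc_list_append_eq:
  assumes "\<And>a b xs ys. a \<in> D \<Longrightarrow> b \<in> D \<Longrightarrow> enc a @ xs = enc b @ ys \<longleftrightarrow> a = b \<and> xs = ys"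
    and "\<And>a. a \<in> D \<Longrightarrow> enc a \<noteq> [] \<and> hd (enc a) \<noteq> 4"
    and "set as \<subseteq> D" "set bs \<subseteq> D"
  shows "enc_list enc as @ xs = enc_list enc bs @ ys \<longleftrightarrow> as = bs \<and> xs = ys"
  using assms(3,4)
proof (induction as arbitrary: bs)
  case Nil
  have "4 # xs \<noteq> enc b @ zs" if "b \<in> D" for b zs
    using assms(2)[OF that] by (cases "enc b") auto
  then show ?case using Nil by (cases bs) (auto simp: enc_list_def)
next
  case (Cons a as)
  have ne: "enc a @ zs \<noteq> 4 # ys" for zs
    using assms(2)[of a] Cons.prems by (cases "enc a") auto
  show ?case
  proof (cases bs)
    case Nil
    then show ?thesis using ne by (simp add: enc_list_def)
  next
    case (Cons b cs)
    have "enc_list enc as @ xs = enc_list enc cs @ ys \<longleftrightarrow> as = cs \<and> xs = ys"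
      using Cons.IH Cons.prems Cons by simp
    then show ?thesis
      using assms(1)[of a b] Cons.prems Cons by (simp add: enc_list_def)
  qed
qed

lemma enc_unary_hd: "enc_unary n \<noteq> [] \<and> hd (enc_unary n) \<noteq> 4"
  by (cases n) (auto simp: enc_unary_def)

lemma inj_on_enc_mac: "inj_on enc_mac (instances MaxAvgCut)"
proof (rule inj_onI)
  fix I J assume IJ: "I \<in> instances MaxAvgCut" "J \<in> instances MaxAvgCut"
    and eq: "enc_mac I = enc_mac J"
  let ?D = "{(u :: nat, v :: nat, w :: int). w \<in> {-1, 1}}"
  have sub: "set (mac_edges K) \<subseteq> ?D" if "K \<in> instances MaxAvgCut" for K
    using that by (fastforce simp: MaxAvgCut_def mac_valid_def mac_graph_def mac_weight_def
        in_set_conv_nth split: prod.splits)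
  have "enc_list enc_wedge (mac_edges I) @ xs = enc_list enc_wedge (mac_edges J) @ ys \<longleftrightarrow>
      mac_edges I = mac_edges J \<and> xs = ys" for xs ys
    by (rule enc_list_append_eq[where D = ?D])
      (use sub IJ in \<open>auto simp: enc_wedge_def enc_unary_append_eq enc_unary_hd\<close>)
  then show "I = J"
    using eq enc_binary_append_eq[of _ "[]" _ "[]"]
    by (simp add: enc_mac_def enc_unary_append_eq enc_int_append_eq)
qed

lemma inj_enc_ttv: "inj enc_ttv"
proof (rule injI)
  fix I J assume eq: "enc_ttv I = enc_ttv J"
  have "enc_list enc_edge as @ xs = enc_list enc_edge bs @ ys \<longleftrightarrow> as = bs \<and> xs = ys" for as bs xs ys
    by (rule enc_list_append_eq[where D = UNIV])
      (auto simp: enc_edge_def enc_unary_append_eq enc_unary_hd)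
  then show "I = J"
    using eq enc_binary_append_eq[of _ "[]" _ "[]"]
    by (simp add: enc_ttv_def enc_unary_append_eq enc_binary_append_eq)
qed

end

theory Submission
  imports Defs
begin

text \<open>
  Let \<open>G\<close> have \<open>n\<close> vertices and \<open>m\<close> edges, and let \<open>k = c / d\<close>. Every vertex \<open>v\<close> of \<open>G\<close> becomes a clique
  on the block \<open>v * B, \<dots>, v * B + (B - 1)\<close>, where \<open>B = 32 * (m + 1)\<close>; the tree runs through the block as
  a path. Every edge \<open>i\<close> from \<open>u\<close> to \<open>v \<noteq> u\<close> becomes two edges from \<open>u * B\<close> to the slots
  \<open>v * B + (2 * i + 1)\<close> and \<open>v * B + (2 * i + 2)\<close>: the first one belongs to the tree, the second one if
  and only if the weight is \<open>1\<close>, and in the tree such an edge replaces the path edge that enters the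
  slot. The blocks are joined by a spanning tree of \<open>G\<close>, whose edges lead to \<open>v * B\<close> in place of the
  first slot. A cut that splits no block contains, if it corresponds to a cut of average weight \<open>s\<close>, a
  fraction \<open>(3 + s) / 4\<close> of tree edges. A cut that splits a block cuts so many clique edges that at
  most a quarter of its edges belong to the tree. Since \<open>k \<ge> -1\<close>, the threshold is at
  least a quarter.

  The machine is obtained from a program over words whose only loops are bounded by the length of a
  word that is not changed, so that polynomial time is automatic. The spanning tree is found by \<open>n\<close>
  scans of the edge list that each attach the edges leaving the set of visited vertices.\<close>

section \<open>Structured programs on several tapes\<close>

text \<open>The tree has to contain a weight-dependent share of the copies of every edge, although
  the edges of \<open>G\<close> may form cycles and may be parallel. Private slots in the target
  block solve both problems: distinct slots keep the copies apart, and a copy can enter the tree in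
  exchange for the path edge at its slot, so that every vertex other than the root keeps exactly one
  parent. Of two copies the tree gets one for weight -1 and both for weight 1, that is, the share (3
  + w) / 4.

  The block size makes the clique edges of a split block outweigh the cut path edges and all
  \<open>2 * m\<close> copies together. The threshold (3 + k) / 4 is at least 1/2; it is lowered by
  1 / (4 * d * 2 ^ m), which is at most 1/4, because thinness fails by a strict inequality while the
  average only has to reach k. The factor 2 ^ m exceeds every cut size of \<open>G\<close>, and
  multiplying by it merely adds binary digits.\<close>

type_synonym tapes = "nat \<Rightarrow> tape"

text \<open>Tests and actions depend only on the symbols under the heads, which is all that a finite
  control can see. Tapes are indexed by all naturals, so that the number of tapes enters only with
  \<open>wfp\<close>.\<close>

datatype prog =
    Act "(nat \<Rightarrow> nat) \<Rightarrow> nat \<Rightarrow> nat \<times> move"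
  | PSeq prog prog
  | PIf "(nat \<Rightarrow> nat) \<Rightarrow> bool" prog prog
  | PWhile "(nat \<Rightarrow> nat) \<Rightarrow> bool" prog

definition rd :: "tapes \<Rightarrow> nat \<Rightarrow> nat" where
  "rd \<tau> i = read_tape (\<tau> i)"

text \<open>The step counts are exact for the compiled code: a true branch pays for its test and for
  the jump over the other branch, a false branch only for its test, and a loop iteration for its
  test and the jump back.\<close>

inductive exec :: "prog \<Rightarrow> tapes \<Rightarrow> nat \<Rightarrow> tapes \<Rightarrow> bool" where
  Act: "exec (Act f) \<tau> 1 (\<lambda>i. act_tape (f (rd \<tau>) i) (\<tau> i))"
| Seq: "exec a \<tau> t \<tau>1 \<Longrightarrow> exec b \<tau>1 t' \<tau>2 \<Longrightarrow> exec (PSeq a b) \<tau> (t + t') \<tau>2"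
| IfT: "P (rd \<tau>) \<Longrightarrow> exec a \<tau> t \<tau>' \<Longrightarrow> exec (PIf P a b) \<tau> (t + 2) \<tau>'"
| IfF: "\<not> P (rd \<tau>) \<Longrightarrow> exec b \<tau> t \<tau>' \<Longrightarrow> exec (PIf P a b) \<tau> (t + 1) \<tau>'"
| WhileF: "\<not> P (rd \<tau>) \<Longrightarrow> exec (PWhile P a) \<tau> 1 \<tau>"
| WhileT: "P (rd \<tau>) \<Longrightarrow> exec a \<tau> t \<tau>1 \<Longrightarrow> exec (PWhile P a) \<tau>1 t' \<tau>2 \<Longrightarrow>
    exec (PWhile P a) \<tau> (t + t' + 2) \<tau>2"

fun psize :: "prog \<Rightarrow> nat" where
  "psize (Act f) = 1"
| "psize (PSeq a b) = psize a + psize b"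
| "psize (PIf P a b) = psize a + psize b + 2"
| "psize (PWhile P a) = psize a + 2"

definition stay :: "(nat \<Rightarrow> nat) \<Rightarrow> nat \<Rightarrow> nat \<times> move" where
  "stay r i = (r i, Move_Stay)"

definition shift :: "nat \<Rightarrow> nat \<times> 'a \<Rightarrow> nat \<times> 'a" where
  "shift b p = (b + fst p, snd p)"

lemma fst_shift [simp]: "fst (shift b p) = b + fst p" and snd_shift [simp]: "snd (shift b p) = snd p"
  by (simp_all add: shift_def)

lemma shift_Pair [simp]: "shift b (q, f) = (b + q, f)"
  by (simp add: shift_def)

text \<open>A fragment \<open>c\<close> owns the states below \<open>psize c\<close> and is left in
  state \<open>psize c\<close>, the first state of whatever follows; sequencing therefore needs no
  extra state. Tests and jumps write back what they read.\<close>

fun pcode :: "prog \<Rightarrow> nat \<Rightarrow> (nat \<Rightarrow> nat) \<Rightarrow> nat \<times> (nat \<Rightarrow> nat \<times> move)" where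
  "pcode (Act f) q r = (1, f r)"
| "pcode (PSeq a b) q r =
     (if q < psize a then pcode a q r else shift (psize a) (pcode b (q - psize a) r))"
| "pcode (PIf P a b) q r =
     (if q = 0 then (if P r then 1 else psize a + 2, stay r)
      else if q < psize a + 1 then shift 1 (pcode a (q - 1) r)
      else if q = psize a + 1 then (psize a + psize b + 2, stay r)
      else shift (psize a + 2) (pcode b (q - (psize a + 2)) r))"
| "pcode (PWhile P a) q r =
     (if q = 0 then (if P r then 1 else psize a + 2, stay r)
      else if q < psize a + 1 then shift 1 (pcode a (q - 1) r)
      else (0, stay r))"

definition gstep :: "(nat \<Rightarrow> (nat \<Rightarrow> nat) \<Rightarrow> nat \<times> (nat \<Rightarrow> nat \<times> move)) \<Rightarrow> nat \<times> tapes \<Rightarrow> nat \<times> tapes" where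
  "gstep G = (\<lambda>(q, \<tau>). case G q (rd \<tau>) of (q', f) \<Rightarrow> (q', \<lambda>i. act_tape (f i) (\<tau> i)))"

lemma act_tape_stay [simp]: "act_tape (stay (rd \<tau>) i) (\<tau> i) = \<tau> i"
  by (cases "\<tau> i") (simp add: stay_def rd_def)

lemma gstep_stay: "G q (rd \<tau>) = (q', stay (rd \<tau>)) \<Longrightarrow> gstep G (q, \<tau>) = (q', \<tau>)"
  by (simp add: gstep_def)

text \<open>The control \<open>G\<close> only has to agree with \<open>c\<close> on the states from
  \<open>b\<close> to \<open>b + psize c - 1\<close>. This lets the induction treat a subprogram at
  its offset within the larger program.\<close>

lemma gstep_exec:
  assumes "exec c \<tau> t \<tau>'"
    and "\<And>q r. q < psize c \<Longrightarrow> G (b + q) r = shift b (pcode c q r)"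
  shows "(gstep G ^^ t) (b, \<tau>) = (b + psize c, \<tau>')"
  using assms
proof (induction arbitrary: b rule: exec.induct)
  case (Act f \<tau>)
  from Act[of 0] show ?case by (simp add: gstep_def)
next
  case (Seq a \<tau> t \<tau>1 c t' \<tau>2)
  have "(gstep G ^^ t) (b, \<tau>) = (b + psize a, \<tau>1)"
    by (rule Seq.IH) (simp add: Seq.prems)
  moreover have "(gstep G ^^ t') (b + psize a, \<tau>1) = (b + psize a + psize c, \<tau>2)"
  proof (rule Seq.IH)
    fix q r assume "q < psize c"
    then show "G (b + psize a + q) r = shift (b + psize a) (pcode c q r)"
      using Seq.prems[of "psize a + q" r]
      by (simp add: add.assoc shift_def)
  qed
  ultimately show ?case
    by (simp add: funpow_add add.commute[of t] add.assoc)
next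
  case (IfT P \<tau> a t \<tau>' c)
  have "gstep G (b, \<tau>) = (b + 1, \<tau>)"
    using IfT.prems[of 0 "rd \<tau>"] IfT.hyps by (intro gstep_stay) simp
  moreover have "(gstep G ^^ t) (b + 1, \<tau>) = (b + 1 + psize a, \<tau>')"
  proof (rule IfT.IH)
    fix q r assume "q < psize a"
    then show "G (b + 1 + q) r = shift (b + 1) (pcode a q r)"
      using IfT.prems[of "1 + q" r] by (simp add: add.assoc shift_def)
  qed
  moreover have "gstep G (b + 1 + psize a, \<tau>') = (b + psize (PIf P a c), \<tau>')"
    using IfT.prems[of "1 + psize a" "rd \<tau>'"] by (intro gstep_stay) (simp add: add.assoc)
  moreover have "t + 2 = Suc (t + 1)" by simp
  ultimately show ?case
    by (simp only: funpow.simps(2) funpow_add o_apply funpow_0 One_nat_def)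
next
  case (IfF P \<tau> c t \<tau>' a)
  have "gstep G (b, \<tau>) = (b + (psize a + 2), \<tau>)"
    using IfF.prems[of 0 "rd \<tau>"] IfF.hyps by (intro gstep_stay) simp
  moreover have "(gstep G ^^ t) (b + (psize a + 2), \<tau>) = (b + (psize a + 2) + psize c, \<tau>')"
  proof (rule IfF.IH)
    fix q r assume "q < psize c"
    then show "G (b + (psize a + 2) + q) r = shift (b + (psize a + 2)) (pcode c q r)"
      using IfF.prems[of "psize a + 2 + q" r]
      by (simp add: add.assoc shift_def)
  qed
  ultimately show ?case
    by (simp only: funpow_add o_apply One_nat_def funpow.simps(2) funpow_0) simp
next
  case (WhileF P \<tau> a)
  then have "gstep G (b, \<tau>) = (b + (psize a + 2), \<tau>)"
    using WhileF.prems[of 0 "rd \<tau>"] by (intro gstep_stay) simp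
  then show ?case by simp
next
  case (WhileT P \<tau> a t \<tau>1 t' \<tau>2)
  have "gstep G (b, \<tau>) = (b + 1, \<tau>)"
    using WhileT.prems[of 0 "rd \<tau>"] WhileT.hyps by (intro gstep_stay) simp
  moreover have "(gstep G ^^ t) (b + 1, \<tau>) = (b + 1 + psize a, \<tau>1)"
  proof (rule WhileT.IH(1))
    fix q r assume "q < psize a"
    then show "G (b + 1 + q) r = shift (b + 1) (pcode a q r)"
      using WhileT.prems[of "1 + q" r] by (simp add: add.assoc shift_def)
  qed
  moreover have "gstep G (b + 1 + psize a, \<tau>1) = (b, \<tau>1)"
    using WhileT.prems[of "1 + psize a" "rd \<tau>1"] by (intro gstep_stay) (simp add: add.assoc)
  moreover have "(gstep G ^^ t') (b, \<tau>1) = (b + psize (PWhile P a), \<tau>2)"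
    by (rule WhileT.IH(2)) (rule WhileT.prems)
  moreover have "t + t' + 2 = t' + (1 + (t + 1))" by simp
  ultimately show ?case
    by (simp only: funpow_add o_apply One_nat_def funpow.simps(2) funpow_0)
qed

text \<open>The second conjunct makes the machine insensitive to the tapes it does not have.\<close>

fun wfp :: "nat \<Rightarrow> nat \<Rightarrow> prog \<Rightarrow> bool" where
  "wfp K S (Act f) \<longleftrightarrow> (\<forall>r. (\<forall>i. r i < S) \<longrightarrow> (\<forall>i. fst (f r i) < S)) \<and> (\<forall>r. \<forall>i\<ge>K. f r i = stay r i)"
| "wfp K S (PSeq a b) \<longleftrightarrow> wfp K S a \<and> wfp K S b"
| "wfp K S (PIf P a b) \<longleftrightarrow> wfp K S a \<and> wfp K S b"
| "wfp K S (PWhile P a) \<longleftrightarrow> wfp K S a"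

lemma pcode_wf:
  assumes "wfp K S c" "q < psize c"
  shows "fst (pcode c q r) \<le> psize c"
    and "(\<forall>i. r i < S) \<Longrightarrow> fst (snd (pcode c q r) i) < S"
    and "i \<ge> K \<Longrightarrow> snd (pcode c q r) i = stay r i"
proof -
  have "fst (pcode c q r) \<le> psize c \<and> ((\<forall>i. r i < S) \<longrightarrow> (\<forall>i. fst (snd (pcode c q r) i) < S)) \<and>
     (\<forall>i\<ge>K. snd (pcode c q r) i = stay r i)"
    using assms
  proof (induction c arbitrary: q)
    case (PSeq a b)
    show ?case using PSeq.prems PSeq.IH(1)[of q] PSeq.IH(2)[of "q - psize a"]
      by (auto simp: less_diff_conv2 add.commute)
  next
    case (PIf P a b)
    consider "q = 0" | q' where "q = Suc q'" "q' < psize a" | "q = psize a + 1" | "psize a + 1 < q"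
      by (metis Suc_eq_plus1 less_Suc_eq not0_implies_Suc not_less_eq)
    then show ?case
      by cases (use PIf.prems PIf.IH(1)[of "q - 1"] PIf.IH(2)[of "q - (psize a + 2)"] in
          \<open>auto simp: stay_def\<close>)
  next
    case (PWhile P a)
    consider "q = 0" | q' where "q = Suc q'" "q' < psize a" | "q = psize a + 1"
      using PWhile.prems by (cases q) (auto simp: less_Suc_eq)
    then show ?case
      by cases (use PWhile.prems PWhile.IH[of "q - 1"] in \<open>auto simp: stay_def\<close>)
  qed auto
  then show "fst (pcode c q r) \<le> psize c" "(\<forall>i. r i < S) \<Longrightarrow> fst (snd (pcode c q r) i) < S"
    "i \<ge> K \<Longrightarrow> snd (pcode c q r) i = stay r i" by auto
qed

section \<open>Translation into multi-tape Turing machines\<close>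

definition rd_list :: "nat list \<Rightarrow> nat \<Rightarrow> nat" where
  "rd_list xs i = (if i < length xs then xs ! i else 0)"

definition pmachine :: "nat \<Rightarrow> nat \<Rightarrow> prog \<Rightarrow> tm" where
  "pmachine K S c = \<lparr>ntapes = K, nsyms = S, nstates = psize c,
     delta = (\<lambda>q syms. case pcode c q (rd_list syms) of (q', f) \<Rightarrow> (q', map f [0..<K]))\<rparr>"

lemma tm_wf_pmachine:
  assumes "wfp K S c" "2 \<le> K" "1 \<le> S"
  shows "tm_wf (pmachine K S c)"
proof -
  have "rd_list syms i < S" if "set syms \<subseteq> {..<S}" for syms i
    using that assms(3) subsetD[OF that nth_mem[of i syms]] by (auto simp: rd_list_def)
  then show ?thesis
    using assms pcode_wf[OF assms(1)]
    by (auto simp: tm_wf_def pmachine_def split: prod.splits) (metis fst_conv snd_conv)+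
qed

text \<open>Missing tapes are read as blank ones. Since a well-formed program leaves all tapes from
  \<open>K\<close> on alone, list configurations and functional ones stay in step.\<close>

definition tapes_of :: "tape list \<Rightarrow> tapes" where
  "tapes_of ts i = (if i < length ts then ts ! i else (word_cells [], 0))"

lemma tm_step_pmachine:
  assumes "wfp K S c" "length ts = K"
  defines "G \<equiv> \<lambda>q r. if q < psize c then pcode c q r else (q, stay r)"
  shows "\<exists>q' ts'. tm_step (pmachine K S c) (q, ts) = (q', ts') \<and> length ts' = K \<and>
           gstep G (q, tapes_of ts) = (q', tapes_of ts')"
proof (cases "q < psize c")
  case True
  have r: "rd_list (map read_tape ts) = rd (tapes_of ts)"
    by (auto simp: fun_eq_iff rd_list_def rd_def tapes_of_def word_cells_def)
  obtain q' f where qf: "pcode c q (rd (tapes_of ts)) = (q', f)" by fastforce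
  have "act_tape (f i) (tapes_of ts i) = tapes_of ts i" if "i \<ge> K" for i
    using pcode_wf(3)[OF assms(1) True that, of "rd (tapes_of ts)"] qf by simp
  then have "(\<lambda>i. act_tape (f i) (tapes_of ts i)) = tapes_of (map2 act_tape (map f [0..<K]) ts)"
    using assms(2) by (auto simp: fun_eq_iff tapes_of_def)
  then show ?thesis
    using True qf assms(2) by (simp add: pmachine_def gstep_def G_def r)
next
  case False
  then show ?thesis
    using assms(2) by (auto simp: pmachine_def G_def intro!: gstep_stay)
qed

lemma tm_steps_pmachine:
  assumes "wfp K S c" "length ts = K"
  defines "G \<equiv> \<lambda>q r. if q < psize c then pcode c q r else (q, stay r)"
  shows "\<exists>q' ts'. (tm_step (pmachine K S c) ^^ t) (q, ts) = (q', ts') \<and> length ts' = K \<and>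
           (gstep G ^^ t) (q, tapes_of ts) = (q', tapes_of ts')"
proof (induction t)
  case (Suc t)
  then show ?case
    using tm_step_pmachine[OF assms(1)] unfolding G_def by fastforce
qed (simp add: assms)

lemma gstep_idle: "(gstep G ^^ t) (q, \<tau>) = (q, \<tau>)" if "\<And>r. G q r = (q, stay r)"
  by (induction t) (simp_all add: gstep_stay that)

lemma pmachine_computes:
  assumes wf: "wfp K S c" and "2 \<le> K"
    and ex: "exec c (\<lambda>i. (word_cells (if i = 0 then x else []), 0)) t \<tau>'" and "t \<le> T"
    and out: "fst (\<tau>' 1) = word_cells y"
    and "set x \<subseteq> {0<..<S}" "set y \<subseteq> {0<..<S}"
  shows "tm_computes_within (pmachine K S c) x y T"
proof -
  define G where "G = (\<lambda>q r. if q < psize c then pcode c q r else (q, stay r))"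
  obtain ts where ts: "tm_init (pmachine K S c) x = (0, ts)" "length ts = K"
    and tau: "tapes_of ts = (\<lambda>i. (word_cells (if i = 0 then x else []), 0))"
    using \<open>2 \<le> K\<close> by (auto simp: tm_init_def pmachine_def tapes_of_def fun_eq_iff nth_Cons split: nat.splits)
  have "(gstep G ^^ t) (0, tapes_of ts) = (0 + psize c, \<tau>')"
    using ex unfolding tau by (rule gstep_exec) (auto simp: G_def shift_def)
  \<comment> \<open>\<open>tm_computes_within\<close> looks at the configuration at time
    \<open>T\<close> exactly; the halting state is idle, so the remaining \<open>T - t\<close> steps
    change nothing.\<close>
  then have "(gstep G ^^ ((T - t) + t)) (0, tapes_of ts) = (psize c, \<tau>')"
    by (simp only: funpow_add o_apply) (simp add: gstep_idle G_def)
  then have "(gstep G ^^ T) (0, tapes_of ts) = (psize c, \<tau>')"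
    using \<open>t \<le> T\<close> by simp
  then obtain ts' where "(tm_step (pmachine K S c) ^^ T) (0, ts) = (psize c, ts')" "length ts' = K"
    "\<tau>' = tapes_of ts'"
    using tm_steps_pmachine[OF wf ts(2), of T 0] by (auto simp: G_def)
  then show ?thesis
    using assms(2,6,7) out ts(1) unfolding tm_computes_within_def
    by (simp add: tapes_of_def pmachine_def)
qed

section \<open>Elementary tape operations\<close>

definition act :: "nat set \<Rightarrow> ((nat \<Rightarrow> nat) \<Rightarrow> nat \<Rightarrow> nat) \<Rightarrow> move \<Rightarrow> prog" where
  "act X g d = Act (\<lambda>r i. if i \<in> X then (g r i, d) else stay r i)"

definition mv :: "nat set \<Rightarrow> move \<Rightarrow> prog" where
  "mv X d = act X (\<lambda>r. r) d"

definition displace :: "nat set \<Rightarrow> int \<Rightarrow> tapes \<Rightarrow> tapes" where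
  "displace X \<delta> \<tau> = (\<lambda>i. if i \<in> X then (fst (\<tau> i), snd (\<tau> i) + \<delta>) else \<tau> i)"

lemma displace_displace [simp]: "displace X a (displace X b \<tau>) = displace X (a + b) \<tau>"
  by (auto simp: displace_def fun_eq_iff)

lemma displace_0 [simp]: "displace X 0 \<tau> = \<tau>"
  by (auto simp: displace_def fun_eq_iff)

lemma rd_eq: "rd \<tau> i = fst (\<tau> i) (snd (\<tau> i))"
  by (cases "\<tau> i") (simp add: rd_def)

lemma exec_act:
  "exec (act X g d) \<tau> 1 (\<lambda>i. if i \<in> X
     then ((fst (\<tau> i))(snd (\<tau> i) := g (rd \<tau>) i), snd (\<tau> i) + move_offset d) else \<tau> i)"
proof -
  have "(\<lambda>i. act_tape (if i \<in> X then (g (rd \<tau>) i, d) else stay (rd \<tau>) i) (\<tau> i)) =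
      (\<lambda>i. if i \<in> X then ((fst (\<tau> i))(snd (\<tau> i) := g (rd \<tau>) i), snd (\<tau> i) + move_offset d) else \<tau> i)"
    (is "?l = ?r")
  proof
    fix i show "?l i = ?r i" using act_tape_stay[of \<tau> i] by (cases "i \<in> X"; cases "\<tau> i") auto
  qed
  then show ?thesis
    unfolding act_def using exec.Act[of "\<lambda>r i. if i \<in> X then (g r i, d) else stay r i" \<tau>] by simp
qed

lemma exec_mv: "exec (mv X d) \<tau> 1 (displace X (move_offset d) \<tau>)"
proof -
  have "(\<lambda>i. if i \<in> X then ((fst (\<tau> i))(snd (\<tau> i) := rd \<tau> i), snd (\<tau> i) + move_offset d) else \<tau> i)
     = displace X (move_offset d) \<tau>"
    by (auto simp: displace_def fun_eq_iff rd_eq)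
  then show ?thesis using exec_act[of X "\<lambda>r. r" d \<tau>] by (simp add: mv_def)
qed

text \<open>The tape states between iterations are given explicitly as \<open>s\<close>. Every round
  adds 2 for the test and the jump back, and the failing test costs 1.\<close>

lemma exec_while_seq:
  assumes "\<And>k. k < n \<Longrightarrow> P (rd (s k))" "\<not> P (rd (s n))"
    and "\<And>k. k < n \<Longrightarrow> \<exists>t\<le>T. exec a (s k) t (s (Suc k))"
  shows "\<exists>t\<le>n * (T + 2) + 1. exec (PWhile P a) (s 0) t (s n)"
  using assms
proof (induction n arbitrary: s)
  case 0
  then have "exec (PWhile P a) (s 0) 1 (s 0)" by (intro exec.WhileF)
  then show ?case by auto
next
  case (Suc n)
  have "\<exists>t\<le>n * (T + 2) + 1. exec (PWhile P a) (s (Suc 0)) t (s (Suc n))"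
    by (rule Suc.IH[of "\<lambda>k. s (Suc k)"]) (use Suc.prems in auto)
  then obtain t where t: "t \<le> n * (T + 2) + 1" "exec (PWhile P a) (s (Suc 0)) t (s (Suc n))" by auto
  obtain t' where "t' \<le> T" "exec a (s 0) t' (s (Suc 0))" using Suc.prems(3)[of 0] by auto
  then have "exec (PWhile P a) (s 0) (t' + t + 2) (s (Suc n))"
    using t(2) Suc.prems(1)[of 0] by (intro exec.WhileT) auto
  moreover have "t' + t + 2 \<le> Suc n * (T + 2) + 1" using t \<open>t' \<le> T\<close> by simp
  ultimately show ?case by blast
qed

lemma exec_walk:
  assumes "\<And>k. k < n \<Longrightarrow> P (rd (displace X (int k * move_offset d) \<tau>))"
    and "\<not> P (rd (displace X (int n * move_offset d) \<tau>))"
  shows "\<exists>t\<le>3 * n + 1. exec (PWhile P (mv X d)) \<tau> t (displace X (int n * move_offset d) \<tau>)"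
proof -
  have "\<exists>t\<le>1. exec (mv X d) (displace X (int k * move_offset d) \<tau>) t
      (displace X (int (Suc k) * move_offset d) \<tau>)" for k
    using exec_mv[of X d "displace X (int k * move_offset d) \<tau>"]
    by (auto simp: algebra_simps intro!: exI[of _ 1])
  then have "\<exists>t\<le>n * (1 + 2) + 1. exec (PWhile P (mv X d)) (displace X (int 0 * move_offset d) \<tau>) t
      (displace X (int n * move_offset d) \<tau>)"
    using assms by (intro exec_while_seq[where s = "\<lambda>k. displace X (int k * move_offset d) \<tau>"]) auto
  moreover have "n * (1 + 2) + 1 = 3 * n + 1" by simp
  ultimately show ?thesis by (simp only: mult_zero_left of_nat_0 displace_0)
qed

text \<open>A head may stand on the blank behind its word, which would stop the search for a blank
  at once; hence the initial step to the left. The search ends in the blank cell -1, which the last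
  step corrects. Only tape \<open>j\<close> decides when to stop; the other heads in
  \<open>X\<close> move along.\<close>

definition rewind :: "nat set \<Rightarrow> nat \<Rightarrow> prog" where
  "rewind X j = PSeq (mv X Move_Left) (PSeq (PWhile (\<lambda>r. r j \<noteq> 0) (mv X Move_Left)) (mv X Move_Right))"

lemma exec_SeqI:
  "\<exists>t\<le>m. exec a \<tau> t \<tau>1 \<Longrightarrow> \<exists>t\<le>n. exec b \<tau>1 t \<tau>2 \<Longrightarrow> m + n \<le> T \<Longrightarrow> \<exists>t\<le>T. exec (PSeq a b) \<tau> t \<tau>2"
  by (meson add_mono exec.Seq le_trans)

lemma exec_mv': "\<exists>t\<le>1. exec (mv X d) \<tau> t (displace X (move_offset d) \<tau>)"
  using exec_mv by blast

lemma exec_act':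
  "\<tau>' = (\<lambda>i. if i \<in> X then ((fst (\<tau> i))(snd (\<tau> i) := g (rd \<tau>) i), snd (\<tau> i) + move_offset d) else \<tau> i)
   \<Longrightarrow> \<exists>t\<le>1. exec (act X g d) \<tau> t \<tau>'"
  using exec_act by blast

lemma exec_rewind:
  assumes "j \<in> X" "\<And>k. k < h \<Longrightarrow> fst (\<tau> j) (int k) \<noteq> 0" "fst (\<tau> j) (-1) = 0" "snd (\<tau> j) = 0"
  shows "\<exists>t\<le>3 * h + 3. exec (rewind X j) (displace X (int h) \<tau>) t \<tau>"
proof -
  have "\<exists>t\<le>3 * h + 1. exec (PWhile (\<lambda>r. r j \<noteq> 0) (mv X Move_Left)) (displace X (int h - 1) \<tau>) t
      (displace X (int h * move_offset Move_Left) (displace X (int h - 1) \<tau>))"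
  proof (rule exec_walk)
    fix k assume "k < h"
    then have "int h - 1 - int k = int (h - 1 - k)" by auto
    then show "rd (displace X (int k * move_offset Move_Left) (displace X (int h - 1) \<tau>)) j \<noteq> 0"
      using assms \<open>k < h\<close> assms(2)[of "h - 1 - k"]
      by (simp add: rd_eq displace_def algebra_simps)
  qed (use assms in \<open>simp add: rd_eq displace_def\<close>)
  then have w: "\<exists>t\<le>3 * h + 1. exec (PWhile (\<lambda>r. r j \<noteq> 0) (mv X Move_Left)) (displace X (int h - 1) \<tau>) t
      (displace X (- 1) \<tau>)" by simp
  have 1: "\<exists>t\<le>1. exec (mv X Move_Left) (displace X (int h) \<tau>) t (displace X (int h - 1) \<tau>)"
    using exec_mv'[of X Move_Left "displace X (int h) \<tau>"] by (simp add: algebra_simps)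
  have 2: "\<exists>t\<le>1. exec (mv X Move_Right) (displace X (- 1) \<tau>) t \<tau>"
    using exec_mv'[of X Move_Right "displace X (- 1) \<tau>"] by simp
  show ?thesis
    unfolding rewind_def by (rule exec_SeqI[OF 1 exec_SeqI[OF w 2 order_refl]]) simp
qed

section \<open>A loop language with polynomial running time\<close>

datatype com =
    Skip
  | App nat nat
  | Clear nat
  | SetAt nat nat nat
  | IfAt nat nat nat com com
  | Seq com com (infixr ";;" 60)
  | For nat com

text \<open>A store assigns a word to every tape; the head rests on the first cell. \<open>IfAt i j s\<close> and
  \<open>SetAt i j s\<close> access the word \<open>i\<close> at the position given by the length of the word \<open>j\<close>. The number of
  iterations of a loop is capped by the length of the word \<open>k\<close>: if the program does not change this
  word, its running time is polynomially bounded by construction.\<close>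

type_synonym store = "nat \<Rightarrow> nat list"

fun run :: "nat \<Rightarrow> com \<Rightarrow> store \<Rightarrow> store" where
  "run k Skip \<sigma> = \<sigma>"
| "run k (App i s) \<sigma> = \<sigma>(i := \<sigma> i @ [s])"
| "run k (Clear i) \<sigma> = \<sigma>(i := [])"
| "run k (SetAt i j s) \<sigma> = \<sigma>(i := (\<sigma> i)[length (\<sigma> j) := s])"
| "run k (IfAt i j s a b) \<sigma> =
     (if word_cells (\<sigma> i) (int (length (\<sigma> j))) = s then run k a \<sigma> else run k b \<sigma>)"
| "run k (Seq a b) \<sigma> = run k b (run k a \<sigma>)"
| "run k (For i c) \<sigma> = (run k c ^^ min (length (\<sigma> i)) (length (\<sigma> k))) \<sigma>"

text \<open>Written symbols must be nonblank because the first blank marks the end of a word on its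
  tape, and no command may change the word \<open>k\<close> that caps the loops.\<close>

fun wfc :: "nat \<Rightarrow> nat \<Rightarrow> nat \<Rightarrow> com \<Rightarrow> bool" where
  "wfc U S k Skip \<longleftrightarrow> True"
| "wfc U S k (App i s) \<longleftrightarrow> i < U \<and> i \<noteq> k \<and> 0 < s \<and> s < S"
| "wfc U S k (Clear i) \<longleftrightarrow> i < U \<and> i \<noteq> k"
| "wfc U S k (SetAt i j s) \<longleftrightarrow> i < U \<and> j < U \<and> i \<noteq> j \<and> i \<noteq> k \<and> 0 < s \<and> s < S"
| "wfc U S k (IfAt i j s a b) \<longleftrightarrow> i < U \<and> j < U \<and> i \<noteq> j \<and> wfc U S k a \<and> wfc U S k b"
| "wfc U S k (Seq a b) \<longleftrightarrow> wfc U S k a \<and> wfc U S k b"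
| "wfc U S k (For i c) \<longleftrightarrow> i < U \<and> wfc U S k c"

text \<open>Number of tapes needed for the counters of nested loops.\<close>

fun depth :: "com \<Rightarrow> nat" where
  "depth (IfAt i j s a b) = max (depth a) (depth b)"
| "depth (Seq a b) = max (depth a) (depth b)"
| "depth (For i c) = Suc (depth c)"
| "depth c = 0"

text \<open>Tape \<open>d\<close> is the first one free for loop counters. A loop first records its
  number of iterations as ones on tape \<open>d\<close>, since the body may change the word
  \<open>i\<close>, and then erases one of them per iteration; inner loops use the tapes from
  \<open>Suc d\<close> on. \<open>SetAt\<close> rewrites a blank as a blank, so that an update
  beyond the end of the word has no effect.\<close>

fun comp :: "nat \<Rightarrow> nat \<Rightarrow> com \<Rightarrow> prog" where
  "comp k d Skip = mv {} Move_Stay"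
| "comp k d (App i s) = PSeq (PWhile (\<lambda>r. r i \<noteq> 0) (mv {i} Move_Right))
     (PSeq (act {i} (\<lambda>r j. s) Move_Stay) (rewind {i} i))"
| "comp k d (Clear i) = PSeq (PWhile (\<lambda>r. r i \<noteq> 0) (mv {i} Move_Right))
     (PSeq (mv {i} Move_Left)
     (PSeq (PWhile (\<lambda>r. r i \<noteq> 0) (act {i} (\<lambda>r j. 0) Move_Left)) (mv {i} Move_Right)))"
| "comp k d (SetAt i j s) = PSeq (PWhile (\<lambda>r. r j \<noteq> 0) (mv {i, j} Move_Right))
     (PSeq (act {i} (\<lambda>r l. if r i = 0 then 0 else s) Move_Stay) (rewind {i, j} j))"
| "comp k d (IfAt i j s a b) = PSeq (PWhile (\<lambda>r. r j \<noteq> 0) (mv {i, j} Move_Right))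
     (PIf (\<lambda>r. r i = s) (PSeq (rewind {i, j} j) (comp k d a)) (PSeq (rewind {i, j} j) (comp k d b)))"
| "comp k d (Seq a b) = PSeq (comp k d a) (comp k d b)"
| "comp k d (For i c) =
     PSeq (PWhile (\<lambda>r. r i \<noteq> 0 \<and> r k \<noteq> 0) (act {i, k, d} (\<lambda>r j. if j = d then 1 else r j) Move_Right))
     (PSeq (rewind {i, k} i)
     (PSeq (mv {d} Move_Left)
     (PSeq (PWhile (\<lambda>r. r d \<noteq> 0) (PSeq (act {d} (\<lambda>r j. 0) Move_Left) (comp k (Suc d) c)))
       (mv {d} Move_Right))))"

text \<open>How many symbols a program can append when the cap has length at most
  \<open>\<kappa>\<close>; only \<open>App\<close> lengthens a word. Adding both branches of a
  conditional is crude, but keeps the bound polynomial.\<close>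

fun ops :: "com \<Rightarrow> nat \<Rightarrow> nat" where
  "ops (App i s) \<kappa> = 1"
| "ops (IfAt i j s a b) \<kappa> = ops a \<kappa> + ops b \<kappa>"
| "ops (Seq a b) \<kappa> = ops a \<kappa> + ops b \<kappa>"
| "ops (For i c) \<kappa> = \<kappa> * ops c \<kappa>"
| "ops c \<kappa> = 0"

text \<open>\<open>V\<close> bounds all word lengths during the run. Walking to the end of a word
  takes 3 * V + 1 steps, an action 1 and the way back 3 * V + 3, together 6 * V + 5.\<close>

fun tbound :: "com \<Rightarrow> nat \<Rightarrow> nat \<Rightarrow> nat" where
  "tbound (IfAt i j s a b) \<kappa> V = 6 * V + 6 + tbound a \<kappa> V + tbound b \<kappa> V"
| "tbound (Seq a b) \<kappa> V = tbound a \<kappa> V + tbound b \<kappa> V"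
| "tbound (For i c) \<kappa> V = 6 * V + 7 + \<kappa> * (tbound c \<kappa> V + 3)"
| "tbound c \<kappa> V = 6 * V + 5"

definition layout :: "nat \<Rightarrow> tapes \<Rightarrow> store \<Rightarrow> tapes" where
  "layout U \<rho> \<sigma> = (\<lambda>i. if i < U then (word_cells (\<sigma> i), 0) else \<rho> i)"

lemma word_cells_nat [simp]: "word_cells w (int k) = (if k < length w then w ! k else 0)"
  by (simp add: word_cells_def)

lemma word_cells_neg [simp]: "word_cells w (-1) = 0"
  by (simp add: word_cells_def)

lemma word_cells_snoc: "(word_cells w)(int (length w) := s) = word_cells (w @ [s])"
  by (auto simp: word_cells_def fun_eq_iff nth_append)

lemma word_cells_update: "k < length w \<Longrightarrow> (word_cells w)(int k := s) = word_cells (w[k := s])"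
  by (auto simp: word_cells_def fun_eq_iff nth_list_update)

lemma word_cells_butlast: "(word_cells (w @ [s]))(int (length w) := 0) = word_cells w"
  by (auto simp: word_cells_def fun_eq_iff nth_append)

lemma nonblank_nth: "0 \<notin> set w \<Longrightarrow> k < length w \<Longrightarrow> w ! k \<noteq> (0::nat)"
  by (metis nth_mem)

lemma run_nonblank:
  assumes "wfc U S k c" "\<And>i. 0 \<notin> set (\<sigma> i)"
  shows "0 \<notin> set (run k c \<sigma> i)"
  using assms
proof (induction c arbitrary: \<sigma> i)
  case (SetAt a b s)
  then show ?case using set_update_subset_insert[of "\<sigma> a" "length (\<sigma> b)" s] by auto
next
  case (For a c)
  have "0 \<notin> set ((run k c ^^ n) \<sigma> i)" for n i
    by (induction n arbitrary: i) (use For in auto)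
  then show ?case by simp
qed auto

lemma run_cap: "wfc U S k c \<Longrightarrow> run k c \<sigma> k = \<sigma> k"
proof (induction c arbitrary: \<sigma>)
  case (For a c)
  have "(run k c ^^ n) \<sigma> k = \<sigma> k" for n
    by (induction n) (use For in auto)
  then show ?case by simp
qed auto

lemma length_run:
  "wfc U S k c \<Longrightarrow> length (\<sigma> k) \<le> \<kappa> \<Longrightarrow> length (run k c \<sigma> i) \<le> length (\<sigma> i) + ops c \<kappa>"
proof (induction c arbitrary: \<sigma> i)
  case (Seq a b)
  then have "length (run k a \<sigma> k) \<le> \<kappa>" by (simp add: run_cap[of U S])
  then show ?case
    using Seq.IH(1)[of \<sigma> i] Seq.IH(2)[of "run k a \<sigma>" i] Seq.prems by simp
next
  case (For a c)
  have "length ((run k c ^^ n) \<sigma> k) \<le> \<kappa> \<and> length ((run k c ^^ n) \<sigma> i) \<le> length (\<sigma> i) + n * ops c \<kappa>" for n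
  proof (induction n)
    case (Suc n)
    then show ?case
      using For.IH[of "(run k c ^^ n) \<sigma>" i] For.prems run_cap[of U S k c "(run k c ^^ n) \<sigma>"] by simp
  qed (use For in simp)
  moreover have "min (length (\<sigma> a)) (length (\<sigma> k)) * ops c \<kappa> \<le> \<kappa> * ops c \<kappa>"
    using For.prems by (intro mult_right_mono) auto
  ultimately show ?case using add_left_mono order_trans by (simp, blast)
next
  case (IfAt a b s c d)
  then show ?case by (auto intro: le_trans[OF IfAt.IH(1)] le_trans[OF IfAt.IH(2)])
qed auto

lemma exec_to_end:
  assumes "j \<in> X" "\<tau> j = (word_cells w, 0)" "0 \<notin> set w"
  shows "\<exists>t\<le>3 * length w + 1. exec (PWhile (\<lambda>r. r j \<noteq> 0) (mv X Move_Right)) \<tau> t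
           (displace X (int (length w)) \<tau>)"
  using exec_walk[of "length w" "\<lambda>r. r j \<noteq> 0" X Move_Right \<tau>] assms
  by (simp add: rd_eq displace_def nonblank_nth)

lemma exec_rewind_word:
  assumes "j \<in> X" "\<tau> j = (word_cells w, 0)" "0 \<notin> set w" "h \<le> length w"
  shows "\<exists>t\<le>3 * h + 3. exec (rewind X j) (displace X (int h) \<tau>) t \<tau>"
  using exec_rewind[of j X h \<tau>] assms by (auto simp: nonblank_nth)

lemma exec_mono: "\<exists>t\<le>m. exec c \<tau> t \<tau>' \<Longrightarrow> m \<le> n \<Longrightarrow> \<exists>t\<le>n. exec c \<tau> t \<tau>'"
  using le_trans by blast

lemma layout_simps [simp]:
  "i < U \<Longrightarrow> layout U \<rho> \<sigma> i = (word_cells (\<sigma> i), 0)"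
  "\<not> i < U \<Longrightarrow> layout U \<rho> \<sigma> i = \<rho> i"
  by (auto simp: layout_def)

text \<open>The background \<open>\<rho>\<close> is general because a loop body runs while the
  counters of the enclosing loops occupy tapes between \<open>U\<close> and \<open>d\<close>; these
  come out unchanged. The last hypothesis reserves room for all symbols still to be appended, so
  that \<open>V\<close> bounds every intermediate word length.\<close>

theorem exec_comp:
  assumes "wfc U S k c" "k < U" "U \<le> d" "\<And>i. i \<ge> d \<Longrightarrow> \<rho> i = (word_cells [], 0)"
    and "\<And>i. 0 \<notin> set (\<sigma> i)" "length (\<sigma> k) \<le> \<kappa>" "\<And>i. length (\<sigma> i) + ops c \<kappa> \<le> V"
  shows "\<exists>t\<le>tbound c \<kappa> V. exec (comp k d c) (layout U \<rho> \<sigma>) t (layout U \<rho> (run k c \<sigma>))"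
  using assms
proof (induction c arbitrary: d \<rho> \<sigma>)
  case Skip
  have "displace {} 0 (layout U \<rho> \<sigma>) = layout U \<rho> \<sigma>" by simp
  then have "\<exists>t\<le>1. exec (mv {} Move_Stay) (layout U \<rho> \<sigma>) t (layout U \<rho> \<sigma>)"
    using exec_mv'[of "{}" Move_Stay "layout U \<rho> \<sigma>"] by simp
  then show ?case by (fastforce intro: exec_mono[of 1])
next
  case (App i s)
  let ?\<sigma> = "\<sigma>(i := \<sigma> i @ [s])" and ?L = "int (length (\<sigma> i))"
  have i: "i < U" "0 < s" using App.prems by auto
  have 1: "\<exists>t\<le>3 * length (\<sigma> i) + 1. exec (PWhile (\<lambda>r. r i \<noteq> 0) (mv {i} Move_Right)) (layout U \<rho> \<sigma>) t
      (displace {i} ?L (layout U \<rho> \<sigma>))"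
    by (rule exec_to_end) (use i App.prems in auto)
  have 2: "\<exists>t\<le>1. exec (act {i} (\<lambda>r j. s) Move_Stay) (displace {i} ?L (layout U \<rho> \<sigma>)) t
      (displace {i} ?L (layout U \<rho> ?\<sigma>))"
    by (rule exec_act') (use i in \<open>auto simp: fun_eq_iff displace_def layout_def word_cells_snoc\<close>)
  have 3: "\<exists>t\<le>3 * length (\<sigma> i) + 3. exec (rewind {i} i) (displace {i} ?L (layout U \<rho> ?\<sigma>)) t (layout U \<rho> ?\<sigma>)"
    by (rule exec_rewind_word[where w = "\<sigma> i @ [s]"]) (use i App.prems in auto)
  have "length (\<sigma> i) \<le> V" using App.prems(7)[of i] by simp
  then show ?case
    by (simp only: comp.simps run.simps)
      (rule exec_SeqI[OF 1 exec_SeqI[OF 2 3 order_refl]], simp)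
next
  case (Clear i)
  let ?w = "\<sigma> i"
  let ?n = "length ?w"
  have i: "i < U" and nb: "0 \<notin> set ?w" using Clear.prems by auto
  have V: "?n \<le> V" using Clear.prems(7)[of i] by simp
  \<comment> \<open>After \<open>m\<close> erasures the head stands on the last remaining symbol,
    and on the blank cell -1 when none is left.\<close>
  define s where "s m = (\<lambda>l. if l = i then (word_cells (take (?n - m) ?w), int ?n - 1 - int m)
      else layout U \<rho> \<sigma> l)" for m
  have 1: "\<exists>t\<le>3 * ?n + 1. exec (PWhile (\<lambda>r. r i \<noteq> 0) (mv {i} Move_Right)) (layout U \<rho> \<sigma>) t
      (displace {i} (int ?n) (layout U \<rho> \<sigma>))"
    by (rule exec_to_end) (use i nb in auto)
  have "displace {i} (int ?n - 1) (layout U \<rho> \<sigma>) = s 0"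
    using i by (auto simp: displace_def s_def fun_eq_iff)
  then have 2: "\<exists>t\<le>1. exec (mv {i} Move_Left) (displace {i} (int ?n) (layout U \<rho> \<sigma>)) t (s 0)"
    using exec_mv'[of "{i}" Move_Left "displace {i} (int ?n) (layout U \<rho> \<sigma>)"] by simp
  have 3: "\<exists>t\<le>?n * (1 + 2) + 1. exec (PWhile (\<lambda>r. r i \<noteq> 0) (act {i} (\<lambda>r j. 0) Move_Left)) (s 0) t (s ?n)"
  proof (rule exec_while_seq)
    fix m assume m: "m < ?n"
    have idx: "int ?n - 1 - int m = int (?n - Suc m)" using m by simp
    show "rd (s m) i \<noteq> 0"
      using m nonblank_nth[OF nb, of "?n - Suc m"]
      by (simp add: rd_eq s_def idx diff_less_mono2 del: of_nat_diff of_nat_Suc)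
    have tk: "take (?n - m) ?w = take (?n - Suc m) ?w @ [?w ! (?n - Suc m)]"
      using m by (metis Suc_diff_Suc diff_less take_Suc_conv_app_nth zero_less_Suc le_less_trans zero_le)
    have l: "length (take (?n - Suc m) ?w) = ?n - Suc m" by simp
    have "(word_cells (take (?n - m) ?w))(int ?n - 1 - int m := 0) = word_cells (take (?n - Suc m) ?w)"
      using word_cells_butlast[of "take (?n - Suc m) ?w" "?w ! (?n - Suc m)"] unfolding l tk idx .
    then show "\<exists>t\<le>1. exec (act {i} (\<lambda>r j. 0) Move_Left) (s m) t (s (Suc m))"
      using m by (intro exec_act') (auto simp: s_def fun_eq_iff)
  next
    show "\<not> rd (s ?n) i \<noteq> 0" by (simp add: rd_eq s_def)
  qed
  have "displace {i} 1 (s ?n) = layout U \<rho> (\<sigma>(i := []))"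
    using i by (auto simp: displace_def s_def fun_eq_iff layout_def)
  then have 4: "\<exists>t\<le>1. exec (mv {i} Move_Right) (s ?n) t (layout U \<rho> (\<sigma>(i := [])))"
    using exec_mv'[of "{i}" Move_Right "s ?n"] by simp
  show ?case
    by (simp only: comp.simps run.simps)
      (rule exec_SeqI[OF 1 exec_SeqI[OF 2 exec_SeqI[OF 3 4 order_refl] order_refl]], use V in simp)
next
  case (SetAt i j s)
  let ?\<sigma> = "\<sigma>(i := (\<sigma> i)[length (\<sigma> j) := s])" and ?L = "int (length (\<sigma> j))"
  have i: "i < U" "j < U" "i \<noteq> j" "0 < s" using SetAt.prems by auto
  have 1: "\<exists>t\<le>3 * length (\<sigma> j) + 1. exec (PWhile (\<lambda>r. r j \<noteq> 0) (mv {i, j} Move_Right)) (layout U \<rho> \<sigma>) t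
      (displace {i, j} ?L (layout U \<rho> \<sigma>))"
    by (rule exec_to_end) (use i SetAt.prems in auto)
  have w: "(word_cells (\<sigma> i))(?L := if word_cells (\<sigma> i) ?L = 0 then 0 else s) =
      word_cells ((\<sigma> i)[length (\<sigma> j) := s])"
    using SetAt.prems(5)[of i] nonblank_nth[of "\<sigma> i" "length (\<sigma> j)"] word_cells_update[of "length (\<sigma> j)" "\<sigma> i" s]
    by (cases "length (\<sigma> j) < length (\<sigma> i)") (auto simp: fun_upd_idem list_update_beyond)
  have 2: "\<exists>t\<le>1. exec (act {i} (\<lambda>r l. if r i = 0 then 0 else s) Move_Stay)
      (displace {i, j} ?L (layout U \<rho> \<sigma>)) t (displace {i, j} ?L (layout U \<rho> ?\<sigma>))"
    by (rule exec_act', rule ext) (use i in \<open>auto simp: w displace_def layout_def rd_eq simp del: word_cells_nat\<close>)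
  have 3: "\<exists>t\<le>3 * length (\<sigma> j) + 3. exec (rewind {i, j} j) (displace {i, j} ?L (layout U \<rho> ?\<sigma>)) t (layout U \<rho> ?\<sigma>)"
    by (rule exec_rewind_word[where w = "\<sigma> j"]) (use i SetAt.prems in auto)
  have "length (\<sigma> j) \<le> V" using SetAt.prems(7)[of j] by simp
  then show ?case
    by (simp only: comp.simps run.simps)
      (rule exec_SeqI[OF 1 exec_SeqI[OF 2 3 order_refl]], simp)
next
  case (IfAt i j s a b)
  let ?L = "int (length (\<sigma> j))"
  have i: "i < U" "j < U" "i \<noteq> j" using IfAt.prems by auto
  have V: "length (\<sigma> j) \<le> V" using IfAt.prems(7)[of j] by simp
  have 1: "\<exists>t\<le>3 * length (\<sigma> j) + 1. exec (PWhile (\<lambda>r. r j \<noteq> 0) (mv {i, j} Move_Right)) (layout U \<rho> \<sigma>) t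
      (displace {i, j} ?L (layout U \<rho> \<sigma>))"
    by (rule exec_to_end) (use i IfAt.prems in auto)
  have 2: "\<exists>t\<le>3 * length (\<sigma> j) + 3. exec (rewind {i, j} j) (displace {i, j} ?L (layout U \<rho> \<sigma>)) t (layout U \<rho> \<sigma>)"
    by (rule exec_rewind_word[where w = "\<sigma> j"]) (use i IfAt.prems in auto)
  have r: "rd (displace {i, j} ?L (layout U \<rho> \<sigma>)) i = word_cells (\<sigma> i) ?L"
    using i by (simp add: rd_eq displace_def)
  have lens: "length (\<sigma> l) + ops a \<kappa> \<le> V" "length (\<sigma> l) + ops b \<kappa> \<le> V" for l
    using IfAt.prems(7)[of l] by auto
  have "\<exists>t\<le>3 * length (\<sigma> j) + 5 + tbound a \<kappa> V + tbound b \<kappa> V.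
      exec (PIf (\<lambda>r. r i = s) (PSeq (rewind {i, j} j) (comp k d a)) (PSeq (rewind {i, j} j) (comp k d b)))
      (displace {i, j} ?L (layout U \<rho> \<sigma>)) t (layout U \<rho> (run k (IfAt i j s a b) \<sigma>))"
  proof (cases "word_cells (\<sigma> i) ?L = s")
    case True
    have "\<exists>t\<le>tbound a \<kappa> V. exec (comp k d a) (layout U \<rho> \<sigma>) t (layout U \<rho> (run k a \<sigma>))"
      using IfAt.prems lens by (intro IfAt.IH(1)) auto
    from exec_SeqI[OF 2 this order_refl] obtain t where
      "t \<le> 3 * length (\<sigma> j) + 3 + tbound a \<kappa> V"
      "exec (PSeq (rewind {i, j} j) (comp k d a)) (displace {i, j} ?L (layout U \<rho> \<sigma>)) t (layout U \<rho> (run k a \<sigma>))"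
      by blast
    then show ?thesis
      using True r by (intro exI[of _ "t + 2"] conjI, simp, simp only: run.simps if_True, intro exec.IfT) auto
  next
    case False
    have "\<exists>t\<le>tbound b \<kappa> V. exec (comp k d b) (layout U \<rho> \<sigma>) t (layout U \<rho> (run k b \<sigma>))"
      using IfAt.prems lens by (intro IfAt.IH(2)) auto
    from exec_SeqI[OF 2 this order_refl] obtain t where
      "t \<le> 3 * length (\<sigma> j) + 3 + tbound b \<kappa> V"
      "exec (PSeq (rewind {i, j} j) (comp k d b)) (displace {i, j} ?L (layout U \<rho> \<sigma>)) t (layout U \<rho> (run k b \<sigma>))"
      by blast
    then show ?thesis
      using False r by (intro exI[of _ "t + 1"] conjI, simp, simp only: run.simps if_False, intro exec.IfF) auto
  qed
  from exec_SeqI[OF 1 this order_refl] show ?case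
    by (simp only: comp.simps) (erule exec_mono, use V in simp)
next
  case (Seq a b)
  have lens: "length (\<sigma> l) + ops a \<kappa> \<le> V" for l
    using Seq.prems(7)[of l] by auto
  have 1: "\<exists>t\<le>tbound a \<kappa> V. exec (comp k d a) (layout U \<rho> \<sigma>) t (layout U \<rho> (run k a \<sigma>))"
    using Seq.prems lens by (intro Seq.IH(1)) auto
  have a: "wfc U S k a" using Seq.prems by simp
  have lens': "length (run k a \<sigma> l) + ops b \<kappa> \<le> V" for l
    using Seq.prems(7)[of l] length_run[OF a, of \<sigma> \<kappa> l] Seq.prems(6) by simp
  have 2: "\<exists>t\<le>tbound b \<kappa> V. exec (comp k d b) (layout U \<rho> (run k a \<sigma>)) t (layout U \<rho> (run k b (run k a \<sigma>)))"
    using Seq.prems lens' run_cap[OF a] run_nonblank[OF a Seq.prems(5)] by (intro Seq.IH(2)) auto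
  show ?case
    by (simp only: comp.simps run.simps) (rule exec_SeqI[OF 1 2], simp)
next
  case (For i c)
  let ?n = "min (length (\<sigma> i)) (length (\<sigma> k))"
  have i: "i < U" "i \<noteq> d" "k \<noteq> d" "\<not> d < U" and c: "wfc U S k c" using For.prems by auto
  have V: "length (\<sigma> i) \<le> V" using For.prems(7)[of i] by simp
  \<comment> \<open>The background with \<open>a\<close> ones on the counter tape \<open>d\<close>
    and its head in cell \<open>h\<close>.\<close>
  define \<rho>' where "\<rho>' a h = \<rho>(d := (word_cells (replicate a 1), h))" for a h
  define s where "s m = displace {i, k} (int m) (layout U (\<rho>' m (int m)) \<sigma>)" for m
  have s0: "s 0 = layout U \<rho> \<sigma>"
    using For.prems(4)[of d] by (simp add: s_def \<rho>'_def fun_upd_idem)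
  have 1: "\<exists>t\<le>?n * (1 + 2) + 1. exec (PWhile (\<lambda>r. r i \<noteq> 0 \<and> r k \<noteq> 0)
      (act {i, k, d} (\<lambda>r j. if j = d then 1 else r j) Move_Right)) (s 0) t (s ?n)"
  proof (rule exec_while_seq)
    fix m assume m: "m < ?n"
    then show "rd (s m) i \<noteq> 0 \<and> rd (s m) k \<noteq> 0"
      using i For.prems by (simp add: rd_eq s_def displace_def nonblank_nth)
    have "(word_cells (replicate m 1))(int m := 1) = word_cells (replicate (Suc m) 1)"
      using word_cells_snoc[of "replicate m 1" 1] by (simp add: replicate_append_same)
    then show "\<exists>t\<le>1. exec (act {i, k, d} (\<lambda>r j. if j = d then 1 else r j) Move_Right) (s m) t (s (Suc m))"
      using i by (intro exec_act') (auto simp: s_def \<rho>'_def fun_eq_iff displace_def layout_def rd_eq)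
  next
    show "\<not> (rd (s ?n) i \<noteq> 0 \<and> rd (s ?n) k \<noteq> 0)"
      using i For.prems by (auto simp: rd_eq s_def displace_def min_def)
  qed
  have 2: "\<exists>t\<le>3 * ?n + 3. exec (rewind {i, k} i) (s ?n) t (layout U (\<rho>' ?n (int ?n)) \<sigma>)"
    unfolding s_def by (rule exec_rewind_word[where w = "\<sigma> i"]) (use i For.prems in auto)
  \<comment> \<open>After \<open>m\<close> iterations the counter has \<open>?n - m\<close> ones and
    its head is on the last of them; for \<open>m = ?n\<close> it has reached cell -1, whose blank
    ends the loop.\<close>
  define u where "u m = layout U (\<rho>' (?n - m) (int ?n - 1 - int m)) ((run k c ^^ m) \<sigma>)" for m
  have "displace {d} (- 1) (layout U (\<rho>' ?n (int ?n)) \<sigma>) = u 0"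
    using i by (auto simp: u_def displace_def layout_def \<rho>'_def fun_eq_iff)
  then have 3: "\<exists>t\<le>1. exec (mv {d} Move_Left) (layout U (\<rho>' ?n (int ?n)) \<sigma>) t (u 0)"
    using exec_mv'[of "{d}" Move_Left "layout U (\<rho>' ?n (int ?n)) \<sigma>"] by simp
  have 4: "\<exists>t\<le>?n * (1 + tbound c \<kappa> V + 2) + 1. exec (PWhile (\<lambda>r. r d \<noteq> 0)
      (PSeq (act {d} (\<lambda>r j. 0) Move_Left) (comp k (Suc d) c))) (u 0) t (u ?n)"
  proof (rule exec_while_seq)
    fix m assume m: "m < ?n"
    let ?\<sigma> = "(run k c ^^ m) \<sigma>"
    have idx: "int ?n - 1 - int m = int (?n - Suc m)" using m by simp
    have "?n - Suc m < ?n - m" using m by (metis diff_less_mono2 lessI)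
    then show "rd (u m) d \<noteq> 0"
      using i unfolding u_def idx by (simp add: rd_eq \<rho>'_def del: of_nat_diff of_nat_Suc)
    have inv: "(\<forall>l. 0 \<notin> set ((run k c ^^ p) \<sigma> l)) \<and> (run k c ^^ p) \<sigma> k = \<sigma> k \<and>
        (\<forall>l. length ((run k c ^^ p) \<sigma> l) \<le> length (\<sigma> l) + p * ops c \<kappa>)" for p
    proof (induction p)
      case (Suc p)
      let ?s = "(run k c ^^ p) \<sigma>"
      have "length (run k c ?s l) \<le> length (\<sigma> l) + Suc p * ops c \<kappa>" for l
      proof -
        have "length (run k c ?s l) \<le> length (?s l) + ops c \<kappa>"
          using Suc For.prems(6) by (intro length_run[OF c]) simp
        moreover have "length (?s l) \<le> length (\<sigma> l) + p * ops c \<kappa>" using Suc by blast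
        ultimately show ?thesis by simp
      qed
      then show ?case
        using Suc run_nonblank[OF c, of ?s] run_cap[OF c, of ?s] by simp
    qed (use For.prems in auto)
    \<comment> \<open>At most \<open>\<kappa> - 1\<close> iterations precede this one, so the
      reserve \<open>\<kappa> * ops c \<kappa>\<close> still covers it.\<close>
    have "length (?\<sigma> l) + ops c \<kappa> \<le> V" for l
    proof -
      have "Suc m * ops c \<kappa> \<le> \<kappa> * ops c \<kappa>"
        using m For.prems(6) by (intro mult_right_mono) auto
      moreover have "length (?\<sigma> l) \<le> length (\<sigma> l) + m * ops c \<kappa>" using inv[of m] by blast
      ultimately show ?thesis using For.prems(7)[of l] by simp
    qed
    then have body: "\<exists>t\<le>tbound c \<kappa> V. exec (comp k (Suc d) c)
        (layout U (\<rho>' (?n - Suc m) (int ?n - 1 - int (Suc m))) ?\<sigma>) t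
        (layout U (\<rho>' (?n - Suc m) (int ?n - 1 - int (Suc m))) (run k c ?\<sigma>))"
      using For.prems inv[of m] by (intro For.IH) (auto simp: \<rho>'_def)
    have erase: "\<exists>t\<le>1. exec (act {d} (\<lambda>r j. 0) Move_Left) (u m) t
        (layout U (\<rho>' (?n - Suc m) (int ?n - 1 - int (Suc m))) ?\<sigma>)"
    proof (rule exec_act')
      have "replicate (?n - m) 1 = replicate (?n - Suc m) 1 @ [1::nat]"
        using m by (metis Suc_diff_Suc replicate_Suc replicate_append_same)
      then have "(word_cells (replicate (?n - m) 1))(int ?n - 1 - int m := 0) = word_cells (replicate (?n - Suc m) 1)"
        using word_cells_butlast[of "replicate (?n - Suc m) 1" 1] unfolding idx by simp
      then show "layout U (\<rho>' (?n - Suc m) (int ?n - 1 - int (Suc m))) ?\<sigma> =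
        (\<lambda>i. if i \<in> {d} then ((fst (u m i))(snd (u m i) := 0), snd (u m i) + move_offset Move_Left) else u m i)"
        using i by (auto simp: u_def \<rho>'_def layout_def fun_eq_iff)
    qed
    show "\<exists>t\<le>1 + tbound c \<kappa> V. exec (PSeq (act {d} (\<lambda>r j. 0) Move_Left) (comp k (Suc d) c)) (u m) t (u (Suc m))"
      using exec_SeqI[OF erase body order_refl] unfolding u_def[of "Suc m"] funpow.simps o_apply .
  next
    show "\<not> rd (u ?n) d \<noteq> 0" using i by (simp add: rd_eq u_def \<rho>'_def)
  qed
  have "displace {d} 1 (u ?n) = layout U \<rho> ((run k c ^^ ?n) \<sigma>)"
    using i For.prems(4)[of d] by (auto simp: displace_def u_def fun_eq_iff layout_def \<rho>'_def)
  then have 5: "\<exists>t\<le>1. exec (mv {d} Move_Right) (u ?n) t (layout U \<rho> ((run k c ^^ ?n) \<sigma>))"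
    using exec_mv'[of "{d}" Move_Right "u ?n"] by simp
  have "?n * (1 + tbound c \<kappa> V + 2) \<le> \<kappa> * (tbound c \<kappa> V + 3)"
    using For.prems(6) by (intro mult_mono) auto
  moreover have "?n \<le> V" using V by simp
  moreover have "q * (1 + 2) + 1 + (3 * q + 3 + (1 + (X + 1 + 1))) \<le> 6 * V + 7 + Y" if "X \<le> Y" "q \<le> V" for q X Y :: nat
    using that by simp
  ultimately have "?n * (1 + 2) + 1 + (3 * ?n + 3 + (1 + (?n * (1 + tbound c \<kappa> V + 2) + 1 + 1))) \<le> tbound (For i c) \<kappa> V"
    unfolding tbound.simps by blast
  then show ?case
    using exec_SeqI[OF 1 exec_SeqI[OF 2 exec_SeqI[OF 3 exec_SeqI[OF 4 5 order_refl] order_refl] order_refl]]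
    unfolding s0 by (simp only: comp.simps run.simps)
qed

lemma wfp_comp:
  assumes "wfc U S k c" "k < U" "U \<le> d" "d + depth c \<le> K" "2 \<le> S"
  shows "wfp K S (comp k d c)"
  using assms
  by (induction c arbitrary: d)
    (auto simp: rewind_def mv_def act_def stay_def)

section \<open>Polynomial bounds\<close>

definition poly_bounded :: "(nat \<Rightarrow> nat) \<Rightarrow> bool" where
  "poly_bounded f \<longleftrightarrow> (\<exists>p :: nat poly. \<forall>n. f n \<le> poly p n)"

lemma poly_bounded_const: "poly_bounded (\<lambda>n. c)"
  unfolding poly_bounded_def by (rule exI[of _ "[:c:]"]) simp

lemma poly_bounded_id: "poly_bounded (\<lambda>n. n)"
  unfolding poly_bounded_def by (rule exI[of _ "[:0, 1:]"]) simp

lemma poly_bounded_add: "poly_bounded f \<Longrightarrow> poly_bounded g \<Longrightarrow> poly_bounded (\<lambda>n. f n + g n)"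
  unfolding poly_bounded_def by (metis add_mono poly_add)

lemma poly_bounded_mult: "poly_bounded f \<Longrightarrow> poly_bounded g \<Longrightarrow> poly_bounded (\<lambda>n. f n * g n)"
  unfolding poly_bounded_def by (metis mult_le_mono poly_mult)

lemmas poly_bounded_intros = poly_bounded_const poly_bounded_id poly_bounded_add poly_bounded_mult

text \<open>Induction over the program, with a polynomially bounded argument, takes the place of
  composing polynomials, for which monotonicity would be needed.\<close>

lemma poly_bounded_ops: "poly_bounded g \<Longrightarrow> poly_bounded (\<lambda>n. ops c (g n))"
  by (induction c) (auto intro: poly_bounded_intros)

lemma poly_bounded_tbound:
  "poly_bounded g \<Longrightarrow> poly_bounded h \<Longrightarrow> poly_bounded (\<lambda>n. tbound c (g n) (h n))"
  by (induction c) (simp_all, (intro poly_bounded_intros; assumption)+)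

text \<open>The first program computes the cap for the loops of the second one, from the input as its own
  cap.\<close>

theorem polytime_computable_run:
  assumes wf: "wfc U S 0 P" "wfc U S k Q" "k < U" "2 \<le> U" "2 \<le> S"
    and sym: "\<And>x. x \<in> D \<Longrightarrow> set (enc x) \<subseteq> {0<..<S}" "\<And>x. x \<in> D \<Longrightarrow> set (enc' (f x)) \<subseteq> {0<..<S}"
    and res: "\<And>x. x \<in> D \<Longrightarrow> run k Q (run 0 P (\<lambda>i. if i = 0 then enc x else [])) 1 = enc' (f x)"
  shows "polytime_computable f D enc enc'"
proof -
  define c where "c = PSeq (comp 0 U P) (comp k U Q)"
  define K where "K = U + max (depth P) (depth Q)"
  \<comment> \<open>A bound on the word lengths after the first program. It serves the second one
    twice: as a bound on its cap and as a bound on the words it starts with.\<close>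
  define V where "V n = n + ops P n" for n
  define T where "T n = tbound P n (V n) + tbound Q (V n) (V n + ops Q (V n))" for n
  have "poly_bounded T"
    unfolding T_def V_def by (intro poly_bounded_intros poly_bounded_tbound poly_bounded_ops)
  then obtain p where p: "\<And>n. T n \<le> poly p n" by (auto simp: poly_bounded_def)
  have wfp: "wfp K S c" unfolding c_def K_def using wf by (auto intro!: wfp_comp)
  have "tm_computes_within (pmachine K S c) (enc x) (enc' (f x)) (poly p (length (enc x)))" if x: "x \<in> D" for x
  proof -
    let ?\<rho> = "\<lambda>i::nat. (word_cells [], 0)" and ?n = "length (enc x)"
    let ?\<sigma>0 = "\<lambda>i::nat. if i = 0 then enc x else []"
    let ?\<sigma>1 = "run 0 P ?\<sigma>0"
    have nb: "0 \<notin> set (?\<sigma>0 i)" for i using sym(1)[OF x] by auto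
    have len: "length (?\<sigma>1 i) \<le> V ?n" for i
      using length_run[OF wf(1), of ?\<sigma>0 ?n i] by (simp add: V_def split: if_splits)
    have 1: "\<exists>t\<le>tbound P ?n (V ?n). exec (comp 0 U P) (layout U ?\<rho> ?\<sigma>0) t (layout U ?\<rho> ?\<sigma>1)"
      by (rule exec_comp[OF wf(1)]) (use wf nb in \<open>auto simp: V_def\<close>)
    have 2: "\<exists>t\<le>tbound Q (V ?n) (V ?n + ops Q (V ?n)).
        exec (comp k U Q) (layout U ?\<rho> ?\<sigma>1) t (layout U ?\<rho> (run k Q ?\<sigma>1))"
      by (rule exec_comp[OF wf(2)]) (use wf len run_nonblank[OF wf(1) nb] in auto)
    from exec_SeqI[OF 1 2 order_refl] obtain t where t: "t \<le> T ?n"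
      "exec c (layout U ?\<rho> ?\<sigma>0) t (layout U ?\<rho> (run k Q ?\<sigma>1))"
      by (auto simp: c_def T_def)
    moreover have "layout U ?\<rho> ?\<sigma>0 = (\<lambda>i. (word_cells (?\<sigma>0 i), 0))"
      using wf(4) by (auto simp: layout_def fun_eq_iff)
    ultimately have ex: "exec c (\<lambda>i. (word_cells (?\<sigma>0 i), 0)) t (layout U ?\<rho> (run k Q ?\<sigma>1))"
      by simp
    show ?thesis
      by (rule pmachine_computes[OF wfp _ ex le_trans[OF t(1) p]])
        (use wf(4) res[OF x] sym x in \<open>auto simp: K_def\<close>)
  qed
  moreover have "tm_wf (pmachine K S c)"
    by (rule tm_wf_pmachine[OF wfp]) (use wf in \<open>auto simp: K_def\<close>)
  ultimately show ?thesis unfolding polytime_computable_def by blast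
qed

section \<open>Cuts and trees given by parents\<close>

lemma list_graph_simps [simp]:
  "verts (list_graph N es) = {..<N}" "edges (list_graph N es) = edge_of ` set es"
  "ends (list_graph N es) e = e"
  by (simp_all add: list_graph_def)

lemma cut_list_graph:
  "cut (list_graph N es) A = {e \<in> edge_of ` set es. \<exists>a b. e = {a, b} \<and> a \<in> A \<and> b \<notin> A}"
  by (simp add: cut_def)

lemma separated_iff [simp]: "(\<exists>a b. {x, y} = {a, b} \<and> a \<in> A \<and> b \<notin> A) \<longleftrightarrow> (x \<in> A) \<noteq> (y \<in> A)"
  by (metis doubleton_eq_iff)

text \<open>An acyclic connected graph arises whenever every vertex other than \<open>0\<close> has a parent of smaller
  rank: the neighbours, on a cycle, of a vertex of maximal rank would both be its parent.\<close>

locale parent_graph =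
  fixes N :: nat and par r :: "nat \<Rightarrow> nat" and es :: "(nat \<times> nat) list"
  assumes N: "0 < N"
    and par: "\<And>x. 0 < x \<Longrightarrow> x < N \<Longrightarrow> par x < N \<and> r (par x) < r x"
    and es: "edge_of ` set es = (\<lambda>x. {par x, x}) ` {0<..<N}"
begin

abbreviation "T \<equiv> list_graph N es"

lemma adj_T: "(x, y) \<in> adj_rel T \<longleftrightarrow> (0 < y \<and> y < N \<and> x = par y) \<or> (0 < x \<and> x < N \<and> y = par x)"
  by (auto simp: adj_rel_def es doubleton_eq_iff)

lemma simple_T: "simple_graph T"
  unfolding simple_graph_def
proof (intro conjI ballI)
  fix e assume "e \<in> edges T"
  then obtain x where "0 < x" "x < N" "e = {par x, x}" by (auto simp: es)
  then show "\<exists>u\<in>verts T. \<exists>v\<in>verts T. u \<noteq> v \<and> ends T e = {u, v}"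
    using par[of x] by (intro bexI[of _ "par x"] bexI[of _ x]) auto
qed (auto simp: inj_on_def)

lemma connected_T: "connected_graph T"
proof -
  have 1: "x < N \<Longrightarrow> (x, 0) \<in> (adj_rel T)\<^sup>*" for x
  proof (induction "r x" arbitrary: x rule: less_induct)
    case less
    then show ?case
    proof (cases "x = 0")
      case False
      then have "(x, par x) \<in> adj_rel T" "(par x, 0) \<in> (adj_rel T)\<^sup>*"
        using less par[of x] by (auto simp: adj_T)
      then show ?thesis by (rule converse_rtrancl_into_rtrancl)
    qed simp
  qed
  have "sym (adj_rel T)" by (auto simp: sym_def adj_T)
  then have 2: "(0, x) \<in> (adj_rel T)\<^sup>*" if "x < N" for x
    using 1[OF that] by (meson sym_rtrancl symD)
  show ?thesis
    unfolding connected_graph_def using N 1 2 by (auto intro: rtrancl_trans)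
qed

lemma acyclic_T: "\<not> is_cycle T vs"
proof
  assume c: "is_cycle T vs"
  let ?l = "length vs"
  have l: "3 \<le> ?l" "distinct vs" and adj: "\<And>i. i < ?l \<Longrightarrow> (vs ! i, vs ! (Suc i mod ?l)) \<in> adj_rel T"
    using c by (auto simp: is_cycle_def)
  then have l0: "0 < ?l" by linarith
  define M where "M = Max (r ` set vs)"
  have "M \<in> r ` set vs" unfolding M_def using l by (intro Max_in) auto
  then obtain i where i: "i < ?l" "r (vs ! i) = M" by (auto simp: in_set_conv_nth)
  have max: "r (vs ! j) \<le> r (vs ! i)" if "j < ?l" for j
    using that i by (simp add: M_def)
  \<comment> \<open>The cyclic predecessor of \<open>i\<close>; adding \<open>?l - 1\<close> avoids
    a subtraction on naturals.\<close>
  define j where "j = (i + (?l - 1)) mod ?l"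
  have "Suc j mod ?l = Suc (i + (?l - 1)) mod ?l" by (simp add: j_def mod_Suc_eq)
  also have "Suc (i + (?l - 1)) = i + ?l" using l by linarith
  finally have "Suc j mod ?l = (i + ?l) mod ?l" .
  then have j: "Suc j mod ?l = i" "j < ?l" using i l0 by (simp_all add: j_def)
  define k where "k = Suc i mod ?l"
  have k: "k < ?l" using l0 by (simp add: k_def)
  have "vs ! k = par (vs ! i)"
    using adj[OF i(1)] max[OF k] par[of "vs ! k"] unfolding k_def[symmetric] adj_T by auto
  moreover have "vs ! j = par (vs ! i)"
    using adj[OF j(2)] max[OF j(2)] par[of "vs ! j"] unfolding j(1) adj_T by auto
  ultimately have jk: "j = k" using l j k nth_eq_iff_index_eq by metis
  \<comment> \<open>Predecessor and successor of \<open>i\<close> coincide, which is impossible on a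
    cycle of length at least 3.\<close>
  have "Suc k = i \<or> (Suc k = ?l \<and> i = 0)"
    using j jk by (auto simp: mod_Suc split: if_splits)
  moreover have "k = Suc i \<or> (Suc i = ?l \<and> k = 0)"
    using i(1) by (auto simp: k_def mod_Suc split: if_splits)
  ultimately show False using l by auto
qed

lemma inj_parent_edge: "inj_on (\<lambda>x. {par x, x}) {0<..<N}"
proof (rule inj_onI)
  fix x y assume "x \<in> {0<..<N}" "y \<in> {0<..<N}" "{par x, x} = {par y, y}"
  then show "x = y" using par[of x] par[of y] by (auto simp: doubleton_eq_iff)
qed

end

section \<open>The reduction\<close>

definition size_of :: "mac_instance \<Rightarrow> nat" where
  "size_of I = length (mac_edges I)"

definition src :: "mac_instance \<Rightarrow> nat \<Rightarrow> nat" where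
  "src I i = fst (mac_edges I ! i)"

definition tgt :: "mac_instance \<Rightarrow> nat \<Rightarrow> nat" where
  "tgt I i = fst (snd (mac_edges I ! i))"

definition block :: "mac_instance \<Rightarrow> nat" where
  "block I = 32 * (size_of I + 1)"

text \<open>A loop never passes the test. Once an edge is attached both its ends are in
  \<open>V\<close>, so neither it nor a parallel edge passes the test again.\<close>

definition grow :: "mac_instance \<Rightarrow> nat \<Rightarrow> nat set \<times> nat set \<Rightarrow> nat set \<times> nat set" where
  "grow I i = (\<lambda>(V, F). if (src I i \<in> V) \<noteq> (tgt I i \<in> V) then (V \<union> {src I i, tgt I i}, insert i F) else (V, F))"

definition pass :: "mac_instance \<Rightarrow> nat set \<times> nat set \<Rightarrow> nat set \<times> nat set" where
  "pass I = fold (grow I) [0..<size_of I]"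

definition forest :: "mac_instance \<Rightarrow> nat set" where
  "forest I = snd ((pass I ^^ mac_order I) ({0}, {}))"

text \<open>This list and the following ones are in the order in which the program writes them.
  Taking only \<open>k < j\<close> gives every pair once.\<close>

definition clique_edges :: "mac_instance \<Rightarrow> (nat \<times> nat) list" where
  "clique_edges I = concat (map (\<lambda>a. concat (map (\<lambda>j. map (\<lambda>k. (a * block I + k, a * block I + j)) [0..<j])
     [0..<block I])) [0..<mac_order I])"

text \<open>The slots depend on the index of the edge, so parallel edges of the multigraph become
  different edges of a simple graph. Loops lie in no cut and are dropped.\<close>

definition cross_edges :: "mac_instance \<Rightarrow> nat \<Rightarrow> (nat \<times> nat) list" where
  "cross_edges I i = (if src I i = tgt I i then [] else
     [(src I i * block I, tgt I i * block I + (if i \<in> forest I then 0 else 2 * i + 1)),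
      (src I i * block I, tgt I i * block I + (2 * i + 2))])"

definition forest_edges :: "mac_instance \<Rightarrow> nat \<Rightarrow> (nat \<times> nat) list" where
  "forest_edges I i = (if i \<in> forest I then [(src I i * block I, tgt I i * block I)] else [])"

definition slot_parent :: "mac_instance \<Rightarrow> nat \<Rightarrow> nat \<Rightarrow> bool \<Rightarrow> nat \<Rightarrow> nat" where
  "slot_parent I a i b j =
     (if b \<and> tgt I i = a \<and> src I i \<noteq> tgt I i then src I i * block I else a * block I + j)"

text \<open>Every block reserves the slots \<open>2 * i + 1\<close> and \<open>2 * i + 2\<close> for
  every edge \<open>i\<close>, although only the block of its target uses them. The first copy of a
  forest edge joins two block heads instead, so its first slot keeps the path edge.\<close>

definition slot_edges :: "mac_instance \<Rightarrow> nat \<Rightarrow> nat \<Rightarrow> (nat \<times> nat) list" where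
  "slot_edges I a i =
     [(slot_parent I a i (i \<notin> forest I) (2 * i), a * block I + (2 * i + 1)),
      (slot_parent I a i (mac_weight I i = 1) (2 * i + 1), a * block I + (2 * i + 2))]"

definition path_edges :: "mac_instance \<Rightarrow> nat \<Rightarrow> (nat \<times> nat) list" where
  "path_edges I a = map (\<lambda>j. (a * block I + j, a * block I + Suc j)) [2 * size_of I..<block I - 1]"

definition graph_edges :: "mac_instance \<Rightarrow> (nat \<times> nat) list" where
  "graph_edges I = clique_edges I @ concat (map (cross_edges I) [0..<size_of I])"

definition tree_edges :: "mac_instance \<Rightarrow> (nat \<times> nat) list" where
  "tree_edges I = concat (map (forest_edges I) [0..<size_of I]) @
     concat (map (\<lambda>a. concat (map (slot_edges I a) [0..<size_of I]) @ path_edges I a) [0..<mac_order I])"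

text \<open>The case k > 1 is separated because the general formula can exceed 1 there. An average
  of weights is at most 1 and every subgraph is 1-thin, so both answers are then NO.\<close>

definition thin_tree_instance :: "mac_instance \<Rightarrow> ttv_instance" where
  "thin_tree_instance I = \<lparr>ttv_order = mac_order I * block I, ttv_edges = graph_edges I,
     ttv_tree_edges = tree_edges I,
     ttv_num = (if mac_num I > int (mac_den I) then 1
       else nat ((3 * int (mac_den I) + mac_num I) * 2 ^ size_of I - 1)),
     ttv_den = (if mac_num I > int (mac_den I) then 1 else 4 * mac_den I * 2 ^ size_of I)\<rparr>"

section \<open>A valid instance and a spanning tree of its graph\<close>

locale valid_mac =
  fixes I :: mac_instance
  assumes valid: "mac_valid I"
begin

abbreviation "n \<equiv> mac_order I"
abbreviation "m \<equiv> size_of I"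
abbreviation "B \<equiv> block I"
abbreviation "u \<equiv> src I"
abbreviation "v \<equiv> tgt I"
abbreviation "w \<equiv> mac_weight I"
abbreviation "F \<equiv> forest I"
abbreviation "G \<equiv> mac_graph I"

lemma G_simps [simp]: "verts G = {..<n}" "edges G = {..<m}" "ends G i = {u i, v i}"
  by (auto simp: mac_graph_def size_of_def src_def tgt_def split: prod.splits)

lemma ends_less: assumes "i < m" shows "u i < n" "v i < n"
proof -
  from valid have "multigraph G" by (simp add: mac_valid_def)
  then have "\<exists>a\<in>{..<n}. \<exists>b\<in>{..<n}. {u i, v i} = {a, b}"
    using assms by (auto simp: multigraph_def)
  then show "u i < n" "v i < n" by (auto simp: doubleton_eq_iff)
qed

lemma weight: "i < m \<Longrightarrow> w i = -1 \<or> w i = 1"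
  using valid by (auto simp: mac_valid_def)

lemma connected: "connected_graph G" and den_pos: "0 < mac_den I" and k_ge: "- 1 \<le> mac_k I"
  using valid by (auto simp: mac_valid_def)

lemma n_pos: "0 < n"
  using connected by (auto simp: connected_graph_def)

lemma B_ge: "32 * m + 32 \<le> B" "0 < B"
  by (auto simp: block_def)

text \<open>The chosen edges are exactly the parent edges of the visited vertices other than 0.
  Keeping the ranks \<open>\<tau>\<close> below \<open>card V\<close> leaves \<open>card V\<close>
  free as the rank of the next vertex, and in the end keeps all ranks below
  \<open>n\<close>.\<close>

definition tree_inv :: "nat set \<times> nat set \<Rightarrow> bool" where
  "tree_inv = (\<lambda>(V, F). 0 \<in> V \<and> V \<subseteq> {..<n} \<and> F \<subseteq> {..<m} \<and> (\<forall>i\<in>F. u i \<noteq> v i) \<and>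
     inj_on (\<lambda>i. {u i, v i}) F \<and>
     (\<exists>p \<tau>. (\<forall>a\<in>V. \<tau> a < card V) \<and> (\<forall>a\<in>V - {0}. p a \<in> V \<and> \<tau> (p a) < \<tau> a) \<and>
        (\<lambda>i. {u i, v i}) ` F = (\<lambda>a. {p a, a}) ` (V - {0})))"

lemma tree_inv_grow:
  assumes "tree_inv s" "i < m"
  shows "tree_inv (grow I i s)"
proof -
  obtain V F where s: "s = (V, F)" by fastforce
  show ?thesis
  proof (cases "(u i \<in> V) = (v i \<in> V)")
    case True
    then show ?thesis using assms s by (simp add: grow_def)
  next
    case False
    then obtain a b where ab: "{u i, v i} = {a, b}" "a \<in> V" "b \<notin> V" by (cases "u i \<in> V") auto
    obtain p \<tau> where inv: "0 \<in> V" "V \<subseteq> {..<n}" "F \<subseteq> {..<m}" "\<forall>i\<in>F. u i \<noteq> v i" "inj_on (\<lambda>i. {u i, v i}) F"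
      and p: "\<forall>a\<in>V. \<tau> a < card V" "\<forall>a\<in>V - {0}. p a \<in> V \<and> \<tau> (p a) < \<tau> a"
        "(\<lambda>i. {u i, v i}) ` F = (\<lambda>a. {p a, a}) ` (V - {0})"
      using assms(1) unfolding s tree_inv_def by auto
    have fin: "finite V" using inv(2) finite_subset by blast
    have bn: "b < n" "u i \<noteq> v i" using ends_less[OF assms(2)] ab by (auto simp: doubleton_eq_iff)
    \<comment> \<open>The edges chosen so far have both ends in \<open>V\<close>, whereas
      \<open>b\<close> is outside; this also excludes a parallel edge.\<close>
    have new: "{u i, v i} \<notin> (\<lambda>i. {u i, v i}) ` F"
    proof
      assume "{u i, v i} \<in> (\<lambda>i. {u i, v i}) ` F"
      then obtain c where "c \<in> V - {0}" "{a, b} = {p c, c}" unfolding p(3) ab(1) by blast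
      then show False using ab(2,3) p(2) by (auto simp: doubleton_eq_iff)
    qed
    have g: "grow I i s = (insert b V, insert i F)"
    proof -
      have "V \<union> {u i, v i} = insert b V" using ab by auto
      then show ?thesis using False by (simp add: s grow_def)
    qed
    let ?p = "p(b := a)" and ?\<tau> = "\<tau>(b := card V)"
    have "\<forall>c\<in>insert b V. ?\<tau> c < card (insert b V)" using p(1) ab fin by auto
    moreover have "\<forall>c\<in>insert b V - {0}. ?p c \<in> insert b V \<and> ?\<tau> (?p c) < ?\<tau> c"
      using p(1,2) ab inv(1) by auto
    moreover have "(\<lambda>i. {u i, v i}) ` insert i F = (\<lambda>a. {?p a, a}) ` (insert b V - {0})"
    proof -
      have "insert b V - {0} = insert b (V - {0})" using ab inv(1) by auto
      moreover have "(\<lambda>a. {?p a, a}) ` (V - {0}) = (\<lambda>a. {p a, a}) ` (V - {0})" using ab by (intro image_cong) auto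
      ultimately show ?thesis using ab p(3) by simp
    qed
    moreover have "inj_on (\<lambda>i. {u i, v i}) (insert i F)"
      using inv(5) new by (simp add: inj_on_insert) blast
    ultimately show ?thesis
      unfolding g tree_inv_def prod.case
      using inv bn assms(2) by (intro conjI exI[of _ ?p] exI[of _ ?\<tau>]) (assumption | simp)+
  qed
qed

lemma grow_mono: "fst s \<subseteq> fst (grow I i s)"
  by (cases s) (auto simp: grow_def)

lemma fold_grow_mono: "fst s \<subseteq> fst (fold (grow I) is s)"
proof (induction "is" arbitrary: s)
  case (Cons i "is")
  show ?case using grow_mono[of s i] Cons[of "grow I i s"] by auto
qed simp

lemma tree_inv_fold: "set is \<subseteq> {..<m} \<Longrightarrow> tree_inv s \<Longrightarrow> tree_inv (fold (grow I) is s)"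
  by (induction "is" arbitrary: s) (auto simp: tree_inv_grow)

lemma tree_inv_pass: "tree_inv s \<Longrightarrow> tree_inv (pass I s)"
  unfolding pass_def by (rule tree_inv_fold) auto

text \<open>The visited set only grows during a scan. If it is the same before and after, it was the
  same when edge \<open>i\<close> was examined, and \<open>i\<close> would have been attached had
  its ends been separated.\<close>

lemma pass_fixed:
  assumes "fst (pass I s) = fst s" "i < m"
  shows "u i \<in> fst s \<longleftrightarrow> v i \<in> fst s"
proof -
  define s1 where "s1 = fold (grow I) [0..<i] s"
  have "[0..<m] = [0..<i] @ i # [Suc i..<m]"
    using assms(2) upt_add_eq_append[of 0 i "m - i"] upt_conv_Cons[of i m] by simp
  then have "pass I s = fold (grow I) [Suc i..<m] (grow I i s1)"
    unfolding pass_def s1_def by simp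
  then have "fst (grow I i s1) \<subseteq> fst s" using assms(1) fold_grow_mono by metis
  moreover have "fst s \<subseteq> fst s1" unfolding s1_def by (rule fold_grow_mono)
  moreover have "fst s1 \<subseteq> fst (grow I i s1)" by (rule grow_mono)
  ultimately have "fst (grow I i s1) = fst s1" "fst s1 = fst s" by auto
  then show ?thesis by (cases s1) (auto simp: grow_def split: if_splits)
qed

text \<open>A vertex set that no edge leaves is closed under reachability. Applied to the visited
  vertices and to a side of a cut without edges.\<close>

lemma closed_eq_all:
  assumes "0 \<in> V" "\<And>i. i < m \<Longrightarrow> u i \<in> V \<longleftrightarrow> v i \<in> V"
  shows "{..<n} \<subseteq> V"
proof
  fix x assume "x \<in> {..<n}"
  then have "(0, x) \<in> (adj_rel G)\<^sup>*" using connected n_pos by (auto simp: connected_graph_def)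
  then show "x \<in> V"
  proof (induction rule: rtrancl_induct)
    case (step y z)
    then obtain i where "i < m" "{u i, v i} = {y, z}" by (auto simp: adj_rel_def)
    then show ?case using assms(2)[of i] step.IH by (auto simp: doubleton_eq_iff)
  qed (rule assms)
qed

text \<open>A scan that gains no vertex shows that no edge leaves the visited set, which is then
  everything; every other scan gains at least one vertex. So \<open>n\<close> scans suffice.\<close>

lemma passes: "tree_inv ((pass I ^^ k) ({0}, {})) \<and> min n (Suc k) \<le> card (fst ((pass I ^^ k) ({0}, {})))"
proof (induction k)
  case 0
  show ?case using n_pos by (auto simp: tree_inv_def)
next
  case (Suc k)
  let ?s = "(pass I ^^ k) ({0}, {})"
  have inv: "tree_inv ?s" "tree_inv (pass I ?s)" using Suc tree_inv_pass by auto
  then have fin: "finite (fst (pass I ?s))" and V: "0 \<in> fst ?s"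
    by (auto simp: tree_inv_def split: prod.splits intro: finite_subset)
  have sub: "fst ?s \<subseteq> fst (pass I ?s)" unfolding pass_def by (rule fold_grow_mono)
  have "min n (Suc (Suc k)) \<le> card (fst (pass I ?s))"
  proof (cases "fst (pass I ?s) = fst ?s")
    case True
    then have "{..<n} \<subseteq> fst (pass I ?s)" using closed_eq_all[OF V] pass_fixed[OF True] by simp
    then have "n \<le> card (fst (pass I ?s))" using card_mono[OF fin] by (metis card_lessThan)
    then show ?thesis by simp
  next
    case False
    then have "card (fst ?s) < card (fst (pass I ?s))" using sub fin by (intro psubset_card_mono) auto
    then show ?thesis using Suc by linarith
  qed
  then show ?case using inv by simp
qed

lemma forest_tree:
  "F \<subseteq> {..<m}" "\<forall>i\<in>F. u i \<noteq> v i" "inj_on (\<lambda>i. {u i, v i}) F"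
  "\<exists>p \<tau>. (\<forall>a\<in>{..<n}. \<tau> a < n) \<and> (\<forall>a\<in>{0<..<n}. p a < n \<and> \<tau> (p a) < \<tau> a) \<and>
     (\<lambda>i. {u i, v i}) ` F = (\<lambda>a. {p a, a}) ` {0<..<n}"
proof -
  obtain V F' where s: "(pass I ^^ n) ({0}, {}) = (V, F')" by fastforce
  have F: "F = F'" by (simp add: forest_def s)
  have inv: "tree_inv (V, F')" "n \<le> card V" using passes[of n] unfolding s by auto
  then have "V \<subseteq> {..<n}" by (auto simp: tree_inv_def)
  then have V: "V = {..<n}" using inv(2) card_subset_eq[of "{..<n}" V] card_mono[of "{..<n}" V] by auto
  have eq: "{..<n} - {0} = {0<..<n}" by auto
  show "F \<subseteq> {..<m}" "\<forall>i\<in>F. u i \<noteq> v i" "inj_on (\<lambda>i. {u i, v i}) F"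
    "\<exists>p \<tau>. (\<forall>a\<in>{..<n}. \<tau> a < n) \<and> (\<forall>a\<in>{0<..<n}. p a < n \<and> \<tau> (p a) < \<tau> a) \<and>
     (\<lambda>i. {u i, v i}) ` F = (\<lambda>a. {p a, a}) ` {0<..<n}"
    using inv(1) unfolding tree_inv_def V F prod.case eq by auto
qed

text \<open>Position \<open>j > 0\<close> of a block is a slot of edge \<open>(j - 1) div 2\<close>,
  the first one if \<open>j\<close> is odd and the second one if \<open>j\<close> is even. Beyond
  the slots this index is at least \<open>m\<close>, and only the path remains.\<close>

definition par_of :: "(nat \<Rightarrow> nat) \<Rightarrow> nat \<Rightarrow> nat" where
  "par_of p x = (let a = x div B; j = x mod B; i = (j - 1) div 2 in
     if j = 0 then p a * B
     else if i < m \<and> u i \<noteq> v i \<and> v i = a \<and> (if odd j then i \<notin> F else w i = 1) then u i * B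
     else x - 1)"

text \<open>The copy of edge \<open>i\<close> that always lies in the tree; for a forest edge it
  joins two block heads.\<close>

definition E1 :: "nat \<Rightarrow> nat set" where
  "E1 i = {u i * B, v i * B + (if i \<in> F then 0 else 2 * i + 1)}"

definition E2 :: "nat \<Rightarrow> nat set" where
  "E2 i = {u i * B, v i * B + (2 * i + 2)}"

definition proper :: "nat set" where
  "proper = {i. i < m \<and> u i \<noteq> v i}"

definition cliques :: "nat set set" where
  "cliques = {{x, y} | x y. x < y \<and> y < n * B \<and> x div B = y div B}"

abbreviation "H \<equiv> list_graph (n * B) (graph_edges I)"
abbreviation "T \<equiv> list_graph (n * B) (tree_edges I)"

lemma block_div_mod [simp]: "j < B \<Longrightarrow> (a * B + j) div B = a" "j < B \<Longrightarrow> (a * B + j) mod B = j"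
  by auto

lemma block_less: "a < n \<Longrightarrow> j < B \<Longrightarrow> a * B + j < n * B"
proof -
  assume "a < n" "j < B"
  then have "a * B + j < Suc a * B" by simp
  also have "\<dots> \<le> n * B" using \<open>a < n\<close> by (intro mult_right_mono) auto
  finally show ?thesis .
qed

lemma vertex_cases:
  assumes "x < n * B"
  obtains a j where "x = a * B + j" "a < n" "j < B"
  using assms that[of "x div B" "x mod B"] B_ge(2)
  by (simp add: less_mult_imp_div_less)

section \<open>Edge sets of the new graph and of its tree\<close>

lemma set_clique: "edge_of ` set (clique_edges I) = cliques"
proof -
  have "edge_of ` set (clique_edges I) = (\<Union>a<n. \<Union>j<B. \<Union>k<j. {{a * B + k, a * B + j}})"
    by (simp add: clique_edges_def edge_of_def image_UN image_image atLeast0LessThan UNION_singleton_eq_range)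
  also have "\<dots> = {{a * B + k, a * B + j} | a j k. a < n \<and> j < B \<and> k < j}"
    by (simp add: set_eq_iff Bex_def) blast
  also have "\<dots> = cliques"
  proof (intro equalityI subsetI)
    fix e assume "e \<in> {{a * B + k, a * B + j} | a j k. a < n \<and> j < B \<and> k < j}"
    then obtain a j k where "e = {a * B + k, a * B + j}" "a < n" "j < B" "k < j" by auto
    then show "e \<in> cliques" unfolding cliques_def
      by (intro CollectI exI[of _ "a * B + k"] exI[of _ "a * B + j"]) (auto simp: block_less)
  next
    fix e assume "e \<in> cliques"
    then obtain x y where xy: "e = {x, y}" "x < y" "y < n * B" "x div B = y div B" by (auto simp: cliques_def)
    then obtain a j where y: "y = a * B + j" "a < n" "j < B" by (metis vertex_cases)
    then have x: "x = a * B + x mod B" using xy by (metis block_div_mod(1) div_mult_mod_eq)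
    then obtain k where k: "x = a * B + k" "k < j" using xy(2) y(1) by (metis nat_add_left_cancel_less)
    then show "e \<in> {{a * B + k, a * B + j} | a j k. a < n \<and> j < B \<and> k < j}"
      unfolding xy(1) y(1) k(1) using y(2,3) k(2) by blast
  qed
  finally show ?thesis .
qed

lemma set_H: "edge_of ` set (graph_edges I) = cliques \<union> E1 ` proper \<union> E2 ` proper"
proof -
  have "edge_of ` set (concat (map (cross_edges I) [0..<m])) = E1 ` proper \<union> E2 ` proper"
  proof -
    have "edge_of ` set (cross_edges I i) = (if u i = v i then {} else {E1 i, E2 i})" for i
      by (simp add: cross_edges_def edge_of_def E1_def E2_def)
    then have "edge_of ` set (concat (map (cross_edges I) [0..<m])) = (\<Union>i<m. if u i = v i then {} else {E1 i, E2 i})"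
      by (simp add: image_UN atLeast0LessThan)
    also have "\<dots> = E1 ` proper \<union> E2 ` proper" unfolding proper_def by (auto split: if_splits)
    finally show ?thesis .
  qed
  then show ?thesis by (simp add: graph_edges_def image_Un set_clique Un_assoc)
qed

lemma slot_less: "i < m \<Longrightarrow> 2 * i + 2 < B"
  using B_ge by linarith

lemma par_of_block:
  assumes "j < B"
  shows "par_of p (a * B + j) = (let i = (j - 1) div 2 in if j = 0 then p a * B
     else if i < m \<and> u i \<noteq> v i \<and> v i = a \<and> (if odd j then i \<notin> F else w i = 1) then u i * B
     else a * B + (j - 1))"
  using assms by (simp add: par_of_def Let_def)

lemma slot_edges_par: "i < m \<Longrightarrow> a < n \<Longrightarrow> slot_edges I a i =
    map (\<lambda>x. (par_of p x, x)) [a * B + (2 * i + 1), a * B + (2 * i + 2)]"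
  using slot_less[of i] par_of_block[of "2 * i + 1" p a] par_of_block[of "2 * i + 2" p a]
  by (auto simp: slot_edges_def slot_parent_def Let_def)

lemma path_edges_par: "a < n \<Longrightarrow> path_edges I a =
    map (\<lambda>x. (par_of p x, x)) (map (\<lambda>j. a * B + Suc j) [2 * m..<B - 1])"
proof -
  have "par_of p (a * B + Suc j) = a * B + j" if "2 * m \<le> j" "Suc j < B" for j
  proof -
    have "\<not> j div 2 < m" using that by simp
    then show ?thesis using that par_of_block[of "Suc j" p a] by (simp add: Let_def)
  qed
  then have "map (\<lambda>j. (a * B + j, a * B + Suc j)) [2 * m..<B - 1] =
      map (\<lambda>j. (par_of p (a * B + Suc j), a * B + Suc j)) [2 * m..<B - 1]"
    by (intro map_cong refl) auto
  then show ?thesis by (simp only: path_edges_def map_map comp_def)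
qed

text \<open>The vertices of block \<open>a\<close> other than its head, in the order in which
  \<open>tree_edges\<close> reaches them: the slots in pairs, then the rest of the path.\<close>

definition inner :: "nat \<Rightarrow> nat list" where
  "inner a = concat (map (\<lambda>i. [a * B + (2 * i + 1), a * B + (2 * i + 2)]) [0..<m]) @
     map (\<lambda>j. a * B + Suc j) [2 * m..<B - 1]"

lemma inner_eq: "inner a = map (\<lambda>j. a * B + j) [1..<B]"
proof -
  have "concat (map (\<lambda>i. [a * B + (2 * i + 1), a * B + (2 * i + 2)]) [0..<k]) =
      map (\<lambda>j. a * B + j) [1..<2 * k + 1]" for k
  proof (induction k)
    case (Suc k)
    have "[1..<2 * Suc k + 1] = [1..<2 * k + 1] @ [2 * k + 1, 2 * k + 2]" by (simp add: upt_Suc)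
    then show ?case using Suc by simp
  qed simp
  moreover have "map (\<lambda>j. a * B + Suc j) [2 * m..<B - 1] = map (\<lambda>j. a * B + j) [2 * m + 1..<B]"
  proof -
    have "[2 * m + 1..<B] = map Suc [2 * m..<B - 1]" using B_ge by (simp add: map_Suc_upt)
    then show ?thesis by (simp add: comp_def)
  qed
  moreover have "[1..<B] = [1..<2 * m + 1] @ [2 * m + 1..<B]"
    using B_ge upt_add_eq_append[of 1 "2 * m + 1" "B - (2 * m + 1)"] by simp
  ultimately show ?thesis by (simp add: inner_def)
qed

lemma set_inner_block: "set (inner a) = {a * B + j | j. 0 < j \<and> j < B}"
proof -
  have "set (inner a) = (\<lambda>j. a * B + j) ` {1..<B}" by (simp only: inner_eq set_map set_upt)
  also have "\<dots> = {a * B + j | j. 0 < j \<and> j < B}" by (auto simp only: image_def atLeastLessThan_iff Suc_le_eq One_nat_def Bex_def Collect_mem_eq)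
  finally show ?thesis .
qed

definition inner_vertices :: "nat list" where
  "inner_vertices = concat (map inner [0..<n])"

lemma set_inner: "set inner_vertices = {x. x < n * B \<and> x mod B \<noteq> 0}"
proof (intro equalityI subsetI)
  fix x assume "x \<in> {x. x < n * B \<and> x mod B \<noteq> 0}"
  then obtain a j where "x = a * B + j" "a < n" "j < B" "j \<noteq> 0" by (auto elim: vertex_cases)
  then show "x \<in> set inner_vertices" by (auto simp: inner_vertices_def set_inner_block intro!: bexI[of _ a])
qed (auto simp: inner_vertices_def set_inner_block block_less)

lemma distinct_inner: "distinct inner_vertices"
proof -
  have "distinct (concat (map inner [0..<k]))" for k
  proof (induction k)
    case (Suc k)
    have "distinct (inner k)" by (simp add: inner_eq distinct_map inj_on_def)
    moreover have False if "x \<in> set (inner k)" "x \<in> set (inner a)" "a < k" for x a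
    proof -
      have "x div B = k" using that(1) by (auto simp: set_inner_block)
      moreover have "x div B = a" using that(2) by (auto simp: set_inner_block)
      ultimately show False using that by simp
    qed
    ultimately show ?case using Suc by auto
  qed simp
  then show ?thesis by (simp add: inner_vertices_def)
qed

text \<open>Holds for every \<open>p\<close>, since \<open>par_of p\<close> consults
  \<open>p\<close> at block heads only, and the edges between heads are listed separately as forest
  edges.\<close>

lemma tree_edges_eq: "tree_edges I = concat (map (forest_edges I) [0..<m]) @ map (\<lambda>x. (par_of p x, x)) inner_vertices"
proof -
  have "concat (map (slot_edges I a) [0..<m]) @ path_edges I a = map (\<lambda>x. (par_of p x, x)) (inner a)" if "a < n" for a
  proof -
    have "map (slot_edges I a) [0..<m] = map (\<lambda>i. map (\<lambda>x. (par_of p x, x)) [a * B + (2 * i + 1), a * B + (2 * i + 2)]) [0..<m]"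
      using that by (intro map_cong refl slot_edges_par) auto
    then show ?thesis
      by (simp only: path_edges_par[OF that, of p] inner_def map_append map_concat map_map comp_def)
  qed
  then have "map (\<lambda>a. concat (map (slot_edges I a) [0..<m]) @ path_edges I a) [0..<n] =
     map (\<lambda>a. map (\<lambda>x. (par_of p x, x)) (inner a)) [0..<n]"
    by (intro map_cong refl) auto
  then show ?thesis by (simp only: tree_edges_def inner_vertices_def map_concat map_map comp_def)
qed

lemma set_forest_edges: "F \<subseteq> {..<m} \<Longrightarrow> edge_of ` set (concat (map (forest_edges I) [0..<m])) = (\<lambda>i. {u i * B, v i * B}) ` F"
proof -
  assume F: "F \<subseteq> {..<m}"
  have "edge_of ` set (forest_edges I i) = (if i \<in> F then {{u i * B, v i * B}} else {})" for i
    by (simp add: forest_edges_def edge_of_def)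
  then have "edge_of ` set (concat (map (forest_edges I) [0..<m])) = (\<Union>i<m. if i \<in> F then {{u i * B, v i * B}} else {})"
    by (simp add: image_UN atLeast0LessThan)
  then show ?thesis using F by auto
qed

lemma mult_B_pair: "{a * B, b * B} = {c * B, d * B} \<longleftrightarrow> {a, b} = {c, d}"
  using B_ge(2) by (auto simp: doubleton_eq_iff)

text \<open>Block heads get the ranks \<open>\<tau> < n\<close> of the forest, and position
  \<open>j > 0\<close> of a block gets \<open>n + j\<close>. Both the path predecessor and any head
  then rank below such a vertex, no matter which path edges are replaced.\<close>

lemma tree_structure:
  "\<exists>p r. parent_graph (n * B) (par_of p) r (tree_edges I) \<and>
    (\<forall>a. 0 < a \<and> a < n \<longrightarrow> (\<exists>i\<in>F. {par_of p (a * B), a * B} = E1 i)) \<and>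
    (\<forall>i\<in>F. \<exists>a. 0 < a \<and> a < n \<and> {par_of p (a * B), a * B} = E1 i)"
    "distinct (map edge_of (tree_edges I))"
proof -
  note F = forest_tree(1-3)
  from forest_tree(4) obtain p \<tau> where p\<tau>: "(\<forall>a\<in>{..<n}. \<tau> a < n) \<and> (\<forall>a\<in>{0<..<n}. p a < n \<and> \<tau> (p a) < \<tau> a) \<and>
     (\<lambda>i. {u i, v i}) ` F = (\<lambda>a. {p a, a}) ` {0<..<n}"
    by (elim exE) (rule that)
  then have \<tau>: "\<And>a. a < n \<Longrightarrow> \<tau> a < n" "\<And>a. 0 < a \<Longrightarrow> a < n \<Longrightarrow> p a < n \<and> \<tau> (p a) < \<tau> a"
    and img: "(\<lambda>i. {u i, v i}) ` F = (\<lambda>a. {p a, a}) ` {0<..<n}"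
    by simp_all
  define r where "r x = (if x mod B = 0 then \<tau> (x div B) else n + x mod B)" for x
  have r0: "r (a * B) = \<tau> a" for a using B_ge by (simp add: r_def)
  have par0: "par_of p (a * B) = p a * B" for a using B_ge by (simp add: par_of_def)
  have par: "par_of p x < n * B \<and> r (par_of p x) < r x" if x: "0 < x" "x < n * B" for x
  proof -
    obtain a j where aj: "x = a * B + j" "a < n" "j < B" using vertex_cases[OF x(2)] .
    show ?thesis
    proof (cases "j = 0")
      case True
      then have "0 < a" using aj x by (cases a) auto
      then have "p a < n \<and> \<tau> (p a) < \<tau> a" using \<tau>(2) aj(2) by blast
      moreover have "x = a * B" using True aj(1) by simp
      ultimately show ?thesis using B_ge(2) by (simp add: par0 r0)
    next
      case False
      have rx: "r x = n + j" using aj False by (simp add: r_def)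
      define i where "i = (j - 1) div 2"
      define C where "C \<longleftrightarrow> u i \<noteq> v i \<and> v i = a \<and> (if odd j then i \<notin> F else w i = 1)"
      have "par_of p x = (if i < m \<and> C then u i * B else x - 1)"
        using par_of_block[OF aj(3), of p a] aj(1) False by (simp add: Let_def i_def C_def)
      then consider "i < m" "par_of p x = u i * B" | "par_of p x = x - 1"
        by (cases "i < m \<and> C") auto
      then show ?thesis
      proof cases
        case 1
        then have "\<tau> (u i) < n" "u i < n" using ends_less(1) \<tau>(1) by blast+
        then show ?thesis using 1(2) B_ge(2) rx by (simp add: r0)
      next
        case 2
        obtain j' where j': "j = Suc j'" using False by (cases j) auto
        have xj: "x - 1 = a * B + j'" and jB: "j' < B" using aj j' by simp_all
        have "r (a * B + j') < n + j"
          unfolding r_def block_div_mod[OF jB] using j' \<tau>(1)[OF aj(2)] by simp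
        then show ?thesis using 2 rx x xj by simp
      qed
    qed
  qed
  have forest_img: "(\<lambda>i. {u i * B, v i * B}) ` F = (\<lambda>x. {par_of p x, x}) ` (\<lambda>a. a * B) ` {0<..<n}"
  proof -
    have "(\<lambda>i. {u i * B, v i * B}) ` F = (`) (\<lambda>x. x * B) ` (\<lambda>i. {u i, v i}) ` F" by (simp add: image_image)
    then show ?thesis unfolding img by (simp add: image_image par0)
  qed
  have split: "{0<..<n * B} = (\<lambda>a. a * B) ` {0<..<n} \<union> {x. x < n * B \<and> x mod B \<noteq> 0}" (is "_ = ?R")
  proof (intro equalityI subsetI)
    fix x assume x: "x \<in> {0<..<n * B}"
    then obtain a j where aj: "x = a * B + j" "a < n" "j < B" by (auto elim: vertex_cases)
    show "x \<in> ?R"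
    proof (cases "j = 0")
      case True
      then have "a \<in> {0<..<n}" using aj x by (cases "a = 0") auto
      then show ?thesis using aj True by auto
    next
      case False
      then have "x mod B \<noteq> 0" using aj(1) block_div_mod(2)[OF aj(3), of a] by simp
      then show ?thesis using x by simp
    qed
  next
    fix x assume "x \<in> ?R"
    then show "x \<in> {0<..<n * B}" using B_ge(2) by (cases "x = 0") auto
  qed
  have edges: "edge_of ` set (tree_edges I) = (\<lambda>x. {par_of p x, x}) ` {0<..<n * B}"
    unfolding split image_Un tree_edges_eq[of p] set_append set_forest_edges[OF F(1)] forest_img
    by (simp add: set_inner image_image edge_of_def)
  interpret P: parent_graph "n * B" "par_of p" r "tree_edges I"
    by unfold_locales (use n_pos B_ge par edges in auto)
  have E1F: "E1 i = {u i * B, v i * B}" if "i \<in> F" for i using that by (simp add: E1_def)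
  show "distinct (map edge_of (tree_edges I))"
  proof -
    let ?L = "map edge_of (concat (map (forest_edges I) [0..<m]))"
    have fe: "map edge_of (concat (map (forest_edges I) [0..<m])) = map (\<lambda>i. {u i * B, v i * B}) (filter (\<lambda>i. i \<in> F) [0..<m])"
    proof -
      have "map edge_of (concat (map (forest_edges I) xs)) = map (\<lambda>i. {u i * B, v i * B}) (filter (\<lambda>i. i \<in> F) xs)" for xs
        by (induction xs) (auto simp: forest_edges_def edge_of_def)
      then show ?thesis .
    qed
    have "distinct ?L"
    proof -
      have "inj_on (\<lambda>i. {u i * B, v i * B}) F"
        by (rule inj_onI, rule inj_onD[OF F(3)]) (simp_all only: mult_B_pair)
      then show ?thesis unfolding fe distinct_map by (auto intro: inj_on_subset)
    qed
    moreover have "distinct (map edge_of (map (\<lambda>x. (par_of p x, x)) inner_vertices))"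
    proof -
      have "inj_on (\<lambda>x. {par_of p x, x}) (set inner_vertices)"
        using P.inj_parent_edge by (rule inj_on_subset) (auto simp: split set_inner)
      then show ?thesis by (simp add: distinct_map distinct_inner comp_def edge_of_def)
    qed
    moreover have "set ?L \<inter> set (map edge_of (map (\<lambda>x. (par_of p x, x)) inner_vertices)) = {}"
    proof -
      have 1: "set ?L = (\<lambda>x. {par_of p x, x}) ` (\<lambda>a. a * B) ` {0<..<n}"
        using set_forest_edges[OF F(1)] forest_img by simp
      have 2: "set (map edge_of (map (\<lambda>x. (par_of p x, x)) inner_vertices)) = (\<lambda>x. {par_of p x, x}) ` {x. x < n * B \<and> x mod B \<noteq> 0}"
        by (simp add: image_image edge_of_def set_inner)
      show ?thesis
        unfolding 1 2
      \<comment> \<open>A common edge would be the parent edge of a head and of a vertex that is not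
        a head, against the injectivity of parent edges.\<close>
      proof (rule equals0I, elim IntE imageE)
        fix e y z c
        assume e: "e = {par_of p z, z}" "z \<in> {x. x < n * B \<and> x mod B \<noteq> 0}" "e = {par_of p y, y}" "y = c * B" "c \<in> {0<..<n}"
        then have "z \<in> {0<..<n * B}" "y \<in> {0<..<n * B}" unfolding split by auto
        then have "y = z" using inj_onD[OF P.inj_parent_edge, of y z] e by simp
        moreover have "y mod B = 0" using e(4) by simp
        ultimately show False using e(2) by simp
      qed
    qed
    ultimately show ?thesis unfolding tree_edges_eq[of p] by simp
  qed
  have f1: "\<exists>i\<in>F. {par_of p (a * B), a * B} = E1 i" if "0 < a" "a < n" for a
  proof -
    have "{p a, a} \<in> (\<lambda>i. {u i, v i}) ` F" unfolding img using that by auto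
    then obtain i where i: "i \<in> F" "{p a, a} = {u i, v i}" by (elim imageE)
    then have "{par_of p (a * B), a * B} = E1 i" unfolding E1F[OF i(1)] par0 mult_B_pair by simp
    then show ?thesis using i(1) by blast
  qed
  have f2: "\<exists>a. 0 < a \<and> a < n \<and> {par_of p (a * B), a * B} = E1 i" if "i \<in> F" for i
  proof -
    have "{u i, v i} \<in> (\<lambda>a. {p a, a}) ` {0<..<n}" unfolding img[symmetric] using that by auto
    then obtain a where a: "a \<in> {0<..<n}" "{u i, v i} = {p a, a}" by (elim imageE)
    then have "{par_of p (a * B), a * B} = E1 i" unfolding E1F[OF that] par0 mult_B_pair by simp
    then show ?thesis using a(1) by (intro exI[of _ a]) simp
  qed
  show "\<exists>p r. parent_graph (n * B) (par_of p) r (tree_edges I) \<and>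
    (\<forall>a. 0 < a \<and> a < n \<longrightarrow> (\<exists>i\<in>F. {par_of p (a * B), a * B} = E1 i)) \<and>
    (\<forall>i\<in>F. \<exists>a. 0 < a \<and> a < n \<and> {par_of p (a * B), a * B} = E1 i)"
    by (intro exI[of _ p] exI[of _ r] conjI allI impI ballI P.parent_graph_axioms f1 f2) simp_all
qed

lemma F_proper: "F \<subseteq> proper"
  using forest_tree(1,2) by (auto simp: proper_def)

definition links :: "nat set set" where
  "links = {{x - 1, x} | x. x < n * B \<and> x mod B \<noteq> 0}"

definition plus :: "nat set" where
  "plus = {i \<in> proper. w i = 1}"

text \<open>Which path edges survive is left open between the two bounds. They lie in cliques, so a
  cut that splits no block contains none of them, and for the other cuts the upper bound is
  enough.\<close>

lemma set_T: "E1 ` proper \<union> E2 ` plus \<subseteq> edge_of ` set (tree_edges I)"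
  "edge_of ` set (tree_edges I) \<subseteq> E1 ` proper \<union> E2 ` plus \<union> links"
proof -
  from tree_structure(1) obtain p r where "parent_graph (n * B) (par_of p) r (tree_edges I) \<and>
    (\<forall>a. 0 < a \<and> a < n \<longrightarrow> (\<exists>i\<in>F. {par_of p (a * B), a * B} = E1 i)) \<and>
    (\<forall>i\<in>F. \<exists>a. 0 < a \<and> a < n \<and> {par_of p (a * B), a * B} = E1 i)"
    by (elim exE) (rule that)
  then have P: "parent_graph (n * B) (par_of p) r (tree_edges I)"
    and f1: "\<And>a. 0 < a \<Longrightarrow> a < n \<Longrightarrow> \<exists>i\<in>F. {par_of p (a * B), a * B} = E1 i"
    and f2: "\<And>i. i \<in> F \<Longrightarrow> \<exists>a. 0 < a \<and> a < n \<and> {par_of p (a * B), a * B} = E1 i"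
    by blast+
  interpret P: parent_graph "n * B" "par_of p" r "tree_edges I" by (rule P)
  have mem: "{par_of p x, x} \<in> edge_of ` set (tree_edges I)" if "0 < x" "x < n * B" for x
    using that by (auto simp: P.es)
  show "E1 ` proper \<union> E2 ` plus \<subseteq> edge_of ` set (tree_edges I)"
  proof (intro Un_least image_subsetI)
    fix i assume i: "i \<in> proper"
    show "E1 i \<in> edge_of ` set (tree_edges I)"
    proof (cases "i \<in> F")
      case True
      then obtain a where "0 < a" "a < n" "{par_of p (a * B), a * B} = E1 i" using f2 by blast
      then show ?thesis using mem[of "a * B"] B_ge(2) by simp
    next
      case False
      have "i < m" using i by (simp add: proper_def)
      then have lt: "2 * i + 1 < B" "v i < n" using slot_less[of i] ends_less(2) by simp_all
      then have "{par_of p (v i * B + (2 * i + 1)), v i * B + (2 * i + 1)} = E1 i"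
        using False i par_of_block[of "2 * i + 1" p "v i"] by (simp add: Let_def E1_def proper_def)
      then show ?thesis using mem[of "v i * B + (2 * i + 1)"] block_less[OF lt(2,1)] by simp
    qed
  next
    fix i assume i: "i \<in> plus"
    have "i < m" using i by (simp add: proper_def plus_def)
    then have lt: "2 * i + 2 < B" "v i < n" using slot_less[of i] ends_less(2) by simp_all
    then have "{par_of p (v i * B + (2 * i + 2)), v i * B + (2 * i + 2)} = E2 i"
      using i par_of_block[of "2 * i + 2" p "v i"] by (simp add: Let_def E2_def proper_def plus_def)
    then show "E2 i \<in> edge_of ` set (tree_edges I)"
      using mem[of "v i * B + (2 * i + 2)"] block_less[OF lt(2,1)] by simp
  qed
  show "edge_of ` set (tree_edges I) \<subseteq> E1 ` proper \<union> E2 ` plus \<union> links"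
    unfolding P.es
  proof (intro image_subsetI)
    fix x assume x: "x \<in> {0<..<n * B}"
    then obtain a j where aj: "x = a * B + j" "a < n" "j < B" by (auto elim: vertex_cases)
    show "{par_of p x, x} \<in> E1 ` proper \<union> E2 ` plus \<union> links"
    proof (cases "j = 0")
      case True
      then have "0 < a" using aj x by (cases a) auto
      then obtain i where "i \<in> F" "{par_of p (a * B), a * B} = E1 i" using f1 aj(2) by blast
      moreover have "x = a * B" using aj(1) True by simp
      ultimately show ?thesis using F_proper by blast
    next
      case False
      define i where "i = (j - 1) div 2"
      have ji: "odd j \<Longrightarrow> j = 2 * i + 1" "even j \<Longrightarrow> j = 2 * i + 2"
        using False unfolding i_def by presburger+
      define C where "C \<longleftrightarrow> i < m \<and> u i \<noteq> v i \<and> v i = a \<and> (if odd j then i \<notin> F else w i = 1)"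
      have par: "par_of p x = (if C then u i * B else x - 1)"
        using par_of_block[OF aj(3), of p a] aj(1) False by (simp add: Let_def i_def C_def)
      show ?thesis
      proof (cases C)
        case C: True
        then have px: "par_of p x = u i * B" by (simp add: par)
        note True = C[unfolded C_def]
        have i: "i \<in> proper" "v i = a" using True by (auto simp: proper_def)
        show ?thesis
        proof (cases "odd j")
          case odd: True
          then have "{par_of p x, x} = E1 i" using px True i(2) aj(1) ji(1) by (simp add: E1_def)
          then show ?thesis using i(1) by blast
        next
          case even: False
          then have "{par_of p x, x} = E2 i" using px i(2) aj(1) ji(2) by (simp add: E2_def)
          moreover have "i \<in> plus" using True even i(1) by (simp add: plus_def)
          ultimately show ?thesis by blast
        qed
      next
        case F: False
        then have "par_of p x = x - 1" by (simp add: par)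
        moreover have "x mod B \<noteq> 0" using aj(1) block_div_mod(2)[OF aj(3), of a] False by simp
        moreover have "x < n * B" using x by simp
        ultimately show ?thesis unfolding links_def by (intro UnI2 CollectI exI[of _ x]) simp
      qed
    qed
  qed
qed

end

lemma distinct_concat_map:
  assumes "distinct xs" "\<And>x. x \<in> set xs \<Longrightarrow> distinct (f x)"
    and "\<And>x y z. x \<in> set xs \<Longrightarrow> y \<in> set xs \<Longrightarrow> z \<in> set (f x) \<Longrightarrow> z \<in> set (f y) \<Longrightarrow> x = y"
  shows "distinct (concat (map f xs))"
  using assms
proof (induction xs)
  case (Cons x xs)
  have "distinct (concat (map f xs))"
    using Cons.prems by (intro Cons.IH) (simp, simp, metis list.set_intros(2))
  moreover have "set (f x) \<inter> set (concat (map f xs)) = {}"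
  proof (rule equals0I)
    fix z assume "z \<in> set (f x) \<inter> set (concat (map f xs))"
    then obtain y where "y \<in> set xs" "z \<in> set (f y)" "z \<in> set (f x)" by auto
    then have "x = y" using Cons.prems(3) by (metis list.set_intros)
    then show False using Cons.prems(1) \<open>y \<in> set xs\<close> by simp
  qed
  ultimately show ?case using Cons.prems(2) by simp
qed simp

context valid_mac begin

section \<open>The new graph is simple and has the tree as a spanning tree\<close>

lemma E2_mod: "i \<in> proper \<Longrightarrow> (\<lambda>x. x mod B) ` E2 i = {0, 2 * i + 2}"
  using slot_less[of i] block_div_mod(2)[of "2 * i + 2" "v i"] by (simp add: E2_def proper_def)

lemma E1_mod: "i \<in> proper \<Longrightarrow> (\<lambda>x. x mod B) ` E1 i = {0, if i \<in> F then 0 else 2 * i + 1}"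
  using slot_less[of i] by (simp add: E1_def proper_def)

lemma E1_div: "i \<in> proper \<Longrightarrow> (\<lambda>x. x div B) ` E1 i = {u i, v i}"
  using slot_less[of i] B_ge(2) by (simp add: E1_def proper_def)

lemma E2_div: "i \<in> proper \<Longrightarrow> (\<lambda>x. x div B) ` E2 i = {u i, v i}"
  using slot_less[of i] block_div_mod(1)[of "2 * i + 2" "v i"] B_ge(2) by (simp add: E2_def proper_def)

lemma inj_E2: "inj_on E2 proper"
proof (rule inj_onI)
  fix i j assume ij: "i \<in> proper" "j \<in> proper" "E2 i = E2 j"
  then have "{0, 2 * i + 2} = {0, 2 * j + 2}" using E2_mod[OF ij(1)] E2_mod[OF ij(2)] by simp
  then show "i = j" by (simp add: doubleton_eq_iff)
qed

text \<open>Residues modulo \<open>B\<close> reveal the slot and hence the index, except for forest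
  edges, whose residues are all 0. Those are told apart by the blocks they join, because no two
  forest edges are parallel.\<close>

lemma inj_E1: "inj_on E1 proper"
proof (rule inj_onI)
  fix i j assume ij: "i \<in> proper" "j \<in> proper" "E1 i = E1 j"
  then have mod: "{0, if i \<in> F then 0 else 2 * i + 1} = {0, if j \<in> F then 0 else 2 * j + 1}"
    using E1_mod[OF ij(1)] E1_mod[OF ij(2)] by simp
  show "i = j"
  proof (cases "i \<in> F")
    case True
    then have "j \<in> F" using mod by (cases "j \<in> F") (simp_all add: doubleton_eq_iff)
    moreover have "{u i, v i} = {u j, v j}" using E1_div[OF ij(1)] E1_div[OF ij(2)] ij(3) by simp
    ultimately show ?thesis using inj_onD[OF forest_tree(3)] True by simp
  next
    case False
    then show ?thesis using mod by (cases "j \<in> F") (simp_all add: doubleton_eq_iff)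
  qed
qed

lemma E1_E2: assumes "i \<in> proper" "j \<in> proper" shows "E1 i \<noteq> E2 j"
proof
  assume "E1 i = E2 j"
  then have "{0, if i \<in> F then 0 else 2 * i + 1} = {0, 2 * j + 2}"
    using E1_mod[OF assms(1)] E2_mod[OF assms(2)] by simp
  then show False by (cases "i \<in> F"; auto simp: doubleton_eq_iff; presburger)
qed

lemma cross_not_clique: "e \<in> E1 ` proper \<union> E2 ` proper \<Longrightarrow> e \<notin> cliques"
proof
  assume "e \<in> E1 ` proper \<union> E2 ` proper" "e \<in> cliques"
  then obtain i where i: "i \<in> proper" "(\<lambda>x. x div B) ` e = {u i, v i}" using E1_div E2_div by blast
  from \<open>e \<in> cliques\<close> obtain x y where "e = {x, y}" "x div B = y div B" unfolding cliques_def by blast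
  then have "{u i, v i} = {x div B}" using i(2) by simp
  then show False using i(1) by (simp add: proper_def doubleton_eq_iff)
qed

lemma distinct_graph_edges: "distinct (map edge_of (graph_edges I))"
proof -
  have "distinct (clique_edges I)"
    unfolding clique_edges_def
  proof (intro distinct_concat_map)
    fix a b z
    assume a: "z \<in> set (concat (map (\<lambda>j. map (\<lambda>k. (a * B + k, a * B + j)) [0..<j]) [0..<B]))"
      and b: "z \<in> set (concat (map (\<lambda>j. map (\<lambda>k. (b * B + k, b * B + j)) [0..<j]) [0..<B]))"
    have "snd z div B = a" using a by auto
    moreover have "snd z div B = b" using b by auto
    ultimately show "a = b" by simp
  next
    fix a i j z
    assume "z \<in> set (map (\<lambda>k. (a * B + k, a * B + i)) [0..<i])" "z \<in> set (map (\<lambda>k. (a * B + k, a * B + j)) [0..<j])"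
    then have "snd z = a * B + i" "snd z = a * B + j" by auto
    then show "i = j" by simp
  qed (simp_all add: distinct_map inj_on_def)
  moreover have "inj_on edge_of (set (clique_edges I))"
  proof (rule inj_onI)
    fix y z assume "y \<in> set (clique_edges I)" "z \<in> set (clique_edges I)" and e: "edge_of y = edge_of z"
    then have "fst y < snd y" "fst z < snd z" by (auto simp: clique_edges_def)
    then show "y = z" using e by (cases y; cases z) (auto simp: edge_of_def doubleton_eq_iff)
  qed
  ultimately have 1: "distinct (map edge_of (clique_edges I))" by (simp add: distinct_map)
  have eq: "map edge_of (concat (map (cross_edges I) [0..<m])) =
      concat (map (\<lambda>i. if u i = v i then [] else [E1 i, E2 i]) [0..<m])"
  proof -
    have "map edge_of (cross_edges I i) = (if u i = v i then [] else [E1 i, E2 i])" for i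
      by (simp add: cross_edges_def edge_of_def E1_def E2_def)
    then show ?thesis by (simp add: map_concat comp_def)
  qed
  have 2: "distinct (map edge_of (concat (map (cross_edges I) [0..<m])))"
    unfolding eq
  proof (rule distinct_concat_map)
    fix i assume "i \<in> set [0..<m]"
    then show "distinct (if u i = v i then [] else [E1 i, E2 i])"
      using E1_E2[of i i] by (simp add: proper_def)
  next
    fix i j z assume ij: "i \<in> set [0..<m]" "j \<in> set [0..<m]"
      "z \<in> set (if u i = v i then [] else [E1 i, E2 i])" "z \<in> set (if u j = v j then [] else [E1 j, E2 j])"
    then have p: "i \<in> proper" "j \<in> proper" by (auto simp: proper_def split: if_splits)
    show "i = j"
      using ij(3,4) inj_onD[OF inj_E1 _ p] inj_onD[OF inj_E2 _ p] E1_E2[OF p] E1_E2[OF p(2,1)]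
      by (auto split: if_splits)
  qed simp
  have "set (map edge_of (clique_edges I)) = cliques"
    using set_clique by simp
  moreover have "set (map edge_of (concat (map (cross_edges I) [0..<m]))) \<subseteq> E1 ` proper \<union> E2 ` proper"
    unfolding eq by (auto simp: proper_def split: if_splits)
  ultimately show ?thesis
    using 1 2 cross_not_clique by (simp only: graph_edges_def map_append distinct_append) blast
qed

lemma links_cliques: "links \<subseteq> cliques"
proof
  fix e assume "e \<in> links"
  then obtain x where x: "e = {x - 1, x}" "x < n * B" "x mod B \<noteq> 0" by (auto simp: links_def)
  obtain a j where aj: "x = a * B + j" "a < n" "j < B" using vertex_cases[OF x(2)] .
  then have "j \<noteq> 0" using x(3) by (metis block_div_mod(2))
  then obtain j' where "j = Suc j'" by (cases j) auto
  then have "x - 1 = a * B + j'" "j' < B" using aj by auto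
  then have "(x - 1) div B = x div B"
    using block_div_mod(1)[of j' a] block_div_mod(1)[OF aj(3), of a] aj(1) by simp
  moreover have "x - 1 < x" using aj \<open>j = Suc j'\<close> by simp
  ultimately show "e \<in> cliques" unfolding cliques_def using x(1,2) by blast
qed

lemma T_subset_H: "edge_of ` set (tree_edges I) \<subseteq> edge_of ` set (graph_edges I)"
  using set_T(2) links_cliques unfolding set_H plus_def by blast

lemma spanning: "spanning_tree T H" "connected_graph H" "simple_graph H"
proof -
  from tree_structure(1) obtain p r where "parent_graph (n * B) (par_of p) r (tree_edges I)" by (elim exE conjE) (rule that)
  then interpret P: parent_graph "n * B" "par_of p" r "tree_edges I" .
  show "spanning_tree T H"
    using P.simple_T P.connected_T P.acyclic_T T_subset_H
    by (auto simp: spanning_tree_def subgraph_def)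
  have sub: "adj_rel T \<subseteq> adj_rel H" using T_subset_H by (auto simp: adj_rel_def)
  show "connected_graph H"
    using P.connected_T rtrancl_mono[OF sub] by (auto simp: connected_graph_def)
  show "simple_graph H"
    unfolding simple_graph_def
  proof (intro conjI ballI)
    fix e assume "e \<in> edges H"
    then have "e \<in> cliques \<union> E1 ` proper \<union> E2 ` proper" by (simp add: set_H)
    then have "\<exists>x y. x < n * B \<and> y < n * B \<and> x \<noteq> y \<and> e = {x, y}"
    proof (elim UnE imageE)
      assume "e \<in> cliques"
      then obtain x y where "e = {x, y}" "x < y" "y < n * B" unfolding cliques_def by blast
      then show ?thesis by (intro exI[of _ x] exI[of _ y]) simp
    next
      fix i assume i: "e = E1 i" "i \<in> proper"
      let ?y = "v i * B + (if i \<in> F then 0 else 2 * i + 1)"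
      have im: "i < m" "u i \<noteq> v i" using i(2) by (simp_all add: proper_def)
      have l: "(if i \<in> F then 0 else 2 * i + 1) < B" using slot_less[OF im(1)] by simp
      have "u i * B < n * B" using ends_less(1)[OF im(1)] B_ge(2) by simp
      moreover have "?y < n * B" using ends_less(2)[OF im(1)] l by (rule block_less)
      moreover have "u i * B \<noteq> ?y" using block_div_mod(1)[OF l, of "v i"] im(2) B_ge(2)
        by (metis nonzero_mult_div_cancel_right less_numeral_extra(3))
      ultimately show ?thesis using i(1) unfolding E1_def by blast
    next
      fix i assume i: "e = E2 i" "i \<in> proper"
      let ?y = "v i * B + (2 * i + 2)"
      have im: "i < m" "u i \<noteq> v i" using i(2) by (simp_all add: proper_def)
      have l: "2 * i + 2 < B" using slot_less[OF im(1)] by simp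
      have "u i * B < n * B" using ends_less(1)[OF im(1)] B_ge(2) by simp
      moreover have "?y < n * B" using ends_less(2)[OF im(1)] l by (rule block_less)
      moreover have "u i * B \<noteq> ?y" using block_div_mod(1)[OF l, of "v i"] im(2) B_ge(2)
        by (metis nonzero_mult_div_cancel_right less_numeral_extra(3))
      ultimately show ?thesis using i(1) unfolding E2_def by blast
    qed
    then show "\<exists>u\<in>verts H. \<exists>v\<in>verts H. u \<noteq> v \<and> ends H e = {u, v}" by auto
  qed (auto simp: inj_on_def)
qed

section \<open>Cuts that split a block\<close>

definition cell :: "nat \<Rightarrow> nat set" where
  "cell a = {a * B..<a * B + B}"

lemma cell_iff: "x \<in> cell a \<longleftrightarrow> x div B = a"
proof
  assume "x \<in> cell a"
  then show "x div B = a" using block_div_mod(1)[of "x - a * B" a] by (auto simp: cell_def)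
next
  assume "x div B = a"
  then show "x \<in> cell a" using B_ge(2) dividend_less_div_times[of B x]
    by (auto simp: cell_def add.commute)
qed

lemma finite_cell [simp]: "finite (cell a)" and card_cell: "card (cell a) = B"
  by (simp_all add: cell_def)

lemma cut_iff: "{x, y} \<in> cut (list_graph N es) A \<longleftrightarrow> {x, y} \<in> edge_of ` set es \<and> (x \<in> A) \<noteq> (y \<in> A)"
  unfolding cut_list_graph by simp

lemma finite_cut [simp]: "finite (cut (list_graph N es) A)"
  unfolding cut_list_graph by simp

definition cut_links :: "nat set \<Rightarrow> nat \<Rightarrow> nat set" where
  "cut_links A a = {x. a * B < x \<and> x < a * B + B \<and> (x - 1 \<in> A) \<noteq> (x \<in> A)}"

text \<open>A crossing link has an end on either side and every vertex lies on at most two links, so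
  there are at most twice as many links as vertices in either part. One part has at least 16 of the
  at least 32 vertices, and this factor pays for 8 * 2.\<close>

lemma card_cut_links:
  "8 * card (cut_links A a) \<le> card (cell a \<inter> A) * card (cell a - A)"
proof -
  have sub: "cut_links A a \<subseteq> (cell a \<inter> A) \<union> Suc ` (cell a \<inter> A)"
    "cut_links A a \<subseteq> (cell a - A) \<union> Suc ` (cell a - A)"
  proof -
    have "x \<in> X \<union> Suc ` X" if "x \<in> cut_links A a" "X = cell a \<inter> A \<or> X = cell a - A" for x X
    proof -
      have "x = Suc (x - 1)" "x \<in> cell a" "x - 1 \<in> cell a" "(x - 1 \<in> A) \<noteq> (x \<in> A)"
        using that(1) by (auto simp: cut_links_def cell_def)
      then have "x \<in> X \<or> x - 1 \<in> X" using that(2) by blast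
      then show ?thesis using \<open>x = Suc (x - 1)\<close> by (metis UnCI image_eqI)
    qed
    then show "cut_links A a \<subseteq> (cell a \<inter> A) \<union> Suc ` (cell a \<inter> A)"
      "cut_links A a \<subseteq> (cell a - A) \<union> Suc ` (cell a - A)" by blast+
  qed
  have bound: "card (cut_links A a) \<le> 2 * card X" if "cut_links A a \<subseteq> X \<union> Suc ` X" "finite X" for X
  proof -
    have "card (cut_links A a) \<le> card (X \<union> Suc ` X)" using that by (intro card_mono) auto
    also have "\<dots> \<le> card X + card (Suc ` X)" by (rule card_Un_le)
    also have "\<dots> \<le> 2 * card X" using card_image_le[OF that(2), of Suc] by simp
    finally show ?thesis .
  qed
  let ?s = "card (cell a \<inter> A)" and ?t = "card (cell a - A)"
  have le: "card (cut_links A a) \<le> 2 * ?s" "card (cut_links A a) \<le> 2 * ?t"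
    using bound sub by simp_all
  have "?s + ?t = card (cell a)"
    by (subst card_Un_disjoint[symmetric]) (auto intro: arg_cong[of _ _ card])
  then have "32 \<le> ?s + ?t" using B_ge by (simp add: card_cell)
  then consider "16 \<le> ?s" | "16 \<le> ?t" by linarith
  then show ?thesis
  proof cases
    case 1
    have "8 * card (cut_links A a) \<le> 16 * ?t" using le by simp
    also have "\<dots> \<le> ?s * ?t" using 1 by (rule mult_right_mono) simp
    finally show ?thesis .
  next
    case 2
    have "8 * card (cut_links A a) \<le> ?s * 16" using le by simp
    also have "\<dots> \<le> ?s * ?t" using 2 by (rule mult_left_mono) simp
    finally show ?thesis .
  qed
qed

text \<open>A tree edge in the cut is a path edge inside a block or one of at most
  \<open>2 * m\<close> copies. Path edges that the tree has given up are counted as well.\<close>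

lemma card_cut_T_le: "card (cut T A) \<le> (\<Sum>a<n. card (cut_links A a)) + 2 * m"
proof -
  let ?L = "(\<lambda>x. {x - 1, x}) ` (\<Union>a<n. cut_links A a)"
  have "cut T A \<subseteq> ?L \<union> (E1 ` proper \<union> E2 ` plus)"
  proof
    fix e assume e: "e \<in> cut T A"
    then have "e \<in> E1 ` proper \<union> E2 ` plus \<union> links" using set_T(2) unfolding cut_list_graph by blast
    moreover have "e \<in> ?L" if "e \<in> links"
    proof -
      from that obtain x where x: "e = {x - 1, x}" "x < n * B" "x mod B \<noteq> 0" unfolding links_def by blast
      obtain a j where aj: "x = a * B + j" "a < n" "j < B" using vertex_cases[OF x(2)] .
      then have "j \<noteq> 0" using x(3) block_div_mod(2)[OF aj(3), of a] by simp
      moreover have "(x - 1 \<in> A) \<noteq> (x \<in> A)" using e unfolding x(1) cut_iff by simp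
      ultimately have "x \<in> cut_links A a" using aj by (simp add: cut_links_def)
      then show ?thesis using x(1) aj(2) by blast
    qed
    ultimately show "e \<in> ?L \<union> (E1 ` proper \<union> E2 ` plus)" by blast
  qed
  moreover have fin: "finite (cut_links A a)" for a by (simp add: cut_links_def)
  moreover have finp: "finite proper" "finite plus" by (simp_all add: proper_def plus_def)
  ultimately have "card (cut T A) \<le> card (?L \<union> (E1 ` proper \<union> E2 ` plus))" by (intro card_mono) auto
  also have "\<dots> \<le> card ?L + (card (E1 ` proper) + card (E2 ` plus))"
    using card_Un_le le_trans add_left_mono by blast
  also have "card ?L \<le> card (\<Union>a<n. cut_links A a)" using fin by (intro card_image_le) auto
  also have "\<dots> \<le> (\<Sum>a<n. card (cut_links A a))" by (rule card_UN_le) simp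
  also have "card (E1 ` proper) \<le> m"
  proof -
    have "card proper \<le> card {..<m}" by (intro card_mono) (auto simp: proper_def)
    then show ?thesis using card_image_le[OF finp(1), of E1] by simp
  qed
  also have "card (E2 ` plus) \<le> m"
  proof -
    have "card plus \<le> card {..<m}" by (intro card_mono) (auto simp: proper_def plus_def)
    then show ?thesis using card_image_le[OF finp(2), of E2] by simp
  qed
  finally show ?thesis by simp
qed

lemma card_cut_H_ge: "(\<Sum>a<n. card (cell a \<inter> A) * card (cell a - A)) \<le> card (cut H A)"
proof -
  let ?P = "\<lambda>a. (cell a \<inter> A) \<times> (cell a - A)"
  have "(\<Sum>a<n. card (cell a \<inter> A) * card (cell a - A)) = (\<Sum>a<n. card (?P a))"
    by (simp add: card_cartesian_product)
  also have "\<dots> = card (\<Union>a<n. ?P a)"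
    by (rule card_UN_disjoint[symmetric]) (auto simp: cell_iff)
  also have "\<dots> = card ((\<lambda>(x, y). {x, y}) ` (\<Union>a<n. ?P a))"
    by (rule card_image[symmetric]) (auto simp: inj_on_def doubleton_eq_iff)
  also have "\<dots> \<le> card (cut H A)"
  proof (rule card_mono)
    show "(\<lambda>(x, y). {x, y}) ` (\<Union>a<n. ?P a) \<subseteq> cut H A"
    proof (clarify)
      fix a x y assume a: "a < n" "x \<in> cell a" "x \<in> A" "y \<in> cell a" "y \<notin> A"
      then have xy: "x < n * B" "y < n * B" "x div B = y div B" "x \<noteq> y"
        using B_ge(2) by (auto simp: cell_iff div_less_iff_less_mult[symmetric])
      have "{x, y} \<in> cliques"
      proof (cases "x < y")
        case True
        then show ?thesis unfolding cliques_def using xy by blast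
      next
        case False
        then have "y < x" using xy(4) by simp
        then have "{y, x} \<in> cliques" unfolding cliques_def using xy(1) xy(3)[symmetric] by blast
        then show ?thesis by (simp add: insert_commute)
      qed
      then show "{x, y} \<in> cut H A" using a by (simp add: cut_iff set_H)
    qed
  qed simp
  finally show ?thesis .
qed

text \<open>For parts of sizes s and t, s * t >= s + t - 1 = B - 1 > 16 * m. So eight times the
  \<open>2 * m\<close> copies is at most the number of cut clique edges, and by
  \<open>card_cut_links\<close> the same holds for eight times the path edges. Together, 8 * |cut T|
  is at most twice the number of cut clique edges.\<close>

lemma split_cut_thin:
  assumes "a < n" "cell a \<inter> A \<noteq> {}" "cell a - A \<noteq> {}"
  shows "4 * card (cut T A) \<le> card (cut H A)" "0 < card (cut H A)"
proof -
  let ?s = "card (cell a \<inter> A)" and ?t = "card (cell a - A)"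
  let ?S = "\<Sum>a<n. card (cell a \<inter> A) * card (cell a - A)"
  have pos: "1 \<le> ?s" "1 \<le> ?t" using assms by (simp_all add: Suc_le_eq card_gt_0_iff)
  have sum: "?s + ?t = B"
    unfolding card_cell[of a, symmetric] by (subst card_Un_disjoint[symmetric]) (auto intro: arg_cong[of _ _ card])
  have "?s + ?t \<le> ?s * ?t + 1" using pos by (cases ?s; cases ?t) auto
  then have st: "16 * m < ?s * ?t" using sum B_ge(1) by linarith
  have le: "?s * ?t \<le> ?S" by (rule member_le_sum) (use assms(1) in auto)
  have "8 * (\<Sum>a<n. card (cut_links A a)) \<le> ?S"
    unfolding sum_distrib_left by (rule sum_mono) (rule card_cut_links)
  then have "8 * card (cut T A) \<le> 2 * ?S" using card_cut_T_le[of A] st le by linarith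
  then show "4 * card (cut T A) \<le> card (cut H A)" using card_cut_H_ge[of A] by linarith
  show "0 < card (cut H A)" using card_cut_H_ge[of A] st le by linarith
qed

section \<open>Cuts that are unions of blocks\<close>

definition cut_edges :: "nat set \<Rightarrow> nat set" where
  "cut_edges A = {i. i < m \<and> (u i \<in> A) \<noteq> (v i \<in> A)}"

lemma cut_G: "cut G A = cut_edges A"
  by (auto simp: cut_def cut_edges_def)

definition blow_up :: "nat set \<Rightarrow> nat set" where
  "blow_up A = {x. x div B \<in> A}"

lemma cross_in_blow_up:
  assumes "i < m"
  shows "u i * B \<in> blow_up A \<longleftrightarrow> u i \<in> A" "v i * B + (if i \<in> F then 0 else 2 * i + 1) \<in> blow_up A \<longleftrightarrow> v i \<in> A"
    "v i * B + (2 * i + 2) \<in> blow_up A \<longleftrightarrow> v i \<in> A"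
proof -
  have l: "(if i \<in> F then 0 else 2 * i + 1) < B" using slot_less[OF assms] by simp
  show "u i * B \<in> blow_up A \<longleftrightarrow> u i \<in> A" using B_ge(2) by (simp add: blow_up_def)
  show "v i * B + (if i \<in> F then 0 else 2 * i + 1) \<in> blow_up A \<longleftrightarrow> v i \<in> A"
    unfolding blow_up_def mem_Collect_eq block_div_mod(1)[OF l] ..
  show "v i * B + (2 * i + 2) \<in> blow_up A \<longleftrightarrow> v i \<in> A"
    unfolding blow_up_def mem_Collect_eq block_div_mod(1)[OF slot_less[OF assms]] ..
qed

lemma E1_cut: "i < m \<Longrightarrow> E1 i \<in> cut (list_graph N es) (blow_up A) \<longleftrightarrow> E1 i \<in> edge_of ` set es \<and> i \<in> cut_edges A"
  unfolding E1_def cut_iff by (simp only: cross_in_blow_up cut_edges_def mem_Collect_eq simp_thms)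

lemma E2_cut: "i < m \<Longrightarrow> E2 i \<in> cut (list_graph N es) (blow_up A) \<longleftrightarrow> E2 i \<in> edge_of ` set es \<and> i \<in> cut_edges A"
  unfolding E2_def cut_iff by (simp only: cross_in_blow_up cut_edges_def mem_Collect_eq simp_thms)

lemma clique_cut: "e \<in> cliques \<Longrightarrow> e \<notin> cut (list_graph N es) (blow_up A)"
proof -
  assume "e \<in> cliques"
  then obtain x y where "e = {x, y}" "x div B = y div B" unfolding cliques_def by blast
  then show ?thesis by (simp add: cut_iff blow_up_def)
qed

lemma cut_edges_proper: "cut_edges A \<subseteq> proper"
  by (auto simp: cut_edges_def proper_def)

lemma card_cut_H: "card (cut H (blow_up A)) = 2 * card (cut_edges A)"
proof -
  have eq: "cut H (blow_up A) = E1 ` cut_edges A \<union> E2 ` cut_edges A"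
  proof (intro equalityI subsetI)
    fix e assume e: "e \<in> cut H (blow_up A)"
    then have "e \<in> cliques \<union> E1 ` proper \<union> E2 ` proper" using set_H unfolding cut_list_graph by blast
    then obtain i where "i \<in> proper" "e = E1 i \<or> e = E2 i" using clique_cut e by blast
    then show "e \<in> E1 ` cut_edges A \<union> E2 ` cut_edges A" using e by (auto simp: E1_cut E2_cut proper_def)
  next
    fix e assume "e \<in> E1 ` cut_edges A \<union> E2 ` cut_edges A"
    then obtain i where "i \<in> cut_edges A" "e = E1 i \<or> e = E2 i" by blast
    moreover from this(1) have "i \<in> proper" "i < m" using cut_edges_proper by (auto simp: cut_edges_def)
    moreover from this(1) have "E1 i \<in> edge_of ` set (graph_edges I)" "E2 i \<in> edge_of ` set (graph_edges I)"
      unfolding set_H by blast+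
    ultimately show "e \<in> cut H (blow_up A)" using E1_cut E2_cut by blast
  qed
  have fin: "finite (cut_edges A)" by (simp add: cut_edges_def)
  have "E1 ` cut_edges A \<inter> E2 ` cut_edges A = {}" using E1_E2 cut_edges_proper by blast
  then show ?thesis
    unfolding eq using fin inj_on_subset[OF inj_E1 cut_edges_proper] inj_on_subset[OF inj_E2 cut_edges_proper]
    by (simp add: card_Un_disjoint card_image)
qed

lemma card_cut_T: "card (cut T (blow_up A)) = card (cut_edges A) + card {i \<in> cut_edges A. w i = 1}"
proof -
  let ?D = "{i \<in> cut_edges A. w i = 1}"
  have eq: "cut T (blow_up A) = E1 ` cut_edges A \<union> E2 ` ?D"
  proof (intro equalityI subsetI)
    fix e assume e: "e \<in> cut T (blow_up A)"
    then have "e \<in> E1 ` proper \<union> E2 ` plus \<union> links" using set_T(2) unfolding cut_list_graph by blast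
    then have "e \<in> E1 ` proper \<union> E2 ` plus" using clique_cut e links_cliques by blast
    then show "e \<in> E1 ` cut_edges A \<union> E2 ` ?D" using e by (auto simp: E1_cut E2_cut proper_def plus_def)
  next
    fix e assume e: "e \<in> E1 ` cut_edges A \<union> E2 ` ?D"
    then obtain i where i: "i \<in> cut_edges A" "e = E1 i \<or> e = E2 i \<and> w i = 1" by blast
    then have "i \<in> proper" "i < m" using cut_edges_proper by (auto simp: cut_edges_def)
    moreover from this(1) i(2) have "e \<in> edge_of ` set (tree_edges I)" using set_T(1) unfolding plus_def by blast
    ultimately show "e \<in> cut T (blow_up A)" using i by (elim disjE conjE) (simp_all add: E1_cut E2_cut)
  qed
  have fin: "finite (cut_edges A)" "finite ?D" by (simp_all add: cut_edges_def)
  have "E1 ` cut_edges A \<inter> E2 ` ?D = {}" using E1_E2 cut_edges_proper by blast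
  moreover have "?D \<subseteq> proper" using cut_edges_proper by blast
  ultimately show ?thesis
    unfolding eq using fin inj_on_subset[OF inj_E1 cut_edges_proper] inj_on_subset[OF inj_E2, of ?D]
    by (simp add: card_Un_disjoint card_image)
qed

text \<open>Weights are -1 or 1, hence twice the indicator of \<open>w e = 1\<close> minus
  one.\<close>

lemma sum_weight: "(\<Sum>e\<in>cut_edges A. w e) = 2 * int (card {i \<in> cut_edges A. w i = 1}) - int (card (cut_edges A))"
proof -
  have fin: "finite (cut_edges A)" by (simp add: cut_edges_def)
  have "(\<Sum>e\<in>cut_edges A. w e) = (\<Sum>e\<in>cut_edges A. 2 * (if w e = 1 then 1 else 0) - 1)"
    by (rule sum.cong) (use weight in \<open>auto simp: cut_edges_def\<close>)
  also have "\<dots> = 2 * int (card {i \<in> cut_edges A. w i = 1}) - int (card (cut_edges A))"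
    using fin by (simp add: sum_subtractf sum_distrib_left[symmetric] sum.If_cases Int_def)
  finally show ?thesis .
qed

text \<open>The quotients to be compared have a multiple of the size of this set as denominator;
  division by zero, which would yield 0, is thereby excluded.\<close>

lemma cut_edges_nonempty:
  assumes "A \<noteq> {}" "A \<subset> {..<n}"
  shows "cut_edges A \<noteq> {}"
proof
  assume "cut_edges A = {}"
  then have cl: "u i \<in> A \<longleftrightarrow> v i \<in> A" if "i < m" for i using that by (auto simp: cut_edges_def)
  show False
  proof (cases "0 \<in> A")
    case True
    then show ?thesis using closed_eq_all[OF True] cl assms by blast
  next
    case False
    then have "{..<n} \<subseteq> - A" using closed_eq_all[of "- A"] cl by simp
    then show ?thesis using assms by blast
  qed
qed

end

text \<open>With \<open>q\<close> edges in the cut, \<open>p\<close> of them of weight \<open>1\<close>, the tree contains a fraction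
  \<open>(q + p) / (2 * q)\<close> of the corresponding cut, which is \<open>(3 + s) / 4\<close> for the average weight
  \<open>s = (2 * p - q) / q\<close>. Both sides of \<open>s \<ge> c / d\<close> are integers after multiplication with \<open>d * q\<close>, so
  lowering the threshold by less than \<open>1 / (4 * d * q)\<close> turns the inequality into a strict one.\<close>

lemma threshold:
  fixes c d p q N :: int
  assumes "0 < d" "0 < q" "q \<le> N"
  shows "(of_int (2 * p - q) / of_int q :: rat) \<ge> of_int c / of_int d \<longleftrightarrow>
    of_int (q + p) / of_int (2 * q) > (of_int ((3 * d + c) * N - 1) / of_int (4 * d * N) :: rat)"
proof -
  have "0 < N" using assms by linarith
  have "(of_int (2 * p - q) / of_int q :: rat) \<ge> of_int c / of_int d \<longleftrightarrow>
      (of_int (c * q) :: rat) \<le> of_int ((2 * p - q) * d)"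
    using assms by (simp add: field_simps)
  also have "\<dots> \<longleftrightarrow> 0 \<le> (2 * p - q) * d - c * q" by (simp only: of_int_le_iff) simp
  \<comment> \<open>A negative integer is at most -1, and multiplication by \<open>N >= q\<close>
    takes it to \<open>- q\<close> or below, so the strict inequality fails exactly for negative
    values.\<close>
  also have "\<dots> \<longleftrightarrow> - q < ((2 * p - q) * d - c * q) * N"
  proof
    assume "0 \<le> (2 * p - q) * d - c * q"
    then have "0 \<le> ((2 * p - q) * d - c * q) * N" using \<open>0 < N\<close> by simp
    then show "- q < ((2 * p - q) * d - c * q) * N" using assms by linarith
  next
    assume *: "- q < ((2 * p - q) * d - c * q) * N"
    show "0 \<le> (2 * p - q) * d - c * q"
    proof (rule ccontr)
      assume "\<not> 0 \<le> (2 * p - q) * d - c * q"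
      then have "((2 * p - q) * d - c * q) * N \<le> (- 1) * N" using \<open>0 < N\<close> by (intro mult_right_mono) auto
      then show False using * assms by linarith
    qed
  qed
  \<comment> \<open>The difference of the two products is twice the amount by which the previous
    inequality holds.\<close>
  also have "\<dots> \<longleftrightarrow> ((3 * d + c) * N - 1) * (2 * q) < (q + p) * (4 * d * N)"
  proof -
    have "(q + p) * (4 * d * N) - ((3 * d + c) * N - 1) * (2 * q) = 2 * (((2 * p - q) * d - c * q) * N + q)"
      by (simp add: algebra_simps)
    moreover have "b - a = 2 * (x + q) \<Longrightarrow> - q < x \<longleftrightarrow> a < b" for a b x :: int by presburger
    ultimately show ?thesis by blast
  qed
  also have "\<dots> \<longleftrightarrow> of_int (((3 * d + c) * N - 1) * (2 * q)) < (of_int ((q + p) * (4 * d * N)) :: rat)"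
    by (simp only: of_int_less_iff)
  also have "\<dots> \<longleftrightarrow> of_int (q + p) / of_int (2 * q) > (of_int ((3 * d + c) * N - 1) / of_int (4 * d * N) :: rat)"
  proof -
    have "(0 :: rat) < of_int (2 * q)" "(0 :: rat) < of_int (4 * d * N)"
      using assms \<open>0 < N\<close> by (simp_all only: of_int_0_less_iff) simp_all
    then show ?thesis by (simp only: of_int_mult[of "_ + _"] of_int_mult[of "_ - _"] divide_less_eq less_divide_eq) (simp add: field_simps)
  qed
  finally show ?thesis .
qed

context valid_mac begin

section \<open>Correctness of the reduction\<close>

abbreviation "J \<equiv> thin_tree_instance I"

lemma J_graphs: "ttv_graph J = H" "ttv_tree J = T"
  by (simp_all add: ttv_graph_def ttv_tree_def thin_tree_instance_def)

lemma num_ge: "- int (mac_den I) \<le> mac_num I"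
proof -
  have "- of_nat (mac_den I) \<le> (of_int (mac_num I) :: rat)"
    using k_ge den_pos by (simp add: mac_k_def field_simps)
  then have "(of_int (- int (mac_den I)) :: rat) \<le> of_int (mac_num I)" by simp
  then show ?thesis by (simp only: of_int_le_iff)
qed

lemma alpha_eq:
  assumes "mac_num I \<le> int (mac_den I)"
  shows "ttv_alpha J = of_int ((3 * int (mac_den I) + mac_num I) * 2 ^ m - 1) / of_int (4 * int (mac_den I) * 2 ^ m)"
    "1 \<le> (3 * int (mac_den I) + mac_num I) * 2 ^ m"
proof -
  have "1 * 1 \<le> (3 * int (mac_den I) + mac_num I) * 2 ^ m"
    using num_ge den_pos by (intro mult_mono) auto
  then show "1 \<le> (3 * int (mac_den I) + mac_num I) * 2 ^ m" by simp
  then have "of_nat (nat ((3 * int (mac_den I) + mac_num I) * 2 ^ m - 1)) =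
      (of_int ((3 * int (mac_den I) + mac_num I) * 2 ^ m - 1) :: rat)"
    by (intro of_nat_nat) simp
  then show "ttv_alpha J = of_int ((3 * int (mac_den I) + mac_num I) * 2 ^ m - 1) / of_int (4 * int (mac_den I) * 2 ^ m)"
    using assms by (simp add: ttv_alpha_def thin_tree_instance_def)
qed

text \<open>From c >= -d the numerator is at least 2 * d * 2 ^ m - 1, hence at least d * 2 ^ m, a
  quarter of the denominator.\<close>

lemma alpha_bounds: "1 / 4 \<le> ttv_alpha J" "ttv_alpha J \<le> 1"
proof -
  have "1 / 4 \<le> ttv_alpha J \<and> ttv_alpha J \<le> 1"
  proof (cases "mac_num I \<le> int (mac_den I)")
    case True
    let ?d = "int (mac_den I)" and ?c = "mac_num I"
    have dN: "1 * 1 \<le> ?d * 2 ^ m" using den_pos by (intro mult_mono) auto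
    have e: "(3 * ?d + ?c) * 2 ^ m = 3 * (?d * 2 ^ m) + ?c * 2 ^ m" "4 * ?d * 2 ^ m = 4 * (?d * 2 ^ m)"
      by (simp_all add: algebra_simps)
    have c1: "- (?d * 2 ^ m) \<le> ?c * 2 ^ m" unfolding minus_mult_left using num_ge by (intro mult_right_mono) auto
    have c2: "?c * 2 ^ m \<le> ?d * 2 ^ m" using True by (intro mult_right_mono) auto
    have aux: "4 * D \<le> 4 * (3 * D + C - 1) \<and> 3 * D + C - 1 \<le> 4 * D" if "- D \<le> C" "C \<le> D" "1 * 1 \<le> D" for C D :: int
      using that by simp
    have "4 * ?d * 2 ^ m \<le> 4 * ((3 * ?d + ?c) * 2 ^ m - 1)" "(3 * ?d + ?c) * 2 ^ m - 1 \<le> 4 * ?d * 2 ^ m"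
      unfolding e using aux[OF c1 c2 dN] by blast+
    then have "(of_int (4 * ?d * 2 ^ m) :: rat) \<le> of_int (4 * ((3 * ?d + ?c) * 2 ^ m - 1))"
      "(of_int ((3 * ?d + ?c) * 2 ^ m - 1) :: rat) \<le> of_int (4 * ?d * 2 ^ m)"
      by (simp_all only: of_int_le_iff)
    moreover have "0 < 4 * ?d * 2 ^ m" using den_pos by simp
    then have "(0 :: rat) < of_int (4 * ?d * 2 ^ m)" by (simp only: of_int_0_less_iff)
    moreover have "1 / 4 \<le> x / y \<and> x / y \<le> 1" if "y \<le> 4 * x" "x \<le> y" "0 < y" for x y :: rat
      using that by (simp add: field_simps)
    ultimately show ?thesis unfolding alpha_eq(1)[OF True] of_int_mult[of 4 "_ - _"] of_int_numeral by blast
  next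
    case False
    then show ?thesis by (simp add: ttv_alpha_def thin_tree_instance_def)
  qed
  then show "1 / 4 \<le> ttv_alpha J" "ttv_alpha J \<le> 1" by auto
qed

lemma valid_J: "ttv_valid J"
proof -
  have "0 \<le> ttv_alpha J" using alpha_bounds(1) by (rule order_trans[rotated]) simp
  moreover have "0 < ttv_den J" using den_pos by (simp add: thin_tree_instance_def)
  moreover have "ttv_edges J = graph_edges I" "ttv_tree_edges J = tree_edges I"
    by (simp_all add: thin_tree_instance_def)
  ultimately show ?thesis
    unfolding ttv_valid_def J_graphs
    using distinct_graph_edges tree_structure(2) spanning alpha_bounds(2) by simp
qed

lemma blow_up_threshold:
  assumes "A \<noteq> {}" "A \<subset> {..<n}"
  shows "of_int (\<Sum>e\<in>cut G A. w e) / of_nat (card (cut G A)) \<ge> mac_k I \<longleftrightarrow>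
    of_nat (card (cut T (blow_up A))) / of_nat (card (cut H (blow_up A))) > ttv_alpha J"
proof -
  define q where "q = card (cut_edges A)"
  define p where "p = card {i \<in> cut_edges A. w i = 1}"
  have fin: "finite (cut_edges A)" by (simp add: cut_edges_def)
  have q0: "0 < q" using cut_edges_nonempty[OF assms] fin by (simp add: q_def card_gt_0_iff)
  have pq: "p \<le> q" unfolding p_def q_def using fin by (intro card_mono) auto
  have "q \<le> card {..<m}" unfolding q_def by (intro card_mono) (auto simp: cut_edges_def)
  \<comment> \<open>The scaling factor of \<open>threshold\<close> has to dominate the number of cut
    edges.\<close>
  then have "q \<le> 2 ^ m" using less_exp[of m] unfolding card_lessThan by linarith
  then have "int q \<le> int (2 ^ m)" by (simp only: of_nat_le_iff)
  then have qN: "int q \<le> 2 ^ m" by simp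
  have lhs: "of_int (\<Sum>e\<in>cut G A. w e) / of_nat (card (cut G A)) = (of_int (2 * int p - int q) / of_int (int q) :: rat)"
    unfolding cut_G sum_weight p_def q_def by simp
  have rhs: "of_nat (card (cut T (blow_up A))) / of_nat (card (cut H (blow_up A))) =
      (of_int (int q + int p) / of_int (2 * int q) :: rat)"
    unfolding card_cut_H card_cut_T p_def q_def by simp
  show ?thesis
  proof (cases "mac_num I \<le> int (mac_den I)")
    case True
    show ?thesis
      unfolding lhs rhs alpha_eq(1)[OF True] mac_k_def
      using threshold[of "int (mac_den I)" "int q" "2 ^ m" "mac_num I" "int p"] q0 qN den_pos by simp
  next
    \<comment> \<open>Here k > 1: neither an average of weights nor a fraction of tree edges exceeds
      1, so both sides are false.\<close>
    case False
    have 1: "of_int (2 * int p - int q) / of_int (int q) \<le> (1 :: rat)"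
      using q0 pq by (simp add: field_simps)
    have "(of_int (int (mac_den I)) :: rat) < of_int (mac_num I)" using False by (simp only: of_int_less_iff)
    then have 2: "1 < mac_k I" using den_pos by (simp add: mac_k_def field_simps)
    have 3: "of_int (int q + int p) / of_int (2 * int q) \<le> (1 :: rat)"
      using q0 pq by (simp add: field_simps)
    have "ttv_alpha J = 1" using False by (simp add: ttv_alpha_def thin_tree_instance_def)
    then show ?thesis unfolding lhs rhs using 1 2 3 by linarith
  qed
qed

lemma blow_up_partition:
  assumes "nontrivial_partition G A A'"
  shows "nontrivial_partition H (blow_up A) (blow_up A')"
proof -
  have A: "A \<union> A' = {..<n}" "A \<inter> A' = {}" "A \<noteq> {}" "A' \<noteq> {}"
    using assms by (auto simp: nontrivial_partition_def)
  have "blow_up A \<union> blow_up A' = {x. x div B \<in> A \<union> A'}" by (auto simp: blow_up_def)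
  also have "\<dots> = {..<n * B}" unfolding A(1) using B_ge(2) by (auto simp: div_less_iff_less_mult)
  finally have "blow_up A \<union> blow_up A' = verts H" by simp
  moreover have "blow_up A \<inter> blow_up A' = {}" using A(2) by (auto simp: blow_up_def)
  moreover have "blow_up X \<noteq> {}" if "X \<noteq> {}" for X
  proof -
    from that obtain a where "a \<in> X" by blast
    then have "a * B \<in> blow_up X" using B_ge(2) by (simp add: blow_up_def)
    then show ?thesis by blast
  qed
  ultimately show ?thesis using A(3,4) by (simp add: nontrivial_partition_def)
qed

lemma unsplit_blow_up:
  assumes "A \<subseteq> {..<n * B}" "\<And>a. a < n \<Longrightarrow> cell a \<inter> A = {} \<or> cell a \<subseteq> A"
  shows "A = blow_up {a. a < n \<and> cell a \<subseteq> A}"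
proof (intro equalityI subsetI)
  fix x assume "x \<in> A"
  then have "x div B < n" using assms(1) B_ge(2) by (auto simp: div_less_iff_less_mult)
  moreover have "x \<in> cell (x div B)" by (simp add: cell_iff)
  ultimately show "x \<in> blow_up {a. a < n \<and> cell a \<subseteq> A}"
    using assms(2)[of "x div B"] \<open>x \<in> A\<close> by (auto simp: blow_up_def)
next
  fix x assume "x \<in> blow_up {a. a < n \<and> cell a \<subseteq> A}"
  then show "x \<in> A" by (auto simp: blow_up_def cell_iff)
qed

lemma yes_iff: "mac_yes I \<longleftrightarrow> \<not> thin (ttv_alpha J) (ttv_tree J) (ttv_graph J)"
proof
  assume "mac_yes I"
  then obtain A A' where A: "nontrivial_partition G A A'"
    "of_int (\<Sum>e\<in>cut G A. w e) / of_nat (card (cut G A)) \<ge> mac_k I"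
    unfolding mac_yes_def by blast
  have "A \<noteq> {}" "A \<subset> {..<n}" using A(1) by (auto simp: nontrivial_partition_def)
  then have "of_nat (card (cut T (blow_up A))) / of_nat (card (cut H (blow_up A))) > ttv_alpha J"
    using A(2) blow_up_threshold by blast
  then show "\<not> thin (ttv_alpha J) (ttv_tree J) (ttv_graph J)"
    unfolding thin_def J_graphs using blow_up_partition[OF A(1)] by (meson not_less)
next
  assume "\<not> thin (ttv_alpha J) (ttv_tree J) (ttv_graph J)"
  then obtain A A' where A: "nontrivial_partition H A A'"
    and gt: "of_nat (card (cut T A)) / of_nat (card (cut H A)) > ttv_alpha J"
    unfolding thin_def J_graphs by (meson not_less)
  have AA: "A \<union> A' = {..<n * B}" "A \<inter> A' = {}" "A \<noteq> {}" "A' \<noteq> {}"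
    using A by (auto simp: nontrivial_partition_def)
  \<comment> \<open>Splitting a block would bring the fraction down to 1/4, which is not above the
    threshold. So the violating cut is a union of blocks.\<close>
  have uns: "cell a \<inter> A = {} \<or> cell a \<subseteq> A" if "a < n" for a
  proof (rule ccontr)
    assume "\<not> ?thesis"
    then have "cell a \<inter> A \<noteq> {}" "cell a - A \<noteq> {}" by auto
    from split_cut_thin[OF that this]
    have "4 * card (cut T A) \<le> card (cut H A)" "0 < card (cut H A)" .
    then have "(of_nat (4 * card (cut T A)) :: rat) \<le> of_nat (card (cut H A))" "(0 :: rat) < of_nat (card (cut H A))"
      by (simp_all only: of_nat_le_iff of_nat_0_less_iff)
    then have "of_nat (card (cut T A)) / of_nat (card (cut H A)) \<le> (1 / 4 :: rat)" by (simp add: field_simps)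
    then show False using gt alpha_bounds(1) by linarith
  qed
  define A0 where "A0 = {a. a < n \<and> cell a \<subseteq> A}"
  have eq: "A = blow_up A0"
    unfolding A0_def using AA(1) uns by (intro unsplit_blow_up) auto
  have "A0 \<noteq> {}" using eq AA(3) by (auto simp: blow_up_def)
  moreover have "A0 \<noteq> {..<n}"
  proof
    assume "A0 = {..<n}"
    then have "{..<n * B} \<subseteq> A" unfolding eq blow_up_def using B_ge(2) by (auto simp: div_less_iff_less_mult)
    then show False using AA by blast
  qed
  moreover have "A0 \<subseteq> {..<n}" by (auto simp: A0_def)
  ultimately have A0: "A0 \<noteq> {}" "A0 \<subset> {..<n}" by auto
  then have "nontrivial_partition G A0 ({..<n} - A0)" by (auto simp: nontrivial_partition_def)
  moreover have "of_int (\<Sum>e\<in>cut G A0. w e) / of_nat (card (cut G A0)) \<ge> mac_k I"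
    using gt blow_up_threshold[OF A0] unfolding eq by blast
  ultimately show "mac_yes I" unfolding mac_yes_def by blast
qed

end

section \<open>Programming the reduction\<close>

text \<open>Use of the tapes: 0 input, 1 output, 2 cap, 3 always empty, 4 position in the input, 5 number of
  vertices, 6 number of edges, 7 block size, 8 to 11 source, target, weight and index of the current
  edge, 12 visited vertices, 13 forest edges, 14 number of links beyond the slots, 15 to 18 counters,
  20 to 27 binary arithmetic. Numbers are written in unary unless stated otherwise.\<close>

abbreviation un :: "nat \<Rightarrow> nat list" where
  "un k \<equiv> replicate k 1"

lemma un_snoc: "replicate k (Suc 0) @ [Suc 0] = replicate (Suc k) (Suc 0)"
  by (simp add: replicate_append_same)

fun apps :: "nat \<Rightarrow> nat \<Rightarrow> nat \<Rightarrow> com" where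
  "apps 0 i s = Skip"
| "apps (Suc k) i s = App i s ;; apps k i s"

lemma run_apps [simp]: "run k (apps l i s) \<sigma> = \<sigma>(i := \<sigma> i @ replicate l s)"
  by (induction l arbitrary: \<sigma>) (auto simp: replicate_append_same[symmetric] fun_eq_iff)

lemma wfc_apps [simp]: "wfc U S k (apps l i s) \<longleftrightarrow> l = 0 \<or> i < U \<and> i \<noteq> k \<and> 0 < s \<and> s < S"
  by (induction l) auto

declare run.simps(7) [simp del]

text \<open>\<open>S t\<close> is the store after \<open>t\<close> iterations. The cap is at least
  as long as the loop word and never cuts the loop short.\<close>

lemma run_For:
  assumes "run k (For i c) \<sigma> = run k (For i c) (S 0)" "length (S 0 i) = N" "N \<le> length (S 0 k)"
    and "\<And>t. t < N \<Longrightarrow> run k c (S t) = S (Suc t)"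
  shows "run k (For i c) \<sigma> = S N"
proof -
  have "t \<le> N \<Longrightarrow> (run k c ^^ t) (S 0) = S t" for t
    by (induction t) (auto simp: assms(4))
  then show ?thesis using assms(1-3) by (simp add: run.simps(7) min_def)
qed

lemma run_For_apps:
  assumes "length (\<sigma> i) \<le> length (\<sigma> k)"
  shows "run k (For i (apps l j s)) \<sigma> = \<sigma>(j := \<sigma> j @ replicate (length (\<sigma> i) * l) s)"
  by (rule run_For[where S = "\<lambda>t. \<sigma>(j := \<sigma> j @ replicate (t * l) s)", THEN trans])
    (use assms in \<open>auto simp: fun_eq_iff replicate_add[symmetric] add.commute\<close>)

lemma run_For_App:
  assumes "length (\<sigma> i) \<le> length (\<sigma> k)"
  shows "run k (For i (App j s)) \<sigma> = \<sigma>(j := \<sigma> j @ replicate (length (\<sigma> i)) s)"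
  by (rule run_For[where S = "\<lambda>t. \<sigma>(j := \<sigma> j @ replicate t s)", THEN trans])
    (use assms in \<open>auto simp: fun_eq_iff replicate_append_same\<close>)

text \<open>Writes the vertex number \<open>a * B + j\<close>, as word 7 has length
  \<open>B\<close>. The always empty word 3 supplies the number 0, and also position 0 in
  \<open>IfAt\<close> and \<open>SetAt\<close>.\<close>

definition emitv :: "nat \<Rightarrow> nat \<Rightarrow> com" where
  "emitv a j = For a (For 7 (App 1 2)) ;; For j (App 1 2) ;; App 1 3"

lemma run_emitv:
  assumes "length (\<sigma> a) \<le> length (\<sigma> 2)" "length (\<sigma> 7) \<le> length (\<sigma> 2)" "length (\<sigma> j) \<le> length (\<sigma> 2)"
    and "a \<noteq> 1" "j \<noteq> 1"
  shows "run 2 (emitv a j) \<sigma> = \<sigma>(1 := \<sigma> 1 @ enc_unary (length (\<sigma> a) * length (\<sigma> 7) + length (\<sigma> j)))"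
proof -
  have "run 2 (For a (For 7 (App 1 2))) \<sigma> = \<sigma>(1 := \<sigma> 1 @ replicate (length (\<sigma> a) * length (\<sigma> 7)) 2)"
    by (rule run_For[where S = "\<lambda>t. \<sigma>(1 := \<sigma> 1 @ replicate (t * length (\<sigma> 7)) 2)", THEN trans])
      (use assms in \<open>auto simp: run_For_App fun_eq_iff replicate_add[symmetric] add.commute\<close>)
  then show ?thesis
    unfolding emitv_def using assms
    by (simp add: run_For_App fun_eq_iff enc_unary_def replicate_add)
qed

lemma run_For_emit:
  assumes "length (\<sigma> i) = N" "N \<le> length (\<sigma> 2)" "i \<noteq> 1" "i \<noteq> c" "c \<noteq> 1" "c \<noteq> 2" "\<sigma> c = un c0"
    and "\<And>t z. t < N \<Longrightarrow> run 2 b (\<sigma>(1 := z, c := un (c0 + t))) = \<sigma>(1 := z @ g t, c := un (Suc (c0 + t)))"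
  shows "run 2 (For i b) \<sigma> = \<sigma>(1 := \<sigma> 1 @ concat (map g [0..<N]), c := un (c0 + N))"
proof (rule run_For[where S = "\<lambda>t. \<sigma>(1 := \<sigma> 1 @ concat (map g [0..<t]), c := un (c0 + t))"])
  have "\<sigma>(1 := \<sigma> 1 @ concat (map g [0..<0]), c := un (c0 + 0)) = \<sigma>"
    using assms by (auto simp: fun_eq_iff)
  then show "run 2 (For i b) \<sigma> = run 2 (For i b) (\<sigma>(1 := \<sigma> 1 @ concat (map g [0..<0]), c := un (c0 + 0)))"
    by simp
qed (use assms in auto)

text \<open>Word \<open>b\<close> has a one at the position given by the length of \<open>a\<close>
  exactly if it is longer, so two reads compare unary numbers.\<close>

definition if_neq :: "nat \<Rightarrow> nat \<Rightarrow> com \<Rightarrow> com \<Rightarrow> com" where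
  "if_neq a b c d = IfAt b a 1 c (IfAt a b 1 c d)"

lemma run_if_neq:
  assumes "\<sigma> a = un x" "\<sigma> b = un y"
  shows "run k (if_neq a b c d) \<sigma> = (if x \<noteq> y then run k c \<sigma> else run k d \<sigma>)"
  using assms by (auto simp: if_neq_def)

text \<open>The loop runs for the full length of the cap; once the position has reached the
  terminator, its body does nothing. The last command steps over the terminator.\<close>

definition read_unary :: "nat \<Rightarrow> com" where
  "read_unary r = For 2 (IfAt 0 4 2 (App r 1 ;; App 4 1) Skip) ;; App 4 1"

lemma word_cells_drop: "drop p x = ys @ zs \<Longrightarrow> word_cells x (int (p + length ys)) = (if zs = [] then 0 else hd zs)"
proof -
  assume d: "drop p x = ys @ zs"
  show ?thesis
  proof (cases "p \<le> length x")
    case True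
    then have "word_cells x (int (p + length ys)) = word_cells (drop p x) (int (length ys))"
      by (auto simp: word_cells_def nat_add_distrib)
    then show ?thesis unfolding d by (auto simp: word_cells_def nth_append hd_conv_nth)
  next
    case False
    then show ?thesis using d by (auto simp: word_cells_def)
  qed
qed

lemma run_read_unary:
  assumes "drop p (\<sigma> 0) = replicate l 2 @ 3 # xs" "\<sigma> 4 = un p" "l \<le> length (\<sigma> 2)" "r \<notin> {0, 2, 4}"
  shows "run 2 (read_unary r) \<sigma> = \<sigma>(r := \<sigma> r @ un l, 4 := un (p + l + 1))"
proof -
  let ?S = "\<lambda>t. \<sigma>(r := \<sigma> r @ un (min t l), 4 := un (p + min t l))"
  have sym: "word_cells (\<sigma> 0) (int (p + t)) = (if t < l then 2 else 3)" if "t \<le> l" for t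
  proof -
    have "drop p (\<sigma> 0) = replicate t 2 @ (replicate (l - t) 2 @ 3 # xs)"
      using assms(1) that by (simp add: replicate_add[symmetric] flip: append_assoc)
    from word_cells_drop[OF this] that show ?thesis by (cases "l - t") auto
  qed
  have "run 2 (For 2 (IfAt 0 4 2 (App r 1 ;; App 4 1) Skip)) \<sigma> = ?S (length (\<sigma> 2))"
  proof (rule run_For[where S = ?S])
    have "?S 0 = \<sigma>" using assms by (auto simp: fun_eq_iff)
    then show "run 2 (For 2 (IfAt 0 4 2 (App r 1 ;; App 4 1) Skip)) \<sigma> =
      run 2 (For 2 (IfAt 0 4 2 (App r 1 ;; App 4 1) Skip)) (?S 0)" by simp
    fix t
    show "run 2 (IfAt 0 4 2 (App r 1 ;; App 4 1) Skip) (?S t) = ?S (Suc t)"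
    proof (cases "t < l")
      case True
      then show ?thesis using assms(4) sym[of t]
        by (auto simp: fun_eq_iff un_snoc simp del: word_cells_nat replicate_Suc)
    next
      case False
      then show ?thesis using assms(4) sym[of l]
        by (auto simp: fun_eq_iff simp del: word_cells_nat)
    qed
  qed (use assms in auto)
  moreover have "min (length (\<sigma> 2)) l = l" using assms(3) by simp
  ultimately show ?thesis
    unfolding read_unary_def using assms(4) by (simp add: fun_eq_iff un_snoc del: replicate_Suc)
qed

text \<open>Each scan decodes the input anew: it skips the number of vertices with its terminator
  and then reads one edge record per iteration, until the end of the list, marked by 4, makes the
  remaining iterations idle. Word 10 is nonempty exactly for weight 1.\<close>

definition for_edges :: "com \<Rightarrow> com" where
  "for_edges b = For 5 (App 4 1) ;; App 4 1 ;;
     For 2 (IfAt 0 4 4 Skip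
       (read_unary 8 ;; read_unary 9 ;; IfAt 0 4 2 (App 10 1) Skip ;; App 4 1 ;; b ;;
        App 11 1 ;; Clear 8 ;; Clear 9 ;; Clear 10)) ;;
     Clear 4 ;; Clear 11"

context valid_mac begin

definition word :: "nat list" where
  "word = enc_mac I"

text \<open>A list of \<open>m\<close> edges takes at least \<open>m\<close> symbols, so this is at
  least \<open>B\<close>; it also bounds all vertex numbers and digit strings of the input.\<close>

definition cap :: nat where
  "cap = 32 * (length word + 1)"

definition pos :: "nat \<Rightarrow> nat" where
  "pos i = n + 1 + length (concat (map enc_wedge (take i (mac_edges I))))"

definition tail :: "nat list" where
  "tail = enc_int (mac_num I) @ enc_binary (mac_den I)"

definition flag :: "bool \<Rightarrow> nat list" where
  "flag b = (if b then [1] else [])"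

lemma word_eq: "word = enc_unary n @ concat (map enc_wedge (mac_edges I)) @ 4 # tail"
  by (simp add: word_def enc_mac_def enc_list_def tail_def)

lemma drop_pos: "i \<le> m \<Longrightarrow> drop (pos i) word = concat (map enc_wedge (drop i (mac_edges I))) @ 4 # tail"
proof -
  have "concat (map enc_wedge (mac_edges I)) =
      concat (map enc_wedge (take i (mac_edges I))) @ concat (map enc_wedge (drop i (mac_edges I)))"
    by (metis append_take_drop_id concat_append map_append)
  then show ?thesis by (simp add: word_eq pos_def enc_unary_def)
qed

lemma edge_code: "i < m \<Longrightarrow> enc_wedge (mac_edges I ! i) =
    replicate (u i) 2 @ 3 # replicate (v i) 2 @ 3 # [if w i = 1 then 2 else 1]"
  by (simp add: enc_wedge_def src_def tgt_def mac_weight_def enc_unary_def split: prod.splits)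

lemma pos_Suc: "i < m \<Longrightarrow> pos (Suc i) = pos i + u i + v i + 3"
  using edge_code[of i] by (simp add: pos_def take_Suc_conv_app_nth size_of_def)

lemma drop_pos_Suc: "i < m \<Longrightarrow> drop (pos i) word =
    replicate (u i) 2 @ 3 # replicate (v i) 2 @ 3 # (if w i = 1 then 2 else 1) # drop (pos (Suc i)) word"
  by (simp add: drop_pos edge_code size_of_def flip: Cons_nth_drop_Suc)

lemma length_word: "n \<le> length word" "m \<le> length word" "i < m \<Longrightarrow> u i \<le> length word" "i < m \<Longrightarrow> v i \<le> length word"
proof -
  show "n \<le> length word" by (simp add: word_eq enc_unary_def)
  have "length es \<le> length (concat (map enc_wedge es))" for es
  proof (induction es)
    case (Cons e es)
    have "1 \<le> length (enc_wedge e)" by (simp add: enc_wedge_def split: prod.splits)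
    then show ?case using Cons by simp
  qed simp
  from this[of "mac_edges I"] show "m \<le> length word" by (simp add: word_eq size_of_def)
  show "u i \<le> length word" "v i \<le> length word" if "i < m"
    using arg_cong[OF drop_pos_Suc[OF that], of length] by simp_all
qed

lemma cap_ge: "n \<le> cap" "m \<le> cap" "B \<le> cap" "i < m \<Longrightarrow> u i \<le> cap" "i < m \<Longrightarrow> v i \<le> cap" "length word < cap"
  using length_word(1,2) length_word(3,4)[of i] by (auto simp: cap_def block_def)

text \<open>What the body of a scan sees at edge \<open>i\<close>: the record is already consumed,
  so the position is that of the next one.\<close>

definition at_edge :: "nat \<Rightarrow> store \<Rightarrow> store" where
  "at_edge i \<sigma> = \<sigma>(4 := un (pos (Suc i)), 8 := un (u i), 9 := un (v i), 10 := flag (w i = 1), 11 := un i)"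

lemma run_for_edges:
  assumes base: "\<And>i. i \<le> m \<Longrightarrow> S i 0 = word \<and> S i 2 = un cap \<and> S i 5 = un n \<and>
      S i 4 = [] \<and> S i 8 = [] \<and> S i 9 = [] \<and> S i 10 = [] \<and> S i 11 = []"
    and body: "\<And>i. i < m \<Longrightarrow> run 2 b (at_edge i (S i)) = at_edge i (S (Suc i))"
  shows "run 2 (for_edges b) (S 0) = S m"
proof -
  let ?c = "read_unary 8 ;; read_unary 9 ;; IfAt 0 4 2 (App 10 1) Skip ;; App 4 1 ;; b ;;
        App 11 1 ;; Clear 8 ;; Clear 9 ;; Clear 10"
  let ?S = "\<lambda>i. (S i)(4 := un (pos i), 11 := un i)"
  have step: "run 2 (IfAt 0 4 4 Skip ?c) (?S i) = ?S (Suc i)" if i: "i < m" for i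
  proof -
    note d = drop_pos_Suc[OF i]
    have ne: "word_cells word (int (pos i)) \<noteq> 4"
      using word_cells_drop[of "pos i" word "[]" "drop (pos i) word"] unfolding d
      by (cases "u i") (simp_all del: word_cells_nat)
    have bi: "S i 0 = word" "S i 2 = un cap" "S i 8 = []" "S i 9 = []" "S i 10 = []" "S i 11 = []"
      using base[of i] i by auto
    have bs: "S (Suc i) 8 = []" "S (Suc i) 9 = []" "S (Suc i) 10 = []"
      using base[of "Suc i"] i by auto
    have 1: "run 2 (read_unary 8) (?S i) = (S i)(4 := un (pos i + u i + 1), 11 := un i, 8 := un (u i))"
      by (subst run_read_unary[OF _ _ _ _]) (use d bi cap_ge(4)[OF i] in \<open>auto simp: fun_eq_iff\<close>)
    have d2: "drop (pos i + u i + 1) word = replicate (v i) 2 @ 3 # (if w i = 1 then 2 else 1) # drop (pos (Suc i)) word"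
      using arg_cong[OF d, of "drop (u i + 1)"] by (simp add: ac_simps)
    have 2: "run 2 (read_unary 9) ((S i)(4 := un (pos i + u i + 1), 11 := un i, 8 := un (u i))) =
        (S i)(4 := un (pos i + u i + v i + 2), 11 := un i, 8 := un (u i), 9 := un (v i))"
      by (subst run_read_unary[OF _ _ _ _]) (use d2 bi cap_ge(5)[OF i] in \<open>auto simp: fun_eq_iff\<close>)
    have d3: "drop (pos i + u i + v i + 2) word = [] @ (if w i = 1 then 2 else 1) # drop (pos (Suc i)) word"
      using arg_cong[OF d2, of "drop (v i + 1)"] by (simp add: ac_simps)
    have sym: "word_cells word (int (pos i + u i + v i + 2)) = (if w i = 1 then 2 else 1)"
      using word_cells_drop[OF d3] by (simp del: word_cells_nat)
    have 3: "run 2 (App 4 1) (run 2 (IfAt 0 4 2 (App 10 1) Skip)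
        ((S i)(4 := un (pos i + u i + v i + 2), 11 := un i, 8 := un (u i), 9 := un (v i)))) = at_edge i (S i)"
      using bi sym pos_Suc[OF i]
      by (auto simp: at_edge_def flag_def fun_eq_iff un_snoc simp del: word_cells_nat replicate_Suc)
    have 4: "(at_edge i (S (Suc i)))(11 := un (Suc i), 8 := [], 9 := [], 10 := []) = ?S (Suc i)"
      using bs by (auto simp: at_edge_def fun_eq_iff)
    have "run 2 (IfAt 0 4 4 Skip ?c) (?S i) = run 2 ?c (?S i)"
      using ne bi by (simp del: word_cells_nat)
    also have "\<dots> = run 2 (b ;; App 11 1 ;; Clear 8 ;; Clear 9 ;; Clear 10) (at_edge i (S i))"
      using 1 2 3 by (simp only: run.simps)
    also have "\<dots> = (at_edge i (S (Suc i)))(11 := un (Suc i), 8 := [], 9 := [], 10 := [])"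
      using body[OF i] by (auto simp: at_edge_def fun_eq_iff un_snoc simp del: replicate_Suc)
    also have "\<dots> = ?S (Suc i)" by (rule 4)
    finally show ?thesis .
  qed
  have last: "run 2 (IfAt 0 4 4 Skip ?c) (?S m) = ?S m"
  proof -
    have "drop (pos m) word = [] @ 4 # tail" using drop_pos[of m] by (simp add: size_of_def)
    from word_cells_drop[OF this] have "word_cells word (int (pos m)) = 4" by (simp del: word_cells_nat)
    then show ?thesis using base[of m] by (simp del: word_cells_nat)
  qed
  have b0: "S 0 0 = word" "S 0 2 = un cap" "S 0 4 = []" "S 0 5 = un n" "S 0 11 = []" using base[of 0] by auto
  have init: "run 2 (App 4 1) (run 2 (For 5 (App 4 1)) (S 0)) = ?S 0"
    using b0 cap_ge(1) by (simp add: run_For_App fun_eq_iff pos_def un_snoc del: replicate_Suc)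
  \<comment> \<open>\<open>min t m\<close> keeps the store fixed during the \<open>cap - m\<close>
    surplus iterations.\<close>
  have loop: "run 2 (For 2 (IfAt 0 4 4 Skip ?c)) (?S 0) = ?S (min cap m)"
  proof (rule run_For[where S = "\<lambda>t. ?S (min t m)", simplified min_0L])
    fix t assume "t < cap"
    show "run 2 (IfAt 0 4 4 Skip ?c) (?S (min t m)) = ?S (min (Suc t) m)"
    proof (cases "t < m")
      case True
      then show ?thesis using step[of t] by (simp only: min.absorb3 min.absorb1 Suc_leI less_imp_le)
    next
      case False
      then have "min t m = m" "min (Suc t) m = m" by auto
      then show ?thesis using last by simp
    qed
  qed (use b0 in auto)
  have "min cap m = m" using cap_ge(2) by simp
  have fin: "(?S m)(4 := [], 11 := []) = S m" using base[of m] by (auto simp: fun_eq_iff)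
  show ?thesis
    unfolding for_edges_def run.simps(6) init loop \<open>min cap m = m\<close> run.simps(3) by (rule fin)
qed

lemma run_for_edges_emit:
  assumes "\<sigma> 0 = word" "\<sigma> 2 = un cap" "\<sigma> 5 = un n" "\<sigma> 4 = []" "\<sigma> 8 = []" "\<sigma> 9 = []" "\<sigma> 10 = []" "\<sigma> 11 = []"
    and "\<And>i z. i < m \<Longrightarrow> run 2 b (at_edge i (\<sigma>(1 := z))) = at_edge i (\<sigma>(1 := z @ g i))"
  shows "run 2 (for_edges b) \<sigma> = \<sigma>(1 := \<sigma> 1 @ concat (map g [0..<m]))"
  using run_for_edges[of "\<lambda>i. \<sigma>(1 := \<sigma> 1 @ concat (map g [0..<i]))" b] assms by simp

end

lemma word_cells_0 [simp]: "word_cells xs 0 = (if xs = [] then 0 else hd xs)"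
  by (simp add: word_cells_def hd_conv_nth)

lemma concat_concat: "concat (concat xss) = concat (map concat xss)"
  by (induction xss) auto

text \<open>A set is kept as a word with 2 at the positions of its members and 1 elsewhere. Marking
  both ends of an attached edge saves asking which of them is new.\<close>

definition grow_body :: com where
  "grow_body = IfAt 12 8 2
     (IfAt 12 9 2 Skip (SetAt 12 8 2 ;; SetAt 12 9 2 ;; SetAt 13 11 2))
     (IfAt 12 9 2 (SetAt 12 8 2 ;; SetAt 12 9 2 ;; SetAt 13 11 2) Skip)"

text \<open>The constants realise \<open>B = 32 * m + 32\<close> in word 7 and
  \<open>B - 1 - 2 * m = 30 * m + 31\<close> in word 14.\<close>

definition setup_prog :: com where
  "setup_prog = read_unary 5 ;; Clear 4 ;; for_edges (App 6 1 ;; App 13 1) ;;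
     For 6 (apps 32 7 1) ;; apps 32 7 1 ;; For 6 (apps 30 14 1) ;; apps 31 14 1 ;;
     For 5 (App 12 1) ;; SetAt 12 3 2 ;; For 5 (for_edges grow_body) ;; Clear 12"

definition clique_prog :: com where
  "clique_prog = For 5 (For 7 (For 16 (emitv 15 17 ;; emitv 15 16 ;; App 17 1) ;; Clear 17 ;; App 16 1) ;;
     Clear 16 ;; App 15 1) ;; Clear 15"

definition cross_body :: com where
  "cross_body = if_neq 8 9
     (emitv 8 3 ;;
      IfAt 13 11 2 (emitv 9 3) (For 11 (apps 2 18 1) ;; App 18 1 ;; emitv 9 18 ;; Clear 18) ;;
      emitv 8 3 ;; For 11 (apps 2 18 1) ;; apps 2 18 1 ;; emitv 9 18 ;; Clear 18) Skip"

definition forest_body :: com where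
  "forest_body = IfAt 13 11 2 (emitv 8 3 ;; emitv 9 3) Skip"

definition parent_prog :: com where
  "parent_prog = if_neq 15 9 (emitv 15 18) (if_neq 8 9 (emitv 8 3) (emitv 15 18))"

definition slots_body :: com where
  "slots_body = For 11 (apps 2 18 1) ;;
     IfAt 13 11 2 (emitv 15 18) parent_prog ;; App 18 1 ;; emitv 15 18 ;;
     IfAt 10 3 1 parent_prog (emitv 15 18) ;; App 18 1 ;; emitv 15 18 ;; Clear 18"

definition tree_prog :: com where
  "tree_prog = For 5 (for_edges slots_body ;;
     For 6 (apps 2 16 1) ;; For 14 (emitv 15 16 ;; App 16 1 ;; emitv 15 16) ;; Clear 16 ;; App 15 1) ;; Clear 15"

section \<open>Correctness of the programs that write the graph and the tree\<close>

context valid_mac begin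

definition marks :: "nat \<Rightarrow> nat set \<Rightarrow> nat list" where
  "marks k X = map (\<lambda>i. if i \<in> X then 2 else 1) [0..<k]"

lemma length_marks [simp]: "length (marks k X) = k"
  by (simp add: marks_def)

lemma nth_marks: "i < k \<Longrightarrow> marks k X ! i = (if i \<in> X then 2 else 1)"
  by (simp add: marks_def)

lemma marks_update: "i < k \<Longrightarrow> (marks k X)[i := 2] = marks k (insert i X)"
  by (rule nth_equalityI) (auto simp: nth_list_update nth_marks)

lemma marks_empty: "marks k {} = un k"
  by (simp add: marks_def map_replicate_trivial list_eq_iff_nth_eq)

definition base :: "store \<Rightarrow> bool" where
  "base \<sigma> \<longleftrightarrow> \<sigma> 0 = word \<and> \<sigma> 2 = un cap \<and> \<sigma> 3 = [] \<and> \<sigma> 5 = un n \<and> \<sigma> 6 = un m \<and> \<sigma> 7 = un B \<and>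
     \<sigma> 13 = marks m F \<and> \<sigma> 14 = un (B - 1 - 2 * m) \<and>
     \<sigma> 4 = [] \<and> \<sigma> 8 = [] \<and> \<sigma> 9 = [] \<and> \<sigma> 10 = [] \<and> \<sigma> 11 = [] \<and> \<sigma> 18 = []"

lemma slot_cap: "i < m \<Longrightarrow> 2 * i + 2 \<le> cap"
  using slot_less[of i] cap_ge(3) by linarith

lemma enc_edge_simp: "enc_edge (a, b) = enc_unary a @ enc_unary b"
  by (simp add: enc_edge_def)

lemma run_cross_body:
  assumes "base \<sigma>" "i < m"
  shows "run 2 cross_body (at_edge i (\<sigma>(1 := z))) = at_edge i (\<sigma>(1 := z @ concat (map enc_edge (cross_edges I i))))"
proof -
  let ?\<sigma> = "at_edge i (\<sigma>(1 := z))"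
  define c where "c = emitv 8 3 ;;
      IfAt 13 11 2 (emitv 9 3) (For 11 (apps 2 18 1) ;; App 18 1 ;; emitv 9 18 ;; Clear 18) ;;
      emitv 8 3 ;; For 11 (apps 2 18 1) ;; apps 2 18 1 ;; emitv 9 18 ;; Clear 18"
  note b = assms(1)[unfolded base_def] assms(2) slot_cap[OF assms(2)] cap_ge(3) cap_ge(4,5)[OF assms(2)]
  have neq: "run 2 cross_body ?\<sigma> = (if u i \<noteq> v i then run 2 c ?\<sigma> else ?\<sigma>)"
    unfolding cross_body_def c_def by (subst run_if_neq[of _ _ "u i" _ "v i"]) (simp_all add: at_edge_def)
  have 1: "run 2 (emitv 8 3) (at_edge i (\<sigma>(1 := y))) = at_edge i (\<sigma>(1 := y @ enc_unary (u i * B)))" for y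
    using b by (simp add: run_emitv at_edge_def fun_upd_twist)
  have 2: "run 2 (IfAt 13 11 2 (emitv 9 3) (For 11 (apps 2 18 1) ;; App 18 1 ;; emitv 9 18 ;; Clear 18)) (at_edge i (\<sigma>(1 := y))) =
      at_edge i (\<sigma>(1 := y @ enc_unary (v i * B + (if i \<in> F then 0 else 2 * i + 1))))" for y
    using b by (cases "i \<in> F") (simp_all add: run_emitv run_For_apps at_edge_def nth_marks fun_eq_iff mult.commute)
  have 3: "run 2 (Clear 18) (run 2 (emitv 9 18) (run 2 (apps 2 18 1) (run 2 (For 11 (apps 2 18 1)) (at_edge i (\<sigma>(1 := y)))))) =
      at_edge i (\<sigma>(1 := y @ enc_unary (v i * B + (2 * i + 2))))" for y
    using b by (simp add: run_emitv run_For_apps at_edge_def fun_eq_iff mult.commute)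
  show ?thesis
    unfolding neq c_def run.simps(6) 1 2 3 by (simp add: cross_edges_def enc_edge_simp)
qed

lemma run_forest_body:
  assumes "base \<sigma>" "i < m"
  shows "run 2 forest_body (at_edge i (\<sigma>(1 := z))) = at_edge i (\<sigma>(1 := z @ concat (map enc_edge (forest_edges I i))))"
  using assms cap_ge(3) cap_ge(4,5)[OF assms(2)]
  by (simp add: forest_body_def base_def at_edge_def run_emitv nth_marks forest_edges_def
      enc_edge_simp fun_eq_iff)

lemma run_parent_prog:
  assumes "\<sigma> 2 = un cap" "\<sigma> 3 = []" "\<sigma> 7 = un B" "\<sigma> 8 = un (u i)" "\<sigma> 9 = un (v i)" "\<sigma> 15 = un a" "\<sigma> 18 = un j"
    and "a < n" "i < m" "j \<le> cap"
  shows "run 2 parent_prog \<sigma> = \<sigma>(1 := \<sigma> 1 @ enc_unary (slot_parent I a i True j))"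
  using assms cap_ge(1,3) cap_ge(4,5)[OF assms(9)]
  by (simp add: parent_prog_def run_if_neq[of _ _ "u i" _ "v i"] run_if_neq[of _ _ a _ "v i"] run_emitv slot_parent_def)

lemma run_slots_body:
  assumes "base \<sigma>" "i < m" "\<sigma> 15 = un a" "a < n"
  shows "run 2 slots_body (at_edge i (\<sigma>(1 := z))) = at_edge i (\<sigma>(1 := z @ concat (map enc_edge (slot_edges I a i))))"
proof -
  define s where "s y j = (at_edge i (\<sigma>(1 := y)))(18 := un j)" for y j
  note b = assms(1)[unfolded base_def] assms(2-4) slot_cap[OF assms(2)] cap_ge(1,3) cap_ge(4,5)[OF assms(2)]
  have 1: "run 2 (For 11 (apps 2 18 1)) (at_edge i (\<sigma>(1 := y))) = s y (2 * i)" for y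
    using b by (simp add: run_For_apps at_edge_def s_def fun_eq_iff mult.commute)
  have link: "run 2 (emitv 15 18) (s y j) = s (y @ enc_unary (a * B + j)) j" if "j \<le> cap" for y j
    using b that by (simp add: run_emitv at_edge_def s_def fun_eq_iff)
  have par: "run 2 parent_prog (s y j) = s (y @ enc_unary (slot_parent I a i True j)) j" if "j \<le> cap" for y j
    by (subst run_parent_prog[of _ i a j]) (use b that in \<open>simp_all add: at_edge_def s_def fun_eq_iff\<close>)
  have 2: "run 2 (IfAt 13 11 2 (emitv 15 18) parent_prog) (s y (2 * i)) =
      s (y @ enc_unary (slot_parent I a i (i \<notin> F) (2 * i))) (2 * i)" for y
  proof -
    have "run 2 (IfAt 13 11 2 (emitv 15 18) parent_prog) (s y (2 * i)) =
        (if i \<in> F then run 2 (emitv 15 18) (s y (2 * i)) else run 2 parent_prog (s y (2 * i)))"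
      using b by (simp add: s_def at_edge_def nth_marks)
    then show ?thesis using b by (simp add: link par slot_parent_def)
  qed
  have 3: "run 2 (IfAt 10 3 1 parent_prog (emitv 15 18)) (s y (2 * i + 1)) =
      s (y @ enc_unary (slot_parent I a i (w i = 1) (2 * i + 1))) (2 * i + 1)" for y
  proof -
    have "run 2 (IfAt 10 3 1 parent_prog (emitv 15 18)) (s y (2 * i + 1)) =
        (if w i = 1 then run 2 parent_prog (s y (2 * i + 1)) else run 2 (emitv 15 18) (s y (2 * i + 1)))"
      using b by (simp add: s_def at_edge_def flag_def)
    then show ?thesis using b by (simp add: link par slot_parent_def)
  qed
  have 4: "run 2 (App 18 1) (s y (2 * i)) = s y (2 * i + 1)" "run 2 (App 18 1) (s y (2 * i + 1)) = s y (2 * i + 2)" for y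
    by (simp_all add: s_def fun_eq_iff un_snoc del: replicate_Suc)
  have 5: "run 2 (Clear 18) (s y j) = at_edge i (\<sigma>(1 := y))" for y j
    using b by (simp add: s_def at_edge_def fun_eq_iff)
  have l: "2 * i + 1 \<le> cap" "2 * i + 2 \<le> cap" using b by simp_all
  show ?thesis
    unfolding slots_body_def run.simps(6) 1 2 4 link[OF l(1)] 3 link[OF l(2)] 5
    by (simp add: slot_edges_def enc_edge_simp)
qed

lemma base_update: "base \<sigma> \<Longrightarrow> base (\<sigma>(1 := z))" "base \<sigma> \<Longrightarrow> i \<in> {15, 16, 17} \<Longrightarrow> base (\<sigma>(i := z))"
  by (auto simp: base_def)

lemma run_path:
  assumes "base \<sigma>" "\<sigma> 15 = un a" "\<sigma> 16 = []" "a < n"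
  shows "run 2 (Clear 16) (run 2 (For 14 (emitv 15 16 ;; App 16 1 ;; emitv 15 16)) (run 2 (For 6 (apps 2 16 1)) \<sigma>)) =
    \<sigma>(1 := \<sigma> 1 @ concat (map enc_edge (path_edges I a)))"
proof -
  note b = assms(1)[unfolded base_def] assms(2-4) cap_ge(1-3) B_ge(1)
  let ?N = "B - 1 - 2 * m"
  let ?g = "\<lambda>t. enc_edge (a * B + (2 * m + t), a * B + Suc (2 * m + t))"
  have 1: "run 2 (For 6 (apps 2 16 1)) \<sigma> = \<sigma>(16 := un (2 * m))"
    using b by (simp add: run_For_apps mult.commute)
  have 2: "run 2 (For 14 (emitv 15 16 ;; App 16 1 ;; emitv 15 16)) (\<sigma>(16 := un (2 * m))) =
      (\<sigma>(16 := un (2 * m)))(1 := (\<sigma>(16 := un (2 * m))) 1 @ concat (map ?g [0..<?N]), 16 := un (2 * m + ?N))"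
  proof (rule run_For_emit)
    fix t z assume t: "t < ?N"
    have "run 2 (emitv 15 16) ((\<sigma>(16 := un (2 * m)))(1 := z, 16 := un (2 * m + t))) =
        (\<sigma>(16 := un (2 * m)))(1 := z @ enc_unary (a * B + (2 * m + t)), 16 := un (2 * m + t))"
      using b t by (subst run_emitv) (auto simp: fun_eq_iff)
    moreover have "run 2 (App 16 1) ((\<sigma>(16 := un (2 * m)))(1 := y, 16 := un (2 * m + t))) =
        (\<sigma>(16 := un (2 * m)))(1 := y, 16 := un (Suc (2 * m + t)))" for y
      by (simp add: fun_eq_iff un_snoc del: replicate_Suc)
    moreover have "run 2 (emitv 15 16) ((\<sigma>(16 := un (2 * m)))(1 := y, 16 := un (Suc (2 * m + t)))) =
        (\<sigma>(16 := un (2 * m)))(1 := y @ enc_unary (a * B + Suc (2 * m + t)), 16 := un (Suc (2 * m + t)))" for y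
      using b t by (subst run_emitv) (auto simp: fun_eq_iff simp del: replicate_Suc)
    ultimately show "run 2 (emitv 15 16 ;; App 16 1 ;; emitv 15 16) ((\<sigma>(16 := un (2 * m)))(1 := z, 16 := un (2 * m + t))) =
        (\<sigma>(16 := un (2 * m)))(1 := z @ ?g t, 16 := un (Suc (2 * m + t)))"
      by (simp only: run.simps(6) enc_edge_simp append_assoc)
  qed (use b in auto)
  have "path_edges I a = map (\<lambda>t. (a * B + (2 * m + t), a * B + Suc (2 * m + t))) [0..<?N]"
  proof -
    have "[2 * m..<B - 1] = map (\<lambda>t. t + 2 * m) [0..<?N]" using b by (simp add: map_add_upt)
    then show ?thesis by (simp add: path_edges_def comp_def add.commute)
  qed
  then have "concat (map enc_edge (path_edges I a)) = concat (map ?g [0..<?N])" by (simp add: comp_def)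
  then show ?thesis unfolding 1 2 using assms(3) by (simp add: fun_eq_iff)
qed

lemma run_tree_prog:
  assumes "base \<sigma>" "\<sigma> 15 = []" "\<sigma> 16 = []"
  shows "run 2 tree_prog \<sigma> = \<sigma>(1 := \<sigma> 1 @ concat (map (\<lambda>a. concat (map enc_edge
     (concat (map (slot_edges I a) [0..<m]) @ path_edges I a))) [0..<n]))"
proof -
  note b = assms(1)[unfolded base_def] assms(2,3) cap_ge(1)
  let ?g = "\<lambda>a. concat (map enc_edge (concat (map (slot_edges I a) [0..<m]) @ path_edges I a))"
  let ?c = "for_edges slots_body ;;
     For 6 (apps 2 16 1) ;; For 14 (emitv 15 16 ;; App 16 1 ;; emitv 15 16) ;; Clear 16 ;; App 15 1"
  have "run 2 (For 5 ?c) \<sigma> = \<sigma>(1 := \<sigma> 1 @ concat (map ?g [0..<n]), 15 := un (0 + n))"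
  proof (rule run_For_emit)
    fix a z assume a: "a < n"
    let ?s = "\<lambda>y. \<sigma>(1 := y, 15 := un (0 + a))"
    have bs: "base (?s y)" for y using base_update assms(1) by simp
    have 1: "run 2 (for_edges slots_body) (?s z) =
        (?s z)(1 := ?s z 1 @ concat (map (\<lambda>i. concat (map enc_edge (slot_edges I a i))) [0..<m]))"
    proof (rule run_for_edges_emit)
      fix i y assume "i < m"
      then show "run 2 slots_body (at_edge i ((?s z)(1 := y))) =
          at_edge i ((?s z)(1 := y @ concat (map enc_edge (slot_edges I a i))))"
        using bs a by (intro run_slots_body) simp_all
    qed (use bs[of z] in \<open>simp_all add: base_def\<close>)
    also have "\<dots> = ?s (z @ concat (map enc_edge (concat (map (slot_edges I a) [0..<m]))))"
      by (simp add: fun_eq_iff map_concat concat_concat comp_def)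
    finally have 1: "run 2 (for_edges slots_body) (?s z) = ?s (z @ concat (map enc_edge (concat (map (slot_edges I a) [0..<m]))))" .
    have 2: "run 2 (Clear 16) (run 2 (For 14 (emitv 15 16 ;; App 16 1 ;; emitv 15 16)) (run 2 (For 6 (apps 2 16 1)) (?s y))) =
       (?s y)(1 := ?s y 1 @ concat (map enc_edge (path_edges I a)))" for y
      using bs a assms by (intro run_path) simp_all
    show "run 2 ?c (\<sigma>(1 := z, 15 := un (0 + a))) = \<sigma>(1 := z @ ?g a, 15 := un (Suc (0 + a)))"
      unfolding run.simps(6) 1 2 by (simp add: fun_eq_iff un_snoc del: replicate_Suc)
  qed (use b in simp_all)
  then show ?thesis using b by (simp add: tree_prog_def fun_eq_iff)
qed

lemma run_clique_prog:
  assumes "base \<sigma>" "\<sigma> 15 = []" "\<sigma> 16 = []" "\<sigma> 17 = []"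
  shows "run 2 clique_prog \<sigma> = \<sigma>(1 := \<sigma> 1 @ concat (map enc_edge (clique_edges I)))"
proof -
  note b = assms(1)[unfolded base_def] assms(2-4) cap_ge(1,3)
  let ?g = "\<lambda>a j k. enc_edge (a * B + k, a * B + j)"
  let ?h = "\<lambda>a j. concat (map (?g a j) [0..<j])"
  let ?f = "\<lambda>a. concat (map (?h a) [0..<B])"
  let ?c1 = "emitv 15 17 ;; emitv 15 16 ;; App 17 1"
  let ?c2 = "For 16 ?c1 ;; Clear 17 ;; App 16 1"
  let ?c3 = "For 7 ?c2 ;; Clear 16 ;; App 15 1"
  have 1: "run 2 (For 16 ?c1) \<tau> = \<tau>(1 := \<tau> 1 @ ?h a j, 17 := un (0 + j))"
    if \<tau>: "\<tau> 2 = un cap" "\<tau> 7 = un B" "\<tau> 15 = un a" "\<tau> 16 = un j" "\<tau> 17 = []" "a < n" "j < B" for \<tau> a j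
  proof (rule run_For_emit)
    fix k z assume k: "k < j"
    have "run 2 (emitv 15 17) (\<tau>(1 := z, 17 := un (0 + k))) = \<tau>(1 := z @ enc_unary (a * B + k), 17 := un (0 + k))"
      using b \<tau> k by (subst run_emitv) (auto simp: fun_eq_iff)
    moreover have "run 2 (emitv 15 16) (\<tau>(1 := y, 17 := un (0 + k))) = \<tau>(1 := y @ enc_unary (a * B + j), 17 := un (0 + k))" for y
      using b \<tau> k by (subst run_emitv) (auto simp: fun_eq_iff)
    moreover have "run 2 (App 17 1) (\<tau>(1 := y, 17 := un (0 + k))) = \<tau>(1 := y, 17 := un (Suc (0 + k)))" for y
      by (simp add: fun_eq_iff un_snoc del: replicate_Suc)
    ultimately show "run 2 ?c1 (\<tau>(1 := z, 17 := un (0 + k))) = \<tau>(1 := z @ ?g a j k, 17 := un (Suc (0 + k)))"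
      by (simp only: run.simps(6) enc_edge_simp append_assoc)
  qed (use b \<tau> in auto)
  have 2: "run 2 (For 7 ?c2) \<tau> = \<tau>(1 := \<tau> 1 @ ?f a, 16 := un (0 + B))"
    if \<tau>: "\<tau> 2 = un cap" "\<tau> 7 = un B" "\<tau> 15 = un a" "\<tau> 16 = []" "\<tau> 17 = []" "a < n" for \<tau> a
  proof (rule run_For_emit)
    fix j z assume j: "j < B"
    have "run 2 (For 16 ?c1) (\<tau>(1 := z, 16 := un (0 + j))) =
        (\<tau>(1 := z, 16 := un (0 + j)))(1 := (\<tau>(1 := z, 16 := un (0 + j))) 1 @ ?h a j, 17 := un (0 + j))"
      using \<tau> j by (intro 1) simp_all
    then show "run 2 ?c2 (\<tau>(1 := z, 16 := un (0 + j))) = \<tau>(1 := z @ ?h a j, 16 := un (Suc (0 + j)))"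
      using \<tau> by (simp add: fun_eq_iff un_snoc del: replicate_Suc)
  qed (use b \<tau> in auto)
  have 3: "run 2 (For 5 ?c3) \<sigma> = \<sigma>(1 := \<sigma> 1 @ concat (map ?f [0..<n]), 15 := un (0 + n))"
  proof (rule run_For_emit)
    fix a z assume a: "a < n"
    have "run 2 (For 7 ?c2) (\<sigma>(1 := z, 15 := un (0 + a))) =
        (\<sigma>(1 := z, 15 := un (0 + a)))(1 := (\<sigma>(1 := z, 15 := un (0 + a))) 1 @ ?f a, 16 := un (0 + B))"
      using b a by (intro 2) simp_all
    then show "run 2 ?c3 (\<sigma>(1 := z, 15 := un (0 + a))) = \<sigma>(1 := z @ ?f a, 15 := un (Suc (0 + a)))"
      using b by (simp add: fun_eq_iff un_snoc del: replicate_Suc)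
  qed (use b in auto)
  have "concat (map enc_edge (clique_edges I)) = concat (map ?f [0..<n])"
    by (simp add: clique_edges_def map_concat concat_concat comp_def)
  then show ?thesis using 3 b by (simp add: clique_prog_def fun_eq_iff)
qed

lemma run_grow_body:
  assumes "i < m" "\<sigma> 12 = marks n (fst VF)" "\<sigma> 13 = marks m (snd VF)"
  shows "run 2 grow_body (at_edge i \<sigma>) = at_edge i (\<sigma>(12 := marks n (fst (grow I i VF)), 13 := marks m (snd (grow I i VF))))"
proof -
  obtain V X where VX: "VF = (V, X)" by fastforce
  have "V \<union> {u i, v i} = insert (v i) (insert (u i) V)" by auto
  then show ?thesis
    using assms ends_less[OF assms(1)] unfolding VX
    by (cases "u i \<in> V"; cases "v i \<in> V")
      (simp_all add: grow_body_def at_edge_def nth_marks marks_update grow_def fun_eq_iff)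
qed

lemma run_pass:
  assumes "\<sigma> 0 = word" "\<sigma> 2 = un cap" "\<sigma> 5 = un n" "\<sigma> 4 = []" "\<sigma> 8 = []" "\<sigma> 9 = []" "\<sigma> 10 = []" "\<sigma> 11 = []"
  shows "run 2 (for_edges grow_body) (\<sigma>(12 := marks n (fst VF), 13 := marks m (snd VF))) =
    \<sigma>(12 := marks n (fst (pass I VF)), 13 := marks m (snd (pass I VF)))"
proof -
  let ?S = "\<lambda>i. \<sigma>(12 := marks n (fst (fold (grow I) [0..<i] VF)), 13 := marks m (snd (fold (grow I) [0..<i] VF)))"
  have "run 2 (for_edges grow_body) (?S 0) = ?S m"
  proof (rule run_for_edges[where S = ?S])
    fix i assume "i < m"
    then have "run 2 grow_body (at_edge i (?S i)) = at_edge i ((?S i)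
        (12 := marks n (fst (grow I i (fold (grow I) [0..<i] VF))), 13 := marks m (snd (grow I i (fold (grow I) [0..<i] VF)))))"
      by (intro run_grow_body) simp_all
    then show "run 2 grow_body (at_edge i (?S i)) = at_edge i (?S (Suc i))" by (simp add: fun_upd_twist)
  qed (use assms in simp)
  then show ?thesis by (simp add: pass_def)
qed

definition store0 :: store where
  "store0 = (\<lambda>i. [])(0 := word, 2 := un cap)"

definition store1 :: store where
  "store1 = store0(5 := un n, 6 := un m, 7 := un B, 13 := marks m F, 14 := un (B - 1 - 2 * m))"

lemma run_setup: "run 2 setup_prog store0 = store1"
proof -
  have d: "drop 0 (store0 0) = replicate n 2 @ 3 # (concat (map enc_wedge (mac_edges I)) @ 4 # tail)"
    by (simp add: store0_def word_eq enc_unary_def)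
  have 1: "run 2 (Clear 4) (run 2 (read_unary 5) store0) = store0(5 := un n)"
    by (subst run_read_unary[where \<sigma> = store0, OF d]) (use cap_ge(1) in \<open>auto simp: store0_def fun_eq_iff\<close>)
  let ?S = "\<lambda>i. store0(5 := un n, 6 := un i, 13 := un i)"
  have 2: "run 2 (for_edges (App 6 1 ;; App 13 1)) (?S 0) = ?S m"
    by (rule run_for_edges[where S = ?S]) (auto simp: store0_def at_edge_def fun_eq_iff un_snoc simp del: replicate_Suc)
  have S0: "?S 0 = store0(5 := un n)" by (simp add: store0_def fun_eq_iff)
  let ?s2 = "store0(5 := un n, 6 := un m, 13 := un m, 7 := un B, 14 := un (B - 1 - 2 * m))"
  have B: "B = m * 32 + 32" "B - 1 - 2 * m = m * 30 + 31" by (simp_all add: block_def)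
  have lm: "length (un m) \<le> length (un cap)" using cap_ge(2) by simp
  have 31: "run 2 (For 6 (apps 32 7 1)) (?S m) = (?S m)(7 := un (m * 32))"
    by (subst run_For_apps) (use lm in \<open>simp_all add: store0_def\<close>)
  have 32: "run 2 (apps 32 7 1) ((?S m)(7 := un (m * 32))) = (?S m)(7 := un B)"
    unfolding run_apps B(1) replicate_add by (simp only: fun_upd_same fun_upd_upd)
  have 33: "run 2 (For 6 (apps 30 14 1)) ((?S m)(7 := un B)) = (?S m)(7 := un B, 14 := un (m * 30))"
    by (subst run_For_apps) (use lm in \<open>simp_all add: store0_def\<close>)
  have 34: "run 2 (apps 31 14 1) ((?S m)(7 := un B, 14 := un (m * 30))) = ?s2"
    unfolding run_apps B(2) replicate_add by (simp only: fun_upd_same fun_upd_upd)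
  note 3 = 31 32 33 34
  have 4: "run 2 (SetAt 12 3 2) (run 2 (For 5 (App 12 1)) ?s2) = ?s2(12 := marks n {0}, 13 := marks m {})"
  proof -
    have "run 2 (For 5 (App 12 1)) ?s2 = ?s2(12 := un n)"
      by (subst run_For_App) (use cap_ge(1) in \<open>simp_all add: store0_def\<close>)
    moreover have "(un n)[0 := 2] = marks n {0}" using n_pos marks_update[of 0 n "{}"] by (simp add: marks_empty)
    ultimately show ?thesis by (simp add: store0_def fun_eq_iff marks_empty del: replicate.simps)
  qed
  let ?P = "\<lambda>k. ?s2(12 := marks n (fst ((pass I ^^ k) ({0}, {}))), 13 := marks m (snd ((pass I ^^ k) ({0}, {}))))"
  have P0: "?s2(12 := marks n {0}, 13 := marks m {}) = ?P 0" by simp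
  have 5: "run 2 (For 5 (for_edges grow_body)) (?P 0) = ?P n"
  proof (rule run_For[where S = ?P])
    fix k
    show "run 2 (for_edges grow_body) (?P k) = ?P (Suc k)"
      unfolding funpow.simps(2) o_apply by (rule run_pass) (simp_all add: store0_def)
  qed (use cap_ge(1) in \<open>simp_all add: store0_def\<close>)
  have 6: "run 2 (Clear 12) (?P n) = store1"
    by (simp add: store1_def store0_def fun_eq_iff forest_def)
  show ?thesis
    unfolding setup_prog_def run.simps(6) 1 2[unfolded S0] 3 4 P0 5 6 ..
qed

end

section \<open>Binary digits\<close>

lemma bin_digits_0 [simp]: "bin_digits 0 = []"
  by (simp add: bin_digits.simps[of 0])

lemma bin_digits_pos: "0 < k \<Longrightarrow> bin_digits k = (if odd k then 2 else 1) # bin_digits (k div 2)"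
  by (simp add: bin_digits.simps[of k])

lemma set_bin_digits: "set (bin_digits k) \<subseteq> {1, 2}"
proof (induction k rule: less_induct)
  case (less k)
  then show ?case by (cases "k = 0") (auto simp: bin_digits_pos)
qed

text \<open>Testing for the symbol 2 treats positions beyond the end as digit zero, so numbers of
  different lengths can be processed without padding.\<close>

lemma bin_digits_nth: "word_cells (bin_digits k) (int t) = 2 \<longleftrightarrow> odd (k div 2 ^ t)"
proof (induction t arbitrary: k)
  case 0
  then show ?case by (cases "k = 0") (simp_all add: bin_digits_pos)
next
  case (Suc t)
  show ?case
  proof (cases "k = 0")
    case False
    then have "word_cells (bin_digits k) (int (Suc t)) = word_cells (bin_digits (k div 2)) (int t)"
      by (simp add: bin_digits_pos del: of_nat_Suc)
    then show ?thesis using Suc[of "k div 2"] by (simp add: div_mult2_eq del: of_nat_Suc word_cells_nat)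
  qed (simp add: word_cells_def)
qed

lemma less_length_bin_digits: "k < 2 ^ length (bin_digits k)"
proof (induction k rule: less_induct)
  case (less k)
  show ?case
  proof (cases "k = 0")
    case False
    then have "k div 2 < 2 ^ length (bin_digits (k div 2))" using less by simp
    then show ?thesis using False by (simp add: bin_digits_pos)
  qed simp
qed

lemma length_bin_digits: "k < 2 ^ t \<Longrightarrow> length (bin_digits k) \<le> t"
proof (induction t arbitrary: k)
  case (Suc t)
  then have "k div 2 < 2 ^ t" by simp
  then show ?case using Suc.IH[of "k div 2"] by (cases "k = 0") (simp_all add: bin_digits_pos)
qed simp

text \<open>Describes the output after a new top digit one: the zeros held back so far have to be
  written before it.\<close>

lemma bin_digits_add_power:
  "k < 2 ^ t \<Longrightarrow> bin_digits (k + 2 ^ t) = bin_digits k @ replicate (t - length (bin_digits k)) 1 @ [2]"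
proof (induction t arbitrary: k)
  case 0
  then show ?case by (simp add: bin_digits_pos)
next
  case (Suc t)
  have "k div 2 < 2 ^ t" using Suc.prems by simp
  then have IH: "bin_digits (k div 2 + 2 ^ t) = bin_digits (k div 2) @ replicate (t - length (bin_digits (k div 2))) 1 @ [2]"
    by (rule Suc.IH)
  have "bin_digits (k + 2 ^ Suc t) = (if odd k then 2 else 1) # bin_digits (k div 2 + 2 ^ t)"
    by (subst bin_digits_pos) (simp_all add: add.commute)
  then show ?case using IH by (cases "k = 0") (simp_all add: bin_digits_pos)
qed

lemma bin_digits_shift: "0 < k \<Longrightarrow> bin_digits (k * 2 ^ t) = replicate t 1 @ bin_digits k"
proof (induction t)
  case (Suc t)
  have "k * 2 ^ Suc t div 2 = k * 2 ^ t" by simp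
  then show ?case using Suc by (subst bin_digits_pos) simp_all
qed simp

text \<open>Since (k + 1) * 2 ^ t - 1 = k * 2 ^ t + (2 ^ t - 1). This makes the lowered threshold
  cheap to write: its numerator consists of \<open>m\<close> ones and then the digits of 3 * d + c -
  1.\<close>

lemma bin_digits_shift_ones: "bin_digits ((k + 1) * 2 ^ t - 1) = replicate t 2 @ bin_digits k"
proof (induction t)
  case (Suc t)
  have "1 \<le> (k + 1) * 2 ^ t" using mult_le_mono[of 1 "k + 1" 1 "2 ^ t"] by simp
  then have "(k + 1) * 2 ^ Suc t - 1 = 2 * ((k + 1) * 2 ^ t - 1) + 1" by simp
  then show ?case using Suc by (subst bin_digits_pos) simp_all
qed simp

definition read_binary :: "nat \<Rightarrow> com" where
  "read_binary r = For 2 (IfAt 0 4 2 (App r 2 ;; App 4 1) (IfAt 0 4 1 (App r 1 ;; App 4 1) Skip)) ;; App 4 1"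

lemma run_read_binary:
  assumes "drop p (\<sigma> 0) = ds @ 3 # xs" "set ds \<subseteq> {1, 2}" "\<sigma> 4 = un p" "length ds \<le> length (\<sigma> 2)" "r \<notin> {0, 2, 4}"
  shows "run 2 (read_binary r) \<sigma> = \<sigma>(r := \<sigma> r @ ds, 4 := un (p + length ds + 1))"
proof -
  let ?S = "\<lambda>t. \<sigma>(r := \<sigma> r @ take t ds, 4 := un (p + min t (length ds)))"
  let ?c = "IfAt 0 4 2 (App r 2 ;; App 4 1) (IfAt 0 4 1 (App r 1 ;; App 4 1) Skip)"
  have sym: "word_cells (\<sigma> 0) (int (p + t)) = (if t < length ds then ds ! t else 3)" if "t \<le> length ds" for t
  proof -
    have "drop p (\<sigma> 0) = take t ds @ (drop t ds @ 3 # xs)" using assms(1) by simp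
    from word_cells_drop[OF this] that show ?thesis by (cases "t < length ds") (simp_all add: hd_append hd_drop_conv_nth min_absorb2 del: word_cells_nat)
  qed
  have "run 2 (For 2 ?c) \<sigma> = ?S (length (\<sigma> 2))"
  proof (rule run_For[where S = ?S])
    have "?S 0 = \<sigma>" using assms by (auto simp: fun_eq_iff)
    then show "run 2 (For 2 ?c) \<sigma> = run 2 (For 2 ?c) (?S 0)" by simp
    fix t
    show "run 2 ?c (?S t) = ?S (Suc t)"
    proof (cases "t < length ds")
      case True
      then have "ds ! t = 1 \<or> ds ! t = 2" using assms(2) nth_mem by blast
      then show ?thesis using True assms(5) sym[of t]
        by (auto simp: fun_eq_iff un_snoc take_Suc_conv_app_nth simp del: word_cells_nat replicate_Suc)
    next
      case False
      then show ?thesis using assms(5) sym[of "length ds"]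
        by (auto simp: fun_eq_iff simp del: word_cells_nat)
    qed
  qed (use assms in auto)
  moreover have "min (length (\<sigma> 2)) (length ds) = length ds" using assms(4) by simp
  ultimately show ?thesis
    unfolding read_binary_def using assms(4,5) by (simp add: fun_eq_iff un_snoc del: replicate_Suc)
qed

text \<open>The first symbol 4 of the input ends the edge list; sign, numerator and denominator
  follow. Word 22 becomes nonempty for a negative numerator.\<close>

definition parse_prog :: com where
  "parse_prog = For 2 (IfAt 0 4 4 Skip (App 4 1)) ;; App 4 1 ;; IfAt 0 4 2 (App 22 1) Skip ;; App 4 1 ;;
     read_binary 20 ;; read_binary 21 ;; Clear 4"

text \<open>In ascending order of significance the last differing digit decides; equal digits leave
  the flag in word 23 alone. For a negative numerator it stays empty.\<close>

definition compare_prog :: com where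
  "compare_prog = IfAt 22 3 1 Skip
     (For 2 (IfAt 20 11 2 (IfAt 21 11 2 Skip (Clear 23 ;; App 23 1)) (IfAt 21 11 2 (Clear 23) Skip) ;; App 11 1) ;;
      Clear 11)"

text \<open>One step of the computation of \<open>3 * d + c - 1\<close>, from the least significant digit on. Word 24 holds
  the carry increased by one, word 27 the zeros that have not been written yet, as leading zeros have
  to be suppressed.\<close>

definition add_digits :: com where
  "add_digits = IfAt 21 11 2 (apps 3 24 1) Skip ;;
     IfAt 22 3 1 (IfAt 20 11 2 Skip (App 24 1)) (IfAt 20 11 2 (apps 2 24 1) (App 24 1))"

definition halve :: com where
  "halve = For 24 (IfAt 26 3 1 (Clear 26 ;; App 25 1) (App 26 1)) ;;
     Clear 24 ;; For 25 (App 24 1) ;; Clear 25"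

definition write_digit :: com where
  "write_digit = IfAt 26 3 1 (For 27 (App 1 1) ;; Clear 27 ;; App 1 2 ;; Clear 26) (App 27 1)"

definition copy_denominator :: com where
  "copy_denominator = For 21 (IfAt 21 11 2 (App 1 2) (App 1 1) ;; App 11 1) ;; Clear 11"

text \<open>The denominator 4 * d * 2 ^ m is written as \<open>m + 2\<close> zeros followed by the
  digits of d. If word 23 reports k > 1, the fraction 1 / 1 is written.\<close>

definition number_prog :: com where
  "number_prog = IfAt 23 3 1 (App 1 2 ;; App 1 3 ;; App 1 2 ;; App 1 3)
     (For 6 (App 1 2) ;; For 2 (add_digits ;; halve ;; write_digit ;; App 11 1) ;; Clear 11 ;; App 1 3 ;;
      For 6 (App 1 1) ;; apps 2 1 1 ;; copy_denominator ;; App 1 3)"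

lemma run_halve:
  assumes "\<sigma> 24 = un t" "\<sigma> 25 = []" "\<sigma> 26 = []" "\<sigma> 3 = []" "t \<le> length (\<sigma> 2)"
  shows "run 2 halve \<sigma> = \<sigma>(24 := un (t div 2), 26 := un (t mod 2))"
proof -
  let ?S = "\<lambda>k. \<sigma>(25 := un (k div 2), 26 := un (k mod 2))"
  have "run 2 (For 24 (IfAt 26 3 1 (Clear 26 ;; App 25 1) (App 26 1))) \<sigma> = ?S t"
  proof (rule run_For[where S = ?S])
    have "?S 0 = \<sigma>" using assms by (auto simp: fun_eq_iff)
    then show "run 2 (For 24 (IfAt 26 3 1 (Clear 26 ;; App 25 1) (App 26 1))) \<sigma> =
        run 2 (For 24 (IfAt 26 3 1 (Clear 26 ;; App 25 1) (App 26 1))) (?S 0)" by simp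
    fix k
    show "run 2 (IfAt 26 3 1 (Clear 26 ;; App 25 1) (App 26 1)) (?S k) = ?S (Suc k)"
    proof (cases "even k")
      case True
      then have "k mod 2 = 0" "Suc k mod 2 = 1" "Suc k div 2 = k div 2" by presburger+
      then show ?thesis using assms by (simp add: fun_eq_iff)
    next
      case False
      then have "k mod 2 = 1" "Suc k mod 2 = 0" "Suc k div 2 = Suc (k div 2)" by presburger+
      then show ?thesis using assms by (simp only: run.simps) (simp add: fun_eq_iff un_snoc)
    qed
  qed (use assms in auto)
  moreover have "t div 2 \<le> length (\<sigma> 2)" using assms(5) by linarith
  ultimately show ?thesis using assms by (simp add: halve_def run_For_App fun_eq_iff)
qed

lemma mod_power_Suc: "(k :: nat) mod 2 ^ Suc t = k mod 2 ^ t + (if odd (k div 2 ^ t) then 2 ^ t else 0)"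
  using mod_mult2_eq[of k "2 ^ t" 2] by (auto simp: mult.commute odd_iff_mod_2_eq_one even_iff_mod_2_eq_zero)

context valid_mac begin

definition num_abs :: nat where
  "num_abs = nat \<bar>mac_num I\<bar>"

abbreviation "den \<equiv> mac_den I"

lemma tail_eq: "tail = (if mac_num I < 0 then 2 else 1) # bin_digits num_abs @ 3 # bin_digits den @ [3]"
  by (simp add: tail_def enc_int_def enc_binary_def num_abs_def)

lemma no_end_marker: "4 \<notin> set (enc_unary n @ concat (map enc_wedge (mac_edges I)))"
  by (auto simp: enc_unary_def enc_wedge_def split: prod.splits)

lemma digits_cap: "length (bin_digits num_abs) \<le> cap" "length (bin_digits den) \<le> cap"
  "num_abs < 2 ^ length word" "den < 2 ^ length word"
proof -
  have l: "length (bin_digits num_abs) \<le> length word" "length (bin_digits den) \<le> length word"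
    by (simp_all add: word_eq tail_eq)
  then show "length (bin_digits num_abs) \<le> cap" "length (bin_digits den) \<le> cap" using cap_ge(6) by simp_all
  show "num_abs < 2 ^ length word" "den < 2 ^ length word"
    using less_le_trans[OF less_length_bin_digits power_increasing[OF l(1)]]
      less_le_trans[OF less_length_bin_digits power_increasing[OF l(2)]] by simp_all
qed

lemma run_parse_prog:
  assumes "base \<sigma>" "\<sigma> 20 = []" "\<sigma> 21 = []" "\<sigma> 22 = []"
  shows "run 2 parse_prog \<sigma> = \<sigma>(20 := bin_digits num_abs, 21 := bin_digits den, 22 := flag (mac_num I < 0))"
proof -
  note b = assms(1)[unfolded base_def] assms(2-4)
  define pre where "pre = enc_unary n @ concat (map enc_wedge (mac_edges I))"
  have word: "word = pre @ 4 # tail" by (simp add: pre_def word_eq)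
  let ?P = "length pre"
  let ?S = "\<lambda>t. \<sigma>(4 := un (min t ?P))"
  have P: "?P \<le> cap" using cap_ge(6) by (simp add: word)
  have sym: "word_cells word (int t) = 4 \<longleftrightarrow> t = ?P" if "t \<le> ?P" for t
  proof -
    have "4 \<notin> set pre" using no_end_marker by (simp add: pre_def)
    then have "t < ?P \<Longrightarrow> pre ! t \<noteq> 4" using nth_mem by metis
    then show ?thesis using that by (auto simp: word nth_append)
  qed
  have 1: "run 2 (For 2 (IfAt 0 4 4 Skip (App 4 1))) \<sigma> = ?S cap"
  proof (rule run_For[where S = ?S])
    have "?S 0 = \<sigma>" using b by (auto simp: fun_eq_iff)
    then show "run 2 (For 2 (IfAt 0 4 4 Skip (App 4 1))) \<sigma> = run 2 (For 2 (IfAt 0 4 4 Skip (App 4 1))) (?S 0)" by simp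
    fix t
    show "run 2 (IfAt 0 4 4 Skip (App 4 1)) (?S t) = ?S (Suc t)"
    proof (cases "t < ?P")
      case True
      then show ?thesis using b sym[of t] by (simp add: fun_eq_iff un_snoc del: word_cells_nat replicate_Suc)
    next
      case False
      then show ?thesis using b sym[of ?P] by (simp add: fun_eq_iff min_absorb2 del: word_cells_nat)
    qed
  qed (use b in auto)
  have 2: "run 2 (App 4 1) (?S cap) = \<sigma>(4 := un (?P + 1))"
    using P by (simp add: min_absorb2 fun_eq_iff un_snoc del: replicate_Suc)
  have d1: "drop (?P + 1) word = [] @ tail" by (simp add: word)
  have "word_cells word (int (?P + 1)) = (if mac_num I < 0 then 2 else 1)"
    using word_cells_drop[OF d1] by (simp add: tail_eq del: word_cells_nat)
  then have 3: "run 2 (App 4 1) (run 2 (IfAt 0 4 2 (App 22 1) Skip) (\<sigma>(4 := un (?P + 1)))) =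
      \<sigma>(4 := un (?P + 2), 22 := flag (mac_num I < 0))"
    using b by (simp add: flag_def fun_eq_iff un_snoc del: word_cells_nat replicate_Suc)
  define p2 where "p2 = ?P + 2"
  define p3 where "p3 = p2 + length (bin_digits num_abs) + 1"
  define p4 where "p4 = p3 + length (bin_digits den) + 1"
  have d2: "drop p2 word = bin_digits num_abs @ 3 # bin_digits den @ [3]"
    using arg_cong[OF d1, of "drop 1"] by (simp add: tail_eq p2_def)
  have 4: "run 2 (read_binary 20) (\<sigma>(4 := un p2, 22 := flag (mac_num I < 0))) =
      \<sigma>(4 := un p3, 22 := flag (mac_num I < 0), 20 := bin_digits num_abs)"
    by (subst run_read_binary[of p2 _ "bin_digits num_abs" "bin_digits den @ [3]"])
      (use d2 b digits_cap set_bin_digits in \<open>auto simp: fun_eq_iff p3_def\<close>)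
  have d3: "drop p3 word = bin_digits den @ 3 # []"
    using arg_cong[OF d2, of "drop (length (bin_digits num_abs) + 1)"] by (simp add: p3_def ac_simps)
  have 5: "run 2 (read_binary 21) (\<sigma>(4 := un p3, 22 := flag (mac_num I < 0), 20 := bin_digits num_abs)) =
      \<sigma>(4 := un p4, 22 := flag (mac_num I < 0), 20 := bin_digits num_abs, 21 := bin_digits den)"
    by (subst run_read_binary[of p3 _ "bin_digits den" "[]"])
      (use d3 b digits_cap set_bin_digits in \<open>auto simp: fun_eq_iff p4_def\<close>)
  show ?thesis
    unfolding parse_prog_def run.simps(6) 1 2 3 p2_def[symmetric] 4 5 using b by (simp add: fun_eq_iff)
qed

end

definition cap_prog :: com where
  "cap_prog = For 0 (apps 32 2 1) ;; apps 32 2 1"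

definition reduction_prog :: com where
  "reduction_prog = setup_prog ;; emitv 5 3 ;; clique_prog ;; for_edges cross_body ;; App 1 4 ;;
     for_edges forest_body ;; tree_prog ;; App 1 4 ;; parse_prog ;; compare_prog ;; number_prog"

context valid_mac begin

definition numbers :: "store \<Rightarrow> bool" where
  "numbers \<sigma> \<longleftrightarrow> \<sigma> 2 = un cap \<and> \<sigma> 3 = [] \<and> \<sigma> 6 = un m \<and> \<sigma> 11 = [] \<and> \<sigma> 20 = bin_digits num_abs \<and>
     \<sigma> 21 = bin_digits den \<and> \<sigma> 22 = flag (mac_num I < 0) \<and> \<sigma> 24 = [] \<and> \<sigma> 25 = [] \<and> \<sigma> 26 = [] \<and> \<sigma> 27 = []"

lemma cap_ge_length: "length word + 3 \<le> cap"
  by (simp add: cap_def)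

text \<open>\<open>cap\<close> digits hold all numbers involved, so loops over \<open>cap\<close>
  digits compute exactly and reductions modulo \<open>2 ^ cap\<close> disappear.\<close>

lemma values_less: "num_abs < 2 ^ cap" "den < 2 ^ cap" "3 * den + num_abs < 2 ^ cap"
proof -
  have "(2 :: nat) ^ (length word + 3) \<le> 2 ^ cap" using cap_ge_length by (intro power_increasing) auto
  then have "8 * 2 ^ length word \<le> (2 :: nat) ^ cap" by (simp add: power_add)
  then show "num_abs < 2 ^ cap" "den < 2 ^ cap" "3 * den + num_abs < 2 ^ cap" using digits_cap(3,4) by linarith+
qed

lemma run_compare_prog:
  assumes "numbers \<sigma>" "\<sigma> 23 = []"
  shows "run 2 compare_prog \<sigma> = \<sigma>(23 := flag (mac_num I > int den))"
proof (cases "mac_num I < 0")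
  case True
  then show ?thesis using assms by (simp add: compare_prog_def numbers_def flag_def fun_eq_iff)
next
  case False
  note b = assms(1)[unfolded numbers_def] assms(2)
  let ?c = "IfAt 20 11 2 (IfAt 21 11 2 Skip (Clear 23 ;; App 23 1)) (IfAt 21 11 2 (Clear 23) Skip) ;; App 11 1"
  let ?S = "\<lambda>t. \<sigma>(23 := flag (num_abs mod 2 ^ t > den mod 2 ^ t), 11 := un t)"
  have 1: "run 2 (For 2 ?c) \<sigma> = ?S cap"
  proof (rule run_For[where S = ?S])
    have "?S 0 = \<sigma>" using b by (auto simp: fun_eq_iff flag_def)
    then show "run 2 (For 2 ?c) \<sigma> = run 2 (For 2 ?c) (?S 0)" by simp
    fix t
    let ?x = "num_abs mod 2 ^ t" and ?y = "den mod 2 ^ t"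
    have "?x < 2 ^ t" "?y < 2 ^ t" by simp_all
    then have lt: "?y < ?x + 2 ^ t" "\<not> ?y + 2 ^ t < ?x" by linarith+
    show "run 2 ?c (?S t) = ?S (Suc t)"
      using b lt bin_digits_nth[of num_abs t] bin_digits_nth[of den t]
      by (cases "odd (num_abs div 2 ^ t)"; cases "odd (den div 2 ^ t)")
        (simp_all add: mod_power_Suc fun_eq_iff flag_def un_snoc del: word_cells_nat replicate_Suc power_Suc)
  qed (use b in auto)
  have "num_abs > den \<longleftrightarrow> mac_num I > int den" using False by (auto simp: num_abs_def)
  then have "?S cap = \<sigma>(23 := flag (mac_num I > int den), 11 := un cap)"
    using values_less by simp
  moreover have "run 2 compare_prog \<sigma> = run 2 (For 2 ?c ;; Clear 11) \<sigma>"
    using b False by (simp add: compare_prog_def flag_def)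
  ultimately show ?thesis using 1 b by (simp add: fun_eq_iff)
qed

definition sgn_num :: int where
  "sgn_num = (if mac_num I < 0 then -1 else 1)"

lemma num_eq: "mac_num I = sgn_num * int num_abs"
  by (simp add: sgn_num_def num_abs_def)

text \<open>With \<open>c\<close> equal to the carry plus one, the extra one added here makes
  \<open>c'\<close> exceed the true digit sum by 2. Hence \<open>c' mod 2\<close> is the digit to be
  written and \<open>c' div 2\<close> is again the next carry plus one.\<close>

lemma run_add_digits:
  assumes "\<sigma> 3 = []" "\<sigma> 11 = un t" "\<sigma> 20 = bin_digits num_abs" "\<sigma> 21 = bin_digits den" "\<sigma> 22 = flag (mac_num I < 0)"
    "\<sigma> 24 = un c"
  shows "\<exists>c'. run 2 add_digits \<sigma> = \<sigma>(24 := un c') \<and> c' \<le> c + 5 \<and>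
    int c' = int c + 1 + 3 * of_bool (odd (den div 2 ^ t)) + sgn_num * of_bool (odd (num_abs div 2 ^ t))"
proof -
  let ?c = "c + (if odd (den div 2 ^ t) then 3 else 0) +
    (if mac_num I < 0 then (if odd (num_abs div 2 ^ t) then 0 else 1) else (if odd (num_abs div 2 ^ t) then 2 else 1))"
  have "run 2 add_digits \<sigma> = \<sigma>(24 := un ?c)"
    using assms bin_digits_nth[of num_abs t] bin_digits_nth[of den t]
    by (cases "odd (num_abs div 2 ^ t)"; cases "odd (den div 2 ^ t)"; cases "mac_num I < 0")
      (simp_all add: add_digits_def flag_def fun_eq_iff replicate_add[symmetric] un_snoc
        del: word_cells_nat replicate_Suc replicate.simps)
  moreover have "?c \<le> c + 5" by simp
  moreover have "int ?c = int c + 1 + 3 * of_bool (odd (den div 2 ^ t)) + sgn_num * of_bool (odd (num_abs div 2 ^ t))"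
    by (simp add: sgn_num_def)
  ultimately show ?thesis by blast
qed

lemma run_write_digit:
  assumes "\<sigma> 26 = un (b mod 2)" "\<sigma> 27 = un (t - length (bin_digits x))" "\<sigma> 3 = []" "x < 2 ^ t" "t \<le> length (\<sigma> 2)"
    and "\<sigma> 1 = z @ bin_digits x"
  shows "run 2 write_digit \<sigma> = \<sigma>(1 := z @ bin_digits (x + 2 ^ t * (b mod 2)),
    26 := [], 27 := un (Suc t - length (bin_digits (x + 2 ^ t * (b mod 2)))))"
proof (cases "odd b")
  case True
  then have b1: "b mod 2 = 1" by presburger
  have l: "length (bin_digits x) \<le> t" using assms(4) by (rule length_bin_digits)
  have "run 2 (For 27 (App 1 1)) \<sigma> = \<sigma>(1 := \<sigma> 1 @ replicate (t - length (bin_digits x)) 1)"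
    using assms(2,5) by (subst run_For_App) simp_all
  then show ?thesis
    using assms b1 bin_digits_add_power[OF assms(4)] l by (simp add: write_digit_def fun_eq_iff)
next
  case False
  then have b0: "b mod 2 = 0" by presburger
  have l: "length (bin_digits x) \<le> t" using assms(4) by (rule length_bin_digits)
  then have "Suc t - length (bin_digits x) = Suc (t - length (bin_digits x))" by simp
  then show ?thesis
    using assms b0 by (simp add: write_digit_def fun_eq_iff un_snoc del: replicate_Suc)
qed

text \<open>\<open>int c - 1\<close> is the current carry. The initially empty word 24 means carry
  -1, which accounts for the summand -1 of 3 * d + c - 1.\<close>

lemma run_add_loop:
  assumes "numbers \<sigma>" "t \<le> cap"
  shows "\<exists>x c. (run 2 (add_digits ;; halve ;; write_digit ;; App 11 1) ^^ t) \<sigma> =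
      \<sigma>(1 := \<sigma> 1 @ bin_digits x, 11 := un t, 24 := un c, 27 := un (t - length (bin_digits x))) \<and> x < 2 ^ t \<and> c \<le> 5 \<and>
      int x + 2 ^ t * (int c - 1) = 3 * int (den mod 2 ^ t) + sgn_num * int (num_abs mod 2 ^ t) - 1"
  using assms(2)
proof (induction t)
  case 0
  then show ?case using assms(1)
    by (intro exI[of _ 0]) (auto simp: numbers_def fun_eq_iff)
next
  case (Suc t)
  note b = assms(1)[unfolded numbers_def]
  obtain x c where run: "(run 2 (add_digits ;; halve ;; write_digit ;; App 11 1) ^^ t) \<sigma> =
      \<sigma>(1 := \<sigma> 1 @ bin_digits x, 11 := un t, 24 := un c, 27 := un (t - length (bin_digits x)))"
    and x: "x < 2 ^ t" and c: "c \<le> 5"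
    and eq: "int x + 2 ^ t * (int c - 1) = 3 * int (den mod 2 ^ t) + sgn_num * int (num_abs mod 2 ^ t) - 1"
    using Suc.IH[OF Suc_leD[OF Suc.prems]] by blast
  define \<tau> where "\<tau> = \<sigma>(1 := \<sigma> 1 @ bin_digits x, 11 := un t, 24 := un c, 27 := un (t - length (bin_digits x)))"
  obtain c' where c': "run 2 add_digits \<tau> = \<tau>(24 := un c')" "c' \<le> c + 5"
    "int c' = int c + 1 + 3 * of_bool (odd (den div 2 ^ t)) + sgn_num * of_bool (odd (num_abs div 2 ^ t))"
    using run_add_digits[of \<tau> t c] b by (auto simp: \<tau>_def)
  have "c' \<le> cap" using c c'(2) by (simp add: cap_def)
  then have 2: "run 2 halve (\<tau>(24 := un c')) = \<tau>(24 := un (c' div 2), 26 := un (c' mod 2))"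
    by (subst run_halve[where t = c']) (use b in \<open>simp_all add: \<tau>_def\<close>)
  let ?y = "x + 2 ^ t * (c' mod 2)"
  have 3: "run 2 write_digit (\<tau>(24 := un (c' div 2), 26 := un (c' mod 2))) =
      \<tau>(24 := un (c' div 2), 1 := \<sigma> 1 @ bin_digits ?y, 26 := [], 27 := un (Suc t - length (bin_digits ?y)))"
    by (subst run_write_digit[where b = c' and t = t and x = x and z = "\<sigma> 1"])
      (use b x Suc.prems in \<open>simp_all add: \<tau>_def fun_eq_iff\<close>)
  have 4: "run 2 (App 11 1) (\<tau>(24 := un (c' div 2), 1 := \<sigma> 1 @ bin_digits ?y, 26 := [], 27 := un (Suc t - length (bin_digits ?y)))) =
      \<sigma>(1 := \<sigma> 1 @ bin_digits ?y, 11 := un (Suc t), 24 := un (c' div 2), 27 := un (Suc t - length (bin_digits ?y)))"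
    using b by (simp add: \<tau>_def fun_eq_iff un_snoc del: replicate_Suc)
  have "(run 2 (add_digits ;; halve ;; write_digit ;; App 11 1) ^^ Suc t) \<sigma> =
      \<sigma>(1 := \<sigma> 1 @ bin_digits ?y, 11 := un (Suc t), 24 := un (c' div 2), 27 := un (Suc t - length (bin_digits ?y)))"
    unfolding funpow.simps(2) o_apply run \<tau>_def[symmetric] run.simps(6) c'(1) 2 3 4 ..
  moreover have "?y < 2 ^ Suc t"
  proof -
    have "2 ^ t * (c' mod 2) \<le> 2 ^ t * 1" by (rule mult_left_mono) auto
    then show ?thesis using x unfolding power_Suc by linarith
  qed
  moreover have "c' div 2 \<le> 5" using c c'(2) by linarith
  moreover have "int ?y + 2 ^ Suc t * (int (c' div 2) - 1) =
      3 * int (den mod 2 ^ Suc t) + sgn_num * int (num_abs mod 2 ^ Suc t) - 1"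
  proof -
    have "int c' = int (c' mod 2 + 2 * (c' div 2))" by (simp only: mod_mult_div_eq)
    then have c2: "int c' = int (c' mod 2) + 2 * int (c' div 2)" by (simp only: of_nat_add of_nat_mult of_nat_numeral)
    have "int ?y + 2 ^ Suc t * (int (c' div 2) - 1) = int x + 2 ^ t * (int c' - 2)"
      unfolding c2 by (simp add: algebra_simps)
    also have "\<dots> = (int x + 2 ^ t * (int c - 1)) + 2 ^ t * (3 * of_bool (odd (den div 2 ^ t)) + sgn_num * of_bool (odd (num_abs div 2 ^ t)))"
      unfolding c'(3) by (simp add: algebra_simps)
    also have "\<dots> = 3 * int (den mod 2 ^ Suc t) + sgn_num * int (num_abs mod 2 ^ Suc t) - 1"
      unfolding eq mod_power_Suc by (auto simp: algebra_simps)
    finally show ?thesis .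
  qed
  ultimately show ?case by blast
qed

lemma run_copy_denominator:
  assumes "\<sigma> 2 = un cap" "\<sigma> 21 = bin_digits den" "\<sigma> 11 = []"
  shows "run 2 copy_denominator \<sigma> = \<sigma>(1 := \<sigma> 1 @ bin_digits den)"
proof -
  let ?c = "IfAt 21 11 2 (App 1 2) (App 1 1) ;; App 11 1"
  let ?S = "\<lambda>t. \<sigma>(1 := \<sigma> 1 @ take t (bin_digits den), 11 := un t)"
  have "run 2 (For 21 ?c) \<sigma> = ?S (length (bin_digits den))"
  proof (rule run_For[where S = ?S])
    have "?S 0 = \<sigma>" using assms by (auto simp: fun_eq_iff)
    then show "run 2 (For 21 ?c) \<sigma> = run 2 (For 21 ?c) (?S 0)" by simp
    fix t assume t: "t < length (bin_digits den)"
    then have "bin_digits den ! t = 1 \<or> bin_digits den ! t = 2"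
      using set_bin_digits nth_mem by blast
    then show "run 2 ?c (?S t) = ?S (Suc t)"
      using assms t by (auto simp: fun_eq_iff un_snoc take_Suc_conv_app_nth simp del: replicate_Suc)
  qed (use assms digits_cap(2) in auto)
  then show ?thesis using assms by (simp add: copy_denominator_def fun_eq_iff)
qed

lemma run_number_prog:
  assumes "numbers \<sigma>" "\<sigma> 23 = flag (mac_num I > int den)"
  shows "run 2 number_prog \<sigma> 1 = \<sigma> 1 @ enc_binary (ttv_num J) @ enc_binary (ttv_den J)"
proof (cases "mac_num I > int den")
  case True
  have "bin_digits 1 = [2]" by (simp add: bin_digits_pos)
  then show ?thesis
    using assms True by (simp add: number_prog_def numbers_def flag_def thin_tree_instance_def enc_binary_def)
next
  case False
  note b = assms(1)[unfolded numbers_def] cap_ge(2)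
  let ?c = "add_digits ;; halve ;; write_digit ;; App 11 1"
  define \<tau> where "\<tau> = \<sigma>(1 := \<sigma> 1 @ replicate m 2)"
  have 1: "run 2 (For 6 (App 1 2)) \<sigma> = \<tau>"
    using b by (subst run_For_App) (simp_all add: \<tau>_def)
  have nt: "numbers \<tau>" using assms(1) by (simp add: numbers_def \<tau>_def)
  obtain x c where run: "(run 2 ?c ^^ cap) \<tau> =
      \<tau>(1 := \<tau> 1 @ bin_digits x, 11 := un cap, 24 := un c, 27 := un (cap - length (bin_digits x)))"
    and x: "x < 2 ^ cap"
    and eq: "int x + 2 ^ cap * (int c - 1) = 3 * int (den mod 2 ^ cap) + sgn_num * int (num_abs mod 2 ^ cap) - 1"
    using run_add_loop[OF nt order_refl] by blast
  have eq: "int x + 2 ^ cap * (int c - 1) = 3 * int den + mac_num I - 1"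
    using eq values_less by (simp add: num_eq)
  have ge: "0 \<le> 3 * int den + mac_num I - 1" using num_ge den_pos by linarith
  have "3 * int den + mac_num I - 1 < 2 ^ cap"
  proof -
    have "int (3 * den + num_abs) < int (2 ^ cap)" using values_less(3) by (simp only: of_nat_less_iff)
    then show ?thesis by (simp add: num_abs_def)
  qed
  \<comment> \<open>The result is not negative and fits into \<open>cap\<close> digits, so the final
    carry \<open>int c - 1\<close> is 0.\<close>
  then have c: "int c = 1"
  proof -
    assume lt: "3 * int den + mac_num I - 1 < 2 ^ cap"
    have "int x < 2 ^ cap" using x by (metis of_nat_less_iff of_nat_numeral of_nat_power)
    consider "int c \<le> 0" | "int c = 1" | "2 \<le> int c" by linarith
    then show ?thesis
    proof cases
      case 1
      then have "2 ^ cap * (int c - 1) \<le> 2 ^ cap * (- 1)" by (intro mult_left_mono) auto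
      then show ?thesis using eq ge \<open>int x < 2 ^ cap\<close> by linarith
    next
      case 3
      then have "2 ^ cap * 1 \<le> 2 ^ cap * (int c - 1)" by (intro mult_left_mono) auto
      then show ?thesis using eq lt by linarith
    qed
  qed
  then have xeq: "int x = 3 * int den + mac_num I - 1" using eq by simp
  have 2: "run 2 (For 2 ?c) \<tau> =
      \<tau>(1 := \<tau> 1 @ bin_digits x, 11 := un cap, 24 := un c, 27 := un (cap - length (bin_digits x)))"
    using run b by (simp add: run.simps(7) \<tau>_def)
  define \<rho> where "\<rho> = \<tau>(1 := \<tau> 1 @ bin_digits x @ [3] @ replicate m 1 @ [1, 1], 11 := [], 24 := un c, 27 := un (cap - length (bin_digits x)))"
  have 3: "run 2 (apps 2 1 1) (run 2 (For 6 (App 1 1)) (run 2 (App 1 3) (run 2 (Clear 11)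
      (\<tau>(1 := \<tau> 1 @ bin_digits x, 11 := un cap, 24 := un c, 27 := un (cap - length (bin_digits x))))))) = \<rho>"
    using b by (simp add: run_For_App \<tau>_def \<rho>_def fun_eq_iff numeral_2_eq_2)
  have 4: "run 2 copy_denominator \<rho> = \<rho>(1 := \<rho> 1 @ bin_digits den)"
    by (rule run_copy_denominator) (use b in \<open>simp_all add: \<rho>_def \<tau>_def\<close>)
  have "run 2 number_prog \<sigma> = run 2 (For 6 (App 1 2) ;; For 2 ?c ;; Clear 11 ;; App 1 3 ;;
      For 6 (App 1 1) ;; apps 2 1 1 ;; copy_denominator ;; App 1 3) \<sigma>"
    using assms b False by (simp add: number_prog_def flag_def)
  also have "\<dots> = run 2 (App 1 3) (\<rho>(1 := \<rho> 1 @ bin_digits den))"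
    unfolding run.simps(6) 1 2 3 4 ..
  finally have out: "run 2 number_prog \<sigma> 1 = \<sigma> 1 @ (replicate m 2 @ bin_digits x) @ [3] @ (replicate m 1 @ [1, 1] @ bin_digits den) @ [3]"
    by (simp add: \<rho>_def \<tau>_def)
  have rep: "replicate (m + 2) (1 :: nat) = replicate m 1 @ [1, 1]"
    unfolding replicate_add by (simp add: numeral_2_eq_2)
  have "ttv_num J = (x + 1) * 2 ^ m - 1"
  proof -
    have "(3 * int den + mac_num I) * 2 ^ m - 1 = int ((x + 1) * 2 ^ m) - 1"
    proof -
      have "3 * int den + mac_num I = int (x + 1)" using xeq by simp
      then show ?thesis by (simp only: of_nat_mult of_nat_power of_nat_numeral)
    qed
    also have "\<dots> = int ((x + 1) * 2 ^ m - 1)" using mult_le_mono[of 1 "x + 1" 1 "2 ^ m"] by simp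
    finally have "nat ((3 * int den + mac_num I) * 2 ^ m - 1) = (x + 1) * 2 ^ m - 1" by simp
    then show ?thesis using False by (simp add: thin_tree_instance_def)
  qed
  then have num: "bin_digits (ttv_num J) = replicate m 2 @ bin_digits x" using bin_digits_shift_ones[of x m] by simp
  have "ttv_den J = den * 2 ^ (m + 2)" using False by (simp add: thin_tree_instance_def)
  then have den: "bin_digits (ttv_den J) = replicate (m + 2) 1 @ bin_digits den" using bin_digits_shift[OF den_pos, of "m + 2"] by simp
  show ?thesis unfolding out enc_binary_def num den rep by simp
qed

lemma run_reduction_prog: "run 2 reduction_prog (run 0 cap_prog (\<lambda>i. if i = 0 then word else [])) 1 = enc_ttv J"
proof -
  have cap: "run 0 cap_prog (\<lambda>i. if i = 0 then word else []) = store0"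
  proof -
    have "run 0 (For 0 (apps 32 2 1)) (\<lambda>i. if i = 0 then word else []) =
        (\<lambda>i. if i = 0 then word else [])(2 := un (length word * 32))"
      by (subst run_For_apps) simp_all
    then show ?thesis
      unfolding cap_prog_def run.simps(6) by (simp add: run_apps store0_def cap_def fun_eq_iff del: apps.simps flip: replicate_add)
  qed
  have b: "base (store1(1 := z))" for z by (simp add: base_def store1_def store0_def)
  have t: "(store1(1 := z)) i = []" if "i \<ge> 15" for z i using that by (simp add: store1_def store0_def)
  have b': "base store1" by (simp add: base_def store1_def store0_def)
  have 1: "run 2 (emitv 5 3) store1 = store1(1 := enc_unary (n * B))"
    by (subst run_emitv) (use cap_ge(1,3) in \<open>simp_all add: store1_def store0_def fun_eq_iff\<close>)
  have 2: "run 2 clique_prog (store1(1 := z)) = store1(1 := z @ concat (map enc_edge (clique_edges I)))" for z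
    using run_clique_prog[of "store1(1 := z)"] b t by simp
  have 3: "run 2 (for_edges cross_body) (store1(1 := z)) =
      store1(1 := z @ concat (map (\<lambda>i. concat (map enc_edge (cross_edges I i))) [0..<m]))" for z
    using run_for_edges_emit[of "store1(1 := z)" cross_body "\<lambda>i. concat (map enc_edge (cross_edges I i))"]
      b[of z, unfolded base_def] run_cross_body[OF b'] by simp
  have 4: "run 2 (for_edges forest_body) (store1(1 := z)) =
      store1(1 := z @ concat (map (\<lambda>i. concat (map enc_edge (forest_edges I i))) [0..<m]))" for z
    using run_for_edges_emit[of "store1(1 := z)" forest_body "\<lambda>i. concat (map enc_edge (forest_edges I i))"]
      b[of z, unfolded base_def] run_forest_body[OF b'] by simp
  have 5: "run 2 tree_prog (store1(1 := z)) = store1(1 := z @ concat (map (\<lambda>a. concat (map enc_edge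
     (concat (map (slot_edges I a) [0..<m]) @ path_edges I a))) [0..<n]))" for z
    using run_tree_prog[of "store1(1 := z)"] b t by simp
  have 6: "run 2 (App 1 4) (store1(1 := z)) = store1(1 := z @ [4])" for z by simp
  have H: "concat (map enc_edge (graph_edges I)) = concat (map enc_edge (clique_edges I)) @
      concat (map (\<lambda>i. concat (map enc_edge (cross_edges I i))) [0..<m])"
    by (simp add: graph_edges_def map_concat concat_concat comp_def)
  have T: "concat (map enc_edge (tree_edges I)) = concat (map (\<lambda>i. concat (map enc_edge (forest_edges I i))) [0..<m]) @
      concat (map (\<lambda>a. concat (map enc_edge (concat (map (slot_edges I a) [0..<m]) @ path_edges I a))) [0..<n])"
    by (simp add: tree_edges_def map_concat concat_concat comp_def)
  define z where "z = enc_unary (n * B) @ enc_list enc_edge (graph_edges I) @ enc_list enc_edge (tree_edges I)"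
  define \<tau> where "\<tau> = (store1(1 := z))(20 := bin_digits num_abs, 21 := bin_digits den, 22 := flag (mac_num I < 0))"
  have 7: "run 2 parse_prog (store1(1 := z)) = \<tau>"
    unfolding \<tau>_def by (rule run_parse_prog) (use b t in simp_all)
  have nt: "numbers \<tau>" "\<tau> 23 = []" by (simp_all add: numbers_def \<tau>_def store1_def store0_def)
  have "run 2 reduction_prog store0 = run 2 number_prog (run 2 compare_prog (run 2 parse_prog
      (store1(1 := ((((enc_unary (n * B) @ concat (map enc_edge (clique_edges I))) @
        concat (map (\<lambda>i. concat (map enc_edge (cross_edges I i))) [0..<m])) @ [4]) @
        concat (map (\<lambda>i. concat (map enc_edge (forest_edges I i))) [0..<m])) @
        concat (map (\<lambda>a. concat (map enc_edge (concat (map (slot_edges I a) [0..<m]) @ path_edges I a))) [0..<n]) @ [4]))))"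
    unfolding reduction_prog_def run.simps(6) run_setup 1 2 3 4 5 6 append_assoc ..
  also have "\<dots> = run 2 number_prog (run 2 compare_prog (run 2 parse_prog (store1(1 := z))))"
    by (simp only: z_def enc_list_def H T append_assoc)
  finally have "run 2 reduction_prog store0 1 = run 2 number_prog (\<tau>(23 := flag (mac_num I > int den))) 1"
    unfolding 7 run_compare_prog[OF nt] by simp
  also have "\<dots> = (\<tau>(23 := flag (mac_num I > int den))) 1 @ enc_binary (ttv_num J) @ enc_binary (ttv_den J)"
    by (rule run_number_prog) (use nt in \<open>simp_all add: numbers_def\<close>)
  also have "\<dots> = enc_ttv J"
    by (simp add: \<tau>_def z_def enc_ttv_def thin_tree_instance_def)
  finally show ?thesis unfolding cap .
qed

end

lemma set_enc_unary: "set (enc_unary k) \<subseteq> {2, 3}"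
  by (auto simp: enc_unary_def)

lemma set_enc_binary: "set (enc_binary k) \<subseteq> {1, 2, 3}"
  using set_bin_digits[of k] by (auto simp: enc_binary_def)

lemma set_enc_mac: "set (enc_mac I) \<subseteq> {0<..<5}"
  using set_enc_unary set_enc_binary
  by (fastforce simp: enc_mac_def enc_list_def enc_wedge_def enc_int_def split: prod.splits if_splits)

lemma set_enc_ttv: "set (enc_ttv J) \<subseteq> {0<..<5}"
  using set_enc_unary set_enc_binary
  by (fastforce simp: enc_ttv_def enc_list_def enc_edge_def split: prod.splits)

text \<open>The programs use the words 0 to 27 and the symbols 0 to 4.\<close>

lemma wf_progs: "wfc 28 5 0 cap_prog" "wfc 28 5 2 reduction_prog"
  by (simp_all add: cap_prog_def reduction_prog_def setup_prog_def read_unary_def for_edges_def grow_body_def emitv_def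
      clique_prog_def cross_body_def if_neq_def forest_body_def tree_prog_def slots_body_def parent_prog_def
      parse_prog_def read_binary_def compare_prog_def number_prog_def add_digits_def halve_def write_digit_def copy_denominator_def)

theorem theorem4:
  shows "karp_reducible MaxAvgCut ThinTreeValid_C"
  unfolding karp_reducible_def
proof (intro exI[of _ thin_tree_instance] conjI ballI)
  fix I assume "I \<in> instances MaxAvgCut"
  then interpret valid_mac I by unfold_locales (simp add: MaxAvgCut_def)
  show "thin_tree_instance I \<in> instances ThinTreeValid_C"
    using valid_J by (simp add: ThinTreeValid_C_def)
  show "I \<in> yes_instances MaxAvgCut \<longleftrightarrow> thin_tree_instance I \<in> yes_instances ThinTreeValid_C"
    using valid_J valid yes_iff by (simp add: ThinTreeValid_C_def MaxAvgCut_def)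
next
  have "run 2 reduction_prog (run 0 cap_prog (\<lambda>i. if i = 0 then enc_mac I else [])) 1 = enc_ttv (thin_tree_instance I)"
    if "I \<in> instances MaxAvgCut" for I
  proof -
    interpret valid_mac I using that by unfold_locales (simp add: MaxAvgCut_def)
    show ?thesis using run_reduction_prog unfolding word_def .
  qed
  then have "polytime_computable thin_tree_instance (instances MaxAvgCut) enc_mac enc_ttv"
    by (intro polytime_computable_run[OF wf_progs]) (simp_all add: set_enc_mac set_enc_ttv)
  then show "polytime_computable thin_tree_instance (instances MaxAvgCut) (encode MaxAvgCut) (encode ThinTreeValid_C)"
    by (simp add: MaxAvgCut_def ThinTreeValid_C_def)
qed

end
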